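(* Let $H$ be a finite dimensional basic hereditary algebra over an algebraically closed field $k$ and let $\Lambda=\begin{pmatrix} H & 0\\ \mathrm{D}H & H\end{pmatrix}$ be its duplicated algebra. If $X$ is an indecomposable finitely generated left $\Lambda$-module with projective dimension $\mathrm{pd}_\Lambda X=1$, then $X\in\mathcal L_\Lambda$.
   Context: $\mathrm{D}=\operatorname{Hom}_k(-,k)$. The duplicated algebra of $H$ is the triangular matrix algebra $\Lambda=\begin{pmatrix} H & 0\\ \mathrm{D}H & H\end{pmatrix}$. $\operatorname{ind}\Lambda$ denotes the full subcategory of the category $\operatorname{mod}\Lambda$ of finitely generated left modules whose objects are a chosen set of representatives of the isomorphism classes of indecomposable $\Lambda$-modules. A path from $Y$ to $X$ in $\operatorname{ind}\Lambda$ is a sequence of nonzero morphisms $Y\to X_1\to X_2\to\cdots\to X_t\to X$ with all $X_i\in\operatorname{ind}\Lambda$; if such a path exists, $Y$ is called a predecessor of $X$. The left part is $\mathcal L_\Lambda=\{X\in\operatorname{ind}\Lambda : \mathrm{pd}_\Lambda Y\le 1\text{ for every predecessor }Y\text{ of }X\}$. *)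

theory Defs
  imports "HOL-Algebra.Algebraic_Closure" "HOL-Library.Extended_Nat"
begin

text \<open>Polynomial rings reserve the letter \<open>X\<close> for the indeterminate.\<close>

no_notation var (\<open>X\<index>\<close>)

section \<open>Left modules over a not necessarily commutative ring\<close>

text \<open>The library locale \<^locale>\<open>module\<close> requires a commutative ring of scalars. As there, only the
  additive part and the scalar multiplication of the record \<open>M\<close> are relevant; its fields \<open>mult\<close> and
  \<open>one\<close> are ignored. The library predicate \<^const>\<open>submodule\<close> makes no commutativity
  assumption and is used as it is.\<close>

locale left_module = R?: ring R + M?: abelian_group M
  for R :: "('r, 'x) ring_scheme" (structure) and M :: "('r, 'm) module" (structure) +
  assumes smult_closed: "\<lbrakk>a \<in> carrier R; x \<in> carrier M\<rbrakk> \<Longrightarrow> a \<odot>\<^bsub>M\<^esub> x \<in> carrier M"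
    and smult_l_distr: "\<lbrakk>a \<in> carrier R; b \<in> carrier R; x \<in> carrier M\<rbrakk>
      \<Longrightarrow> (a \<oplus> b) \<odot>\<^bsub>M\<^esub> x = a \<odot>\<^bsub>M\<^esub> x \<oplus>\<^bsub>M\<^esub> b \<odot>\<^bsub>M\<^esub> x"
    and smult_r_distr: "\<lbrakk>a \<in> carrier R; x \<in> carrier M; y \<in> carrier M\<rbrakk>
      \<Longrightarrow> a \<odot>\<^bsub>M\<^esub> (x \<oplus>\<^bsub>M\<^esub> y) = a \<odot>\<^bsub>M\<^esub> x \<oplus>\<^bsub>M\<^esub> a \<odot>\<^bsub>M\<^esub> y"
    and smult_assoc1: "\<lbrakk>a \<in> carrier R; b \<in> carrier R; x \<in> carrier M\<rbrakk>
      \<Longrightarrow> (a \<otimes> b) \<odot>\<^bsub>M\<^esub> x = a \<odot>\<^bsub>M\<^esub> (b \<odot>\<^bsub>M\<^esub> x)"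
    and smult_one: "x \<in> carrier M \<Longrightarrow> \<one> \<odot>\<^bsub>M\<^esub> x = x"

definition lmod_hom ::
    "('r, 'x) ring_scheme \<Rightarrow> ('r, 'm) module \<Rightarrow> ('r, 'n) module \<Rightarrow> ('m \<Rightarrow> 'n) set"
  where "lmod_hom R M N = {f \<in> carrier M \<rightarrow> carrier N.
    (\<forall>x \<in> carrier M. \<forall>y \<in> carrier M. f (x \<oplus>\<^bsub>M\<^esub> y) = f x \<oplus>\<^bsub>N\<^esub> f y) \<and>
    (\<forall>a \<in> carrier R. \<forall>x \<in> carrier M. f (a \<odot>\<^bsub>M\<^esub> x) = a \<odot>\<^bsub>N\<^esub> f x)}"

definition lmod_iso ::
    "('r, 'x) ring_scheme \<Rightarrow> ('r, 'm) module \<Rightarrow> ('r, 'n) module \<Rightarrow> bool"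
  where "lmod_iso R M N \<longleftrightarrow> (\<exists>f \<in> lmod_hom R M N. bij_betw f (carrier M) (carrier N))"

definition finitely_generated :: "('r, 'x) ring_scheme \<Rightarrow> ('r, 'm) module \<Rightarrow> bool"
  where "finitely_generated R M \<longleftrightarrow> (\<exists>S. finite S \<and> S \<subseteq> carrier M \<and>
    (\<forall>N. submodule N R M \<longrightarrow> S \<subseteq> N \<longrightarrow> N = carrier M))"

definition fg_left_module :: "('r, 'x) ring_scheme \<Rightarrow> ('r, 'm) module \<Rightarrow> bool"
  where "fg_left_module R M \<longleftrightarrow> left_module R M \<and> finitely_generated R M"

definition indecomposable :: "('r, 'x) ring_scheme \<Rightarrow> ('r, 'm) module \<Rightarrow> bool"
  where "indecomposable R M \<longleftrightarrow> carrier M \<noteq> {\<zero>\<^bsub>M\<^esub>} \<and>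
    (\<forall>A B. submodule A R M \<longrightarrow> submodule B R M \<longrightarrow>
      A <+>\<^bsub>M\<^esub> B = carrier M \<longrightarrow> A \<inter> B = {\<zero>\<^bsub>M\<^esub>} \<longrightarrow> A = {\<zero>\<^bsub>M\<^esub>} \<or> B = {\<zero>\<^bsub>M\<^esub>})"

text \<open>A finitely generated \<open>R\<close>-module is a quotient of some \<open>R\<^sup>n\<close>, hence is isomorphic
  to a module whose carrier is a subset of the type \<^typ>\<open>nat \<Rightarrow> 'r\<close>. The following type is
  therefore large enough to quantify over the category \<open>mod R\<close> of all finitely generated left
  \<open>R\<close>-modules.\<close>

type_synonym 'r small_module = "('r, nat \<Rightarrow> 'r) module"

text \<open>Projective objects of \<open>mod R\<close>: finitely generated modules that have the lifting property
  for all epimorphisms of \<open>mod R\<close>.\<close>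

definition projective :: "('r, 'x) ring_scheme \<Rightarrow> ('r, 'p) module \<Rightarrow> bool"
  where "projective R P \<longleftrightarrow> fg_left_module R P \<and>
    (\<forall>(M :: 'r small_module) (N :: 'r small_module). \<forall>g \<in> lmod_hom R M N. \<forall>f \<in> lmod_hom R P N.
      fg_left_module R M \<longrightarrow> fg_left_module R N \<longrightarrow> g ` carrier M = carrier N \<longrightarrow>
      (\<exists>h \<in> lmod_hom R P M. \<forall>x \<in> carrier P. g (h x) = f x))"

text \<open>An exact sequence \<open>0 \<rightarrow> P\<^sub>n \<rightarrow> \<dots> \<rightarrow> P\<^sub>1 \<rightarrow> P\<^sub>0 \<rightarrow> X \<rightarrow> 0\<close> with projective \<open>P\<^sub>i\<close>, extended by
  \<open>P\<^sub>i = 0\<close> for \<open>i > n\<close>; \<open>d i\<close> is the map \<open>P\<^bsub>i+1\<^esub> \<rightarrow> P\<^sub>i\<close>.\<close>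

definition has_projective_resolution ::
    "('r, 'x) ring_scheme \<Rightarrow> ('r, 'm) module \<Rightarrow> nat \<Rightarrow> bool"
  where "has_projective_resolution R X n \<longleftrightarrow>
    (\<exists>(P :: nat \<Rightarrow> 'r small_module) d \<epsilon>.
      (\<forall>i. projective R (P i)) \<and>
      (\<forall>i > n. carrier (P i) = {\<zero>\<^bsub>P i\<^esub>}) \<and>
      (\<forall>i. d i \<in> lmod_hom R (P (Suc i)) (P i)) \<and>
      \<epsilon> \<in> lmod_hom R (P 0) X \<and>
      \<epsilon> ` carrier (P 0) = carrier X \<and>
      d 0 ` carrier (P 1) = a_kernel (P 0) X \<epsilon> \<and>
      (\<forall>i. d (Suc i) ` carrier (P (Suc (Suc i))) = a_kernel (P (Suc i)) (P i) (d i)))"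

text \<open>The infimum of the empty set is \<open>\<infinity>\<close>.\<close>

definition pd :: "('r, 'x) ring_scheme \<Rightarrow> ('r, 'm) module \<Rightarrow> enat"
  where "pd R X = Inf (enat ` {n. has_projective_resolution R X n})"

section \<open>The left part\<close>

text \<open>\<open>I\<close> is a set of representatives of the isomorphism classes of indecomposable finitely
  generated left \<open>R\<close>-modules, that is, a choice of the objects of \<open>ind R\<close>. That an arbitrary module belongs
  to \<open>left_part R I\<close> means that its representative in \<open>I\<close> does.\<close>

definition ind_representatives :: "('r, 'x) ring_scheme \<Rightarrow> 'r small_module set \<Rightarrow> bool"
  where "ind_representatives R I \<longleftrightarrow>
    (\<forall>M \<in> I. fg_left_module R M \<and> indecomposable R M) \<and>
    (\<forall>M :: 'r small_module. fg_left_module R M \<longrightarrow> indecomposable R M \<longrightarrow>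
      (\<exists>!N. N \<in> I \<and> lmod_iso R M N))"

definition nonzero_morphism_rel ::
    "('r, 'x) ring_scheme \<Rightarrow> 'r small_module set \<Rightarrow> 'r small_module rel"
  where "nonzero_morphism_rel R I =
    {(M, N). M \<in> I \<and> N \<in> I \<and> (\<exists>f \<in> lmod_hom R M N. \<exists>x \<in> carrier M. f x \<noteq> \<zero>\<^bsub>N\<^esub>)}"

definition predecessor ::
    "('r, 'x) ring_scheme \<Rightarrow> 'r small_module set \<Rightarrow> 'r small_module \<Rightarrow> 'r small_module \<Rightarrow> bool"
  where "predecessor R I Y X \<longleftrightarrow> (Y, X) \<in> (nonzero_morphism_rel R I)\<^sup>+"

definition left_part :: "('r, 'x) ring_scheme \<Rightarrow> 'r small_module set \<Rightarrow> 'r small_module set"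
  where "left_part R I = {X \<in> I. \<forall>Y \<in> I. predecessor R I Y X \<longrightarrow> pd R Y \<le> 1}"

section \<open>Finite dimensional basic hereditary algebras\<close>

text \<open>Associative unital algebras; the library locale \<^locale>\<open>algebra\<close> covers only commutative ones.\<close>

locale assoc_algebra = module K A + A?: ring A
  for K :: "('k, 'x) ring_scheme" and A :: "('k, 'h) module" (structure) +
  assumes smult_mult_left: "\<lbrakk>c \<in> carrier K; x \<in> carrier A; y \<in> carrier A\<rbrakk>
      \<Longrightarrow> (c \<odot>\<^bsub>A\<^esub> x) \<otimes>\<^bsub>A\<^esub> y = c \<odot>\<^bsub>A\<^esub> (x \<otimes>\<^bsub>A\<^esub> y)"
    and smult_mult_right: "\<lbrakk>c \<in> carrier K; x \<in> carrier A; y \<in> carrier A\<rbrakk>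
      \<Longrightarrow> x \<otimes>\<^bsub>A\<^esub> (c \<odot>\<^bsub>A\<^esub> y) = c \<odot>\<^bsub>A\<^esub> (x \<otimes>\<^bsub>A\<^esub> y)"

definition findim_algebra :: "('k, 'x) ring_scheme \<Rightarrow> ('k, 'h) module \<Rightarrow> bool"
  where "findim_algebra K A \<longleftrightarrow> field K \<and> assoc_algebra K A \<and> finitely_generated K A"

definition regular_module :: "('r, 'x) ring_scheme \<Rightarrow> ('r, 'r) module"
  where "regular_module R =
    \<lparr>carrier = carrier R, monoid.mult = (\<otimes>\<^bsub>R\<^esub>), one = \<one>\<^bsub>R\<^esub>, zero = \<zero>\<^bsub>R\<^esub>, add = (\<oplus>\<^bsub>R\<^esub>),
     smult = (\<otimes>\<^bsub>R\<^esub>)\<rparr>"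

text \<open>All left ideals are projective. Since \<^const>\<open>projective\<close> refers to finitely generated
  modules, this is the usual notion for left noetherian rings, in particular for finite
  dimensional algebras.\<close>

definition hereditary :: "('r, 'x) ring_scheme \<Rightarrow> bool"
  where "hereditary R \<longleftrightarrow> (\<forall>J. submodule J R (regular_module R) \<longrightarrow>
    projective R ((regular_module R)\<lparr>carrier := J\<rparr>))"

definition primitive_idempotent :: "('r, 'x) ring_scheme \<Rightarrow> 'r \<Rightarrow> bool"
  where "primitive_idempotent R e \<longleftrightarrow> e \<in> carrier R \<and> e \<otimes>\<^bsub>R\<^esub> e = e \<and> e \<noteq> \<zero>\<^bsub>R\<^esub> \<and>
    (\<forall>f \<in> carrier R. \<forall>g \<in> carrier R.
      f \<otimes>\<^bsub>R\<^esub> f = f \<longrightarrow> g \<otimes>\<^bsub>R\<^esub> g = g \<longrightarrow> f \<otimes>\<^bsub>R\<^esub> g = \<zero>\<^bsub>R\<^esub> \<longrightarrow> g \<otimes>\<^bsub>R\<^esub> f = \<zero>\<^bsub>R\<^esub> \<longrightarrow>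
      e = f \<oplus>\<^bsub>R\<^esub> g \<longrightarrow> f = \<zero>\<^bsub>R\<^esub> \<or> g = \<zero>\<^bsub>R\<^esub>)"

definition complete_primitive_orthogonal_idempotents :: "('r, 'x) ring_scheme \<Rightarrow> 'r set \<Rightarrow> bool"
  where "complete_primitive_orthogonal_idempotents R E \<longleftrightarrow> finite E \<and>
    (\<forall>e \<in> E. primitive_idempotent R e) \<and>
    (\<forall>e \<in> E. \<forall>f \<in> E. e \<noteq> f \<longrightarrow> e \<otimes>\<^bsub>R\<^esub> f = \<zero>\<^bsub>R\<^esub>) \<and>
    (\<Oplus>\<^bsub>R\<^esub>e \<in> E. e) = \<one>\<^bsub>R\<^esub>"

definition left_ideal_module :: "('r, 'x) ring_scheme \<Rightarrow> 'r \<Rightarrow> ('r, 'r) module"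
  where "left_ideal_module R e = (regular_module R)\<lparr>carrier := {a \<otimes>\<^bsub>R\<^esub> e | a. a \<in> carrier R}\<rparr>"

text \<open>The algebra is basic if for \<open>1 = e\<^sub>1 + \<dots> + e\<^sub>n\<close>, a decomposition into primitive orthogonal
  idempotents, the indecomposable projective left modules \<open>R e\<^sub>i\<close> are pairwise nonisomorphic.\<close>

definition basic :: "('r, 'x) ring_scheme \<Rightarrow> bool"
  where "basic R \<longleftrightarrow> (\<exists>E. complete_primitive_orthogonal_idempotents R E \<and>
    (\<forall>e \<in> E. \<forall>f \<in> E. e \<noteq> f \<longrightarrow> \<not> lmod_iso R (left_ideal_module R e) (left_ideal_module R f)))"

section \<open>The duplicated algebra\<close>

text \<open>\<open>D = Hom\<^sub>K(-, K)\<close>. Functionals are taken to be \<^const>\<open>undefined\<close> outside the carrier, so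
  that equality of functions is equality of functionals.\<close>

definition dual_carrier :: "('k, 'x) ring_scheme \<Rightarrow> ('k, 'h) module \<Rightarrow> ('h \<Rightarrow> 'k) set"
  where "dual_carrier K A = lmod_hom K A (regular_module K) \<inter> extensional (carrier A)"

text \<open>The triple \<open>(a, \<phi>, b)\<close> stands for the lower triangular matrix with diagonal \<open>a, b\<close> and lower
  left entry \<open>\<phi>\<close>. The bimodule structure of \<open>D A\<close> is \<open>(b \<phi> a)(x) = \<phi>(a x b)\<close>, and matrix
  multiplication gives \<open>(a, \<phi>, b)(a', \<phi>', b') = (a a', \<phi> a' + b \<phi>', b b')\<close>.\<close>

definition duplicated_algebra ::
    "('k, 'x) ring_scheme \<Rightarrow> ('k, 'h) module \<Rightarrow> ('k, 'h \<times> ('h \<Rightarrow> 'k) \<times> 'h) module"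
  where "duplicated_algebra K A =
    \<lparr>carrier = carrier A \<times> dual_carrier K A \<times> carrier A,
     monoid.mult = (\<lambda>(a, \<phi>, b) (a', \<phi>', b').
       (a \<otimes>\<^bsub>A\<^esub> a',
        (\<lambda>x \<in> carrier A. \<phi> (a' \<otimes>\<^bsub>A\<^esub> x) \<oplus>\<^bsub>K\<^esub> \<phi>' (x \<otimes>\<^bsub>A\<^esub> b)),
        b \<otimes>\<^bsub>A\<^esub> b')),
     one = (\<one>\<^bsub>A\<^esub>, (\<lambda>x \<in> carrier A. \<zero>\<^bsub>K\<^esub>), \<one>\<^bsub>A\<^esub>),
     zero = (\<zero>\<^bsub>A\<^esub>, (\<lambda>x \<in> carrier A. \<zero>\<^bsub>K\<^esub>), \<zero>\<^bsub>A\<^esub>),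
     add = (\<lambda>(a, \<phi>, b) (a', \<phi>', b').
       (a \<oplus>\<^bsub>A\<^esub> a', (\<lambda>x \<in> carrier A. \<phi> x \<oplus>\<^bsub>K\<^esub> \<phi>' x), b \<oplus>\<^bsub>A\<^esub> b')),
     smult = (\<lambda>c (a, \<phi>, b).
       (c \<odot>\<^bsub>A\<^esub> a, (\<lambda>x \<in> carrier A. c \<otimes>\<^bsub>K\<^esub> \<phi> x), c \<odot>\<^bsub>A\<^esub> b))\<rparr>"

end

theory Submission
  imports Defs
begin

text \<open>A left \<open>\<Lambda>\<close>-module \<open>X\<close> is a pair of \<open>H\<close>-modules \<open>e1 X\<close>, \<open>e2 X\<close> with a map \<open>DH \<otimes> e1 X \<rightarrow> e2 X\<close>. Since
  quotients of injective \<open>H\<close>-modules are injective, an indecomposable \<open>X\<close> satisfies \<open>e1 X = 0\<close> or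
  \<open>X = \<Lambda> e1 X\<close>. If \<open>pd X = 1\<close> and \<open>X = \<Lambda> e1 X\<close>, then \<open>X = P/L\<close> with \<open>P = \<Lambda> e1 P\<close> projective and injective, and
  with \<open>L\<close> a projective \<open>H\<close>-module that is essential in \<open>P\<close>. As every simple quotient of \<open>e1 P\<close> also
  occurs in the socle of \<open>e2 P = DH \<otimes> e1 P\<close>, hence in \<open>L\<close>, it is projective, so that \<open>e1 P\<close> is
  semisimple.

  For a nonzero \<open>Y \<rightarrow> X\<close> with \<open>Y = \<Lambda> e1 Y\<close> indecomposable, lift a cover \<open>Q \<rightarrow> Y\<close> with \<open>Q = (\<Lambda> e1)\<^sup>n\<close> and kernel
  \<open>U\<close> to \<open>F: Q \<rightarrow> P\<close>. The image \<open>V\<close> of \<open>F\<close> is a direct summand of \<open>P\<close>, and a section \<open>V \<rightarrow> Q\<close> can be corrected,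
  using that \<open>F U \<subseteq> L\<close> is projective and that \<open>Q\<close> is injective, so that it maps \<open>F U\<close> into \<open>U\<close>. It then
  splits \<open>V/F U\<close> off from \<open>Y\<close>, whence \<open>Y = V/F U\<close> is again of the same kind. Modules of this kind and
  the \<open>H\<close>-modules have projective dimension at most one.\<close>

section \<open>Modules\<close>

text \<open>Pairs of \<open>H\<close>-modules, tensor products, quotients and simple modules are
  avoided: a module over the triangular ring is treated as a whole, with \<open>e1\<close> and
  \<open>e2\<close> the diagonal idempotents. A simple quotient of \<open>e1 P\<close> becomes a
  maximal submodule \<open>N\<close> of \<open>P\<close> containing \<open>e2 P\<close>. That this
  quotient occurs in the socle of \<open>e2 P\<close> is the Nakayama correspondence, realised by an
  additive map that exchanges the actions of the two copies of \<open>H\<close>. Essentiality of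
  \<open>L\<close> comes from indecomposability: as \<open>P\<close> is injective, a maximal
  essential extension of \<open>L\<close> splits off, and a nonzero complement of it would be a
  projective summand of \<open>X\<close>, hence all of \<open>X\<close>. Semisimplicity of
  \<open>e1 P\<close> is needed because the image of a map between covers must be a summand before a
  section can be chosen; it is inherited by that image, so the argument can be repeated along a
  path. The section has to be corrected because only a section that carries \<open>F U\<close> into
  \<open>U\<close> induces an endomorphism of \<open>Y\<close>.\<close>

context left_module
begin

declare smult_closed [simp, intro]
declare smult_one [simp]

lemma smult_l_null [simp]: "x \<in> carrier M \<Longrightarrow> \<zero> \<odot>\<^bsub>M\<^esub> x = \<zero>\<^bsub>M\<^esub>"
  by (metis M.add.r_cancel_one' R.l_zero R.zero_closed smult_closed smult_l_distr)

lemma smult_r_null [simp]: "a \<in> carrier R \<Longrightarrow> a \<odot>\<^bsub>M\<^esub> \<zero>\<^bsub>M\<^esub> = \<zero>\<^bsub>M\<^esub>"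
  by (metis M.add.r_cancel_one' M.l_zero M.zero_closed smult_closed smult_r_distr)

lemma smult_neg_one: "x \<in> carrier M \<Longrightarrow> (\<ominus> \<one>) \<odot>\<^bsub>M\<^esub> x = \<ominus>\<^bsub>M\<^esub> x"
  by (metis M.minus_equality R.add.inv_closed R.l_neg R.one_closed smult_closed smult_l_distr
      smult_l_null smult_one)

lemma smult_r_neg: "a \<in> carrier R \<Longrightarrow> x \<in> carrier M \<Longrightarrow> a \<odot>\<^bsub>M\<^esub> (\<ominus>\<^bsub>M\<^esub> x) = \<ominus>\<^bsub>M\<^esub> (a \<odot>\<^bsub>M\<^esub> x)"
  by (metis M.add.inv_closed M.minus_equality M.l_neg smult_closed smult_r_distr smult_r_null)

text \<open>The library predicate also demands closure under negation; the scalar -1 supplies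
  it.\<close>

lemma submoduleI:
  assumes "N \<subseteq> carrier M" "\<zero>\<^bsub>M\<^esub> \<in> N" "\<And>x y. x \<in> N \<Longrightarrow> y \<in> N \<Longrightarrow> x \<oplus>\<^bsub>M\<^esub> y \<in> N"
    and s: "\<And>a x. a \<in> carrier R \<Longrightarrow> x \<in> N \<Longrightarrow> a \<odot>\<^bsub>M\<^esub> x \<in> N"
  shows "submodule N R M"
proof -
  have "\<ominus>\<^bsub>M\<^esub> x \<in> N" if "x \<in> N" for x
    using s[of "\<ominus> \<one>" x] that assms(1) smult_neg_one by auto
  then show ?thesis
    using assms by (unfold_locales) (auto simp: a_inv_def[symmetric])
qed

lemma submoduleD:
  assumes "submodule N R M"
  shows "N \<subseteq> carrier M" "\<zero>\<^bsub>M\<^esub> \<in> N" "\<And>x y. x \<in> N \<Longrightarrow> y \<in> N \<Longrightarrow> x \<oplus>\<^bsub>M\<^esub> y \<in> N"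
    "\<And>a x. a \<in> carrier R \<Longrightarrow> x \<in> N \<Longrightarrow> a \<odot>\<^bsub>M\<^esub> x \<in> N"
    "\<And>x. x \<in> N \<Longrightarrow> \<ominus>\<^bsub>M\<^esub> x \<in> N" "\<And>x y. x \<in> N \<Longrightarrow> y \<in> N \<Longrightarrow> x \<ominus>\<^bsub>M\<^esub> y \<in> N"
    "\<And>x. x \<in> N \<Longrightarrow> x \<in> carrier M"
proof -
  interpret N: submodule N R M by fact
  show *: "N \<subseteq> carrier M" "\<zero>\<^bsub>M\<^esub> \<in> N" "\<And>x y. x \<in> N \<Longrightarrow> y \<in> N \<Longrightarrow> x \<oplus>\<^bsub>M\<^esub> y \<in> N"
    "\<And>a x. a \<in> carrier R \<Longrightarrow> x \<in> N \<Longrightarrow> a \<odot>\<^bsub>M\<^esub> x \<in> N"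
    "\<And>x. x \<in> N \<Longrightarrow> \<ominus>\<^bsub>M\<^esub> x \<in> N"
    using N.subset N.one_closed N.m_closed N.m_inv_closed N.smult_closed
    by (auto simp: a_inv_def[symmetric])
  then show "\<And>x y. x \<in> N \<Longrightarrow> y \<in> N \<Longrightarrow> x \<ominus>\<^bsub>M\<^esub> y \<in> N" "\<And>x. x \<in> N \<Longrightarrow> x \<in> carrier M"
    by (auto simp: a_minus_def)
qed

lemma minus_eq_zero_iff [simp]:
  "x \<in> carrier M \<Longrightarrow> y \<in> carrier M \<Longrightarrow> x \<ominus>\<^bsub>M\<^esub> y = \<zero>\<^bsub>M\<^esub> \<longleftrightarrow> x = y"
  by (metis M.add.inv_closed M.minus_equality M.minus_minus M.r_neg a_minus_def)

lemma carrier_submodule: "submodule (carrier M) R M"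
  by (rule submoduleI) auto

lemma zero_submodule: "submodule {\<zero>\<^bsub>M\<^esub>} R M"
  by (rule submoduleI) auto

lemma submodule_Int: "submodule A R M \<Longrightarrow> submodule B R M \<Longrightarrow> submodule (A \<inter> B) R M"
  by (rule submoduleI) (auto dest: submoduleD)

lemma set_add_iff: "z \<in> A <+>\<^bsub>M\<^esub> B \<longleftrightarrow> (\<exists>a\<in>A. \<exists>b\<in>B. z = a \<oplus>\<^bsub>M\<^esub> b)"
  by (auto simp: set_add_def set_mult_def)

lemma submodule_set_add:
  assumes "submodule A R M" "submodule B R M"
  shows "submodule (A <+>\<^bsub>M\<^esub> B) R M" "A \<subseteq> A <+>\<^bsub>M\<^esub> B" "B \<subseteq> A <+>\<^bsub>M\<^esub> B"
proof -
  note a = submoduleD[OF assms(1)] and b = submoduleD[OF assms(2)]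
  show "submodule (A <+>\<^bsub>M\<^esub> B) R M"
  proof (rule submoduleI)
    show "A <+>\<^bsub>M\<^esub> B \<subseteq> carrier M" using a(7) b(7) by (auto simp: set_add_iff)
    show "\<zero>\<^bsub>M\<^esub> \<in> A <+>\<^bsub>M\<^esub> B"
      unfolding set_add_iff by (intro bexI[of _ "\<zero>\<^bsub>M\<^esub>"]) (use a(2) b(2) in auto)
    fix x y assume "x \<in> A <+>\<^bsub>M\<^esub> B" "y \<in> A <+>\<^bsub>M\<^esub> B"
    then obtain x1 x2 y1 y2 where *: "x1 \<in> A" "x2 \<in> B" "x = x1 \<oplus>\<^bsub>M\<^esub> x2" "y1 \<in> A" "y2 \<in> B" "y = y1 \<oplus>\<^bsub>M\<^esub> y2"
      by (auto simp: set_add_iff)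
    then have "x \<oplus>\<^bsub>M\<^esub> y = (x1 \<oplus>\<^bsub>M\<^esub> y1) \<oplus>\<^bsub>M\<^esub> (x2 \<oplus>\<^bsub>M\<^esub> y2)"
      using a(7) b(7) by (simp add: M.a_ac)
    then show "x \<oplus>\<^bsub>M\<^esub> y \<in> A <+>\<^bsub>M\<^esub> B" using a(3)[OF *(1,4)] b(3)[OF *(2,5)] by (auto simp: set_add_iff)
  next
    fix c x assume c: "c \<in> carrier R" and "x \<in> A <+>\<^bsub>M\<^esub> B"
    then obtain x1 x2 where *: "x1 \<in> A" "x2 \<in> B" "x = x1 \<oplus>\<^bsub>M\<^esub> x2" by (auto simp: set_add_iff)
    then have "c \<odot>\<^bsub>M\<^esub> x = c \<odot>\<^bsub>M\<^esub> x1 \<oplus>\<^bsub>M\<^esub> c \<odot>\<^bsub>M\<^esub> x2" using a(7) b(7) c by (simp add: smult_r_distr)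
    then show "c \<odot>\<^bsub>M\<^esub> x \<in> A <+>\<^bsub>M\<^esub> B" using a(4)[OF c *(1)] b(4)[OF c *(2)] by (auto simp: set_add_iff)
  qed
  show "A \<subseteq> A <+>\<^bsub>M\<^esub> B"
    unfolding set_add_iff subset_iff by (metis a(7) b(2) M.r_zero)
  show "B \<subseteq> A <+>\<^bsub>M\<^esub> B"
    unfolding set_add_iff subset_iff by (metis b(7) a(2) M.l_zero)
qed

lemma submodule_left_module:
  assumes "submodule N R M"
  shows "left_module R (M\<lparr>carrier := N\<rparr>)"
proof -
  note a = submoduleD[OF assms]
  have 1: "abelian_group (M\<lparr>carrier := N\<rparr>)"
  proof (rule abelian_groupI)
    fix x assume x: "x \<in> carrier (M\<lparr>carrier := N\<rparr>)"
    show "\<exists>y\<in>carrier (M\<lparr>carrier := N\<rparr>). y \<oplus>\<^bsub>M\<lparr>carrier := N\<rparr>\<^esub> x = \<zero>\<^bsub>M\<lparr>carrier := N\<rparr>\<^esub>"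
      using x a(5)[of x] a(7)[of x] by (auto intro!: bexI[of _ "\<ominus>\<^bsub>M\<^esub> x"] simp: M.l_neg)
  qed (use a M.a_ac in auto)
  show ?thesis
    using 1 R.ring_axioms a
    by (simp add: left_module_def left_module_axioms_def smult_l_distr smult_r_distr smult_assoc1)
qed

text \<open>A submodule becomes a module by replacing the carrier of \<open>M\<close>, so nested
  submodules are records with the same operations and can be compared inside
  \<open>M\<close>.\<close>

lemma submodule_trans:
  assumes "submodule N R M"
  shows "submodule L R (M\<lparr>carrier := N\<rparr>) \<longleftrightarrow> L \<subseteq> N \<and> submodule L R M"
proof -
  interpret N: left_module R "M\<lparr>carrier := N\<rparr>" by (rule submodule_left_module[OF assms])
  note a = submoduleD[OF assms]
  show ?thesis
  proof
    assume "submodule L R (M\<lparr>carrier := N\<rparr>)"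
    note b = N.submoduleD[OF this]
    show "L \<subseteq> N \<and> submodule L R M"
      using a(1) b by (intro conjI submoduleI) auto
  next
    assume "L \<subseteq> N \<and> submodule L R M"
    then show "submodule L R (M\<lparr>carrier := N\<rparr>)"
      using submoduleD[of L] by (intro N.submoduleI) auto
  qed
qed

end

text \<open>The recursion uses only the zero and the addition, not the carrier, so a sum formed in a
  submodule is literally the sum formed in \<open>M\<close>; this is the rewrite rule
  \<open>msum_carrier_update\<close>.\<close>

primrec msum :: "('a, 'b) ring_scheme \<Rightarrow> nat \<Rightarrow> (nat \<Rightarrow> 'a) \<Rightarrow> 'a"
  where "msum M 0 f = \<zero>\<^bsub>M\<^esub>"
  | "msum M (Suc n) f = msum M n f \<oplus>\<^bsub>M\<^esub> f n"

lemma msum_carrier_update [simp]: "msum (M\<lparr>carrier := N\<rparr>) n f = msum M n f"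
  by (induction n) auto

lemma msum_cong: "(\<And>i. i < n \<Longrightarrow> f i = g i) \<Longrightarrow> msum M n f = msum M n g"
  by (induction n) auto

lemma (in abelian_group) msum_closed: "(\<And>i. i < n \<Longrightarrow> f i \<in> carrier G) \<Longrightarrow> msum G n f \<in> carrier G"
  by (induction n) auto

lemma (in abelian_group) msum_add:
  "(\<And>i. i < n \<Longrightarrow> f i \<in> carrier G) \<Longrightarrow> (\<And>i. i < n \<Longrightarrow> g i \<in> carrier G) \<Longrightarrow>
    msum G n (\<lambda>i. f i \<oplus> g i) = msum G n f \<oplus> msum G n g"
  by (induction n) (auto simp: a_ac msum_closed)

lemma (in abelian_group) msum_zero: "(\<And>i. i < n \<Longrightarrow> f i = \<zero>) \<Longrightarrow> msum G n f = \<zero>"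
  by (induction n) auto

lemma (in abelian_group) msum_single:
  "j < n \<Longrightarrow> x \<in> carrier G \<Longrightarrow> msum G n (\<lambda>i. if i = j then x else \<zero>) = x"
proof (induction n)
  case (Suc n)
  then show ?case
    by (cases "j = n") (auto simp: msum_zero)
qed simp

context left_module
begin

lemma msum_smult:
  "a \<in> carrier R \<Longrightarrow> (\<And>i. i < n \<Longrightarrow> f i \<in> carrier M) \<Longrightarrow>
    a \<odot>\<^bsub>M\<^esub> msum M n f = msum M n (\<lambda>i. a \<odot>\<^bsub>M\<^esub> f i)"
  by (induction n) (auto simp: smult_r_distr M.msum_closed)

lemma submodule_msum: "submodule N R M \<Longrightarrow> (\<And>i. i < n \<Longrightarrow> f i \<in> N) \<Longrightarrow> msum M n f \<in> N"
  by (induction n) (auto dest: submoduleD)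

end

section \<open>Homomorphisms\<close>

lemma lmod_homI:
  assumes "\<And>x. x \<in> carrier M \<Longrightarrow> f x \<in> carrier N"
    "\<And>x y. x \<in> carrier M \<Longrightarrow> y \<in> carrier M \<Longrightarrow> f (x \<oplus>\<^bsub>M\<^esub> y) = f x \<oplus>\<^bsub>N\<^esub> f y"
    "\<And>a x. a \<in> carrier R \<Longrightarrow> x \<in> carrier M \<Longrightarrow> f (a \<odot>\<^bsub>M\<^esub> x) = a \<odot>\<^bsub>N\<^esub> f x"
  shows "f \<in> lmod_hom R M N"
  using assms by (auto simp: lmod_hom_def)

lemma lmod_homD:
  assumes "f \<in> lmod_hom R M N"
  shows "\<And>x. x \<in> carrier M \<Longrightarrow> f x \<in> carrier N"
    "\<And>x y. x \<in> carrier M \<Longrightarrow> y \<in> carrier M \<Longrightarrow> f (x \<oplus>\<^bsub>M\<^esub> y) = f x \<oplus>\<^bsub>N\<^esub> f y"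
    "\<And>a x. a \<in> carrier R \<Longrightarrow> x \<in> carrier M \<Longrightarrow> f (a \<odot>\<^bsub>M\<^esub> x) = a \<odot>\<^bsub>N\<^esub> f x"
  using assms by (auto simp: lmod_hom_def)

lemma lmod_hom_comp:
  "f \<in> lmod_hom R M N \<Longrightarrow> g \<in> lmod_hom R N L \<Longrightarrow> (\<lambda>x. g (f x)) \<in> lmod_hom R M L"
  by (auto simp: lmod_hom_def Pi_def)

lemma lmod_hom_id: "(\<lambda>x. x) \<in> lmod_hom R M M"
  by (auto simp: lmod_hom_def)

lemma lmod_hom_restrict:
  "f \<in> lmod_hom R M N \<Longrightarrow> A \<subseteq> carrier M \<Longrightarrow> f \<in> lmod_hom R (M\<lparr>carrier := A\<rparr>) N"
  by (simp add: lmod_hom_def Pi_def subset_iff)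

lemma lmod_hom_codomain:
  "f \<in> lmod_hom R M N \<Longrightarrow> (\<And>x. x \<in> carrier M \<Longrightarrow> f x \<in> B) \<Longrightarrow> f \<in> lmod_hom R M (N\<lparr>carrier := B\<rparr>)"
  by (auto simp: lmod_hom_def Pi_def)

lemma lmod_hom_codomainD:
  "f \<in> lmod_hom R M (N\<lparr>carrier := B\<rparr>) \<Longrightarrow> B \<subseteq> carrier N \<Longrightarrow> f \<in> lmod_hom R M N"
  by (auto simp: lmod_hom_def Pi_def)

locale lmod_homomorphism = M: left_module R M + N: left_module R N
  for R :: "('r, 'x) ring_scheme" (structure) and M :: "('r, 'm) module" and N :: "('r, 'n) module" +
  fixes f
  assumes hom: "f \<in> lmod_hom R M N"
begin

lemmas f_closed [simp] = lmod_homD(1)[OF hom]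
lemmas f_add = lmod_homD(2)[OF hom]
lemmas f_smult = lmod_homD(3)[OF hom]

lemma f_zero [simp]: "f \<zero>\<^bsub>M\<^esub> = \<zero>\<^bsub>N\<^esub>"
proof -
  have "f \<zero>\<^bsub>M\<^esub> = f (\<zero>\<^bsub>R\<^esub> \<odot>\<^bsub>M\<^esub> \<zero>\<^bsub>M\<^esub>)" by simp
  also have "\<dots> = \<zero>\<^bsub>N\<^esub>" by (subst f_smult) auto
  finally show ?thesis .
qed

lemma f_neg: "x \<in> carrier M \<Longrightarrow> f (\<ominus>\<^bsub>M\<^esub> x) = \<ominus>\<^bsub>N\<^esub> f x"
  by (simp add: M.smult_neg_one[symmetric] N.smult_neg_one[symmetric] f_smult)

lemma f_minus: "x \<in> carrier M \<Longrightarrow> y \<in> carrier M \<Longrightarrow> f (x \<ominus>\<^bsub>M\<^esub> y) = f x \<ominus>\<^bsub>N\<^esub> f y"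
  by (simp add: a_minus_def f_add f_neg)

lemma f_msum: "(\<And>i. i < n \<Longrightarrow> x i \<in> carrier M) \<Longrightarrow> f (msum M n x) = msum N n (\<lambda>i. f (x i))"
  by (induction n) (auto simp: f_add M.M.msum_closed)

lemma preimage_submodule:
  assumes "submodule B R N"
  shows "submodule {x \<in> carrier M. f x \<in> B} R M"
  using N.submoduleD[OF assms] by (intro M.submoduleI) (auto simp: f_add f_smult)

lemma image_submodule:
  assumes "submodule A R M"
  shows "submodule (f ` A) R N"
proof -
  note a = M.submoduleD[OF assms]
  show ?thesis
  proof (rule N.submoduleI)
    show "f ` A \<subseteq> carrier N" using a by auto
    show "\<zero>\<^bsub>N\<^esub> \<in> f ` A" using a(2) by (force simp: image_iff)
    show "x \<oplus>\<^bsub>N\<^esub> y \<in> f ` A" if "x \<in> f ` A" "y \<in> f ` A" for x y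
      using that a(3,7) by (auto simp: f_add[symmetric])
    show "c \<odot>\<^bsub>N\<^esub> x \<in> f ` A" if "c \<in> carrier R" "x \<in> f ` A" for c x
      using that a(4,7) by (auto simp: f_smult[symmetric])
  qed
qed

lemma kernel_submodule: "submodule {x \<in> carrier M. f x = \<zero>\<^bsub>N\<^esub>} R M"
  using preimage_submodule[OF N.zero_submodule] by simp

lemma inj_iff: "inj_on f (carrier M) \<longleftrightarrow> (\<forall>x \<in> carrier M. f x = \<zero>\<^bsub>N\<^esub> \<longrightarrow> x = \<zero>\<^bsub>M\<^esub>)"
proof
  assume r: "\<forall>x \<in> carrier M. f x = \<zero>\<^bsub>N\<^esub> \<longrightarrow> x = \<zero>\<^bsub>M\<^esub>"
  show "inj_on f (carrier M)"
  proof (rule inj_onI)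
    fix x y assume *: "x \<in> carrier M" "y \<in> carrier M" "f x = f y"
    then have "f (x \<ominus>\<^bsub>M\<^esub> y) = \<zero>\<^bsub>N\<^esub>" by (simp add: f_minus)
    then have "x \<ominus>\<^bsub>M\<^esub> y = \<zero>\<^bsub>M\<^esub>" using r * by simp
    then show "x = y" using * by simp
  qed
qed (auto simp: inj_on_def)

text \<open>The homomorphism theorem for a surjection \<open>f\<close>. Quotient modules are never
  built; a quotient is represented by a surjection, and maps out of it come from this lemma.\<close>

lemma factor:
  assumes L: "left_module R L" and k: "k \<in> lmod_hom R M L" and onto: "f ` carrier M = carrier N"
    and ker: "\<And>x. x \<in> carrier M \<Longrightarrow> f x = \<zero>\<^bsub>N\<^esub> \<Longrightarrow> k x = \<zero>\<^bsub>L\<^esub>"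
  shows "\<exists>h \<in> lmod_hom R N L. \<forall>x \<in> carrier M. h (f x) = k x"
proof -
  interpret L: left_module R L by fact
  interpret k: lmod_homomorphism R M L k by unfold_locales fact
  have wd: "k x = k y" if "x \<in> carrier M" "y \<in> carrier M" "f x = f y" for x y
  proof -
    have "f (x \<ominus>\<^bsub>M\<^esub> y) = \<zero>\<^bsub>N\<^esub>" using that by (simp add: f_minus)
    then have "k x \<ominus>\<^bsub>L\<^esub> k y = \<zero>\<^bsub>L\<^esub>" using that ker by (metis M.M.minus_closed k.f_minus)
    then show ?thesis using that by simp
  qed
  \<comment> \<open>A preimage is chosen for each \<open>y\<close>; \<open>wd\<close> makes the
    value of \<open>k\<close> independent of the choice.\<close>
  define h where "h y = k (SOME x. x \<in> carrier M \<and> f x = y)" for y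
  have h: "h (f x) = k x" if "x \<in> carrier M" for x
  proof -
    have "(SOME z. z \<in> carrier M \<and> f z = f x) \<in> carrier M \<and> f (SOME z. z \<in> carrier M \<and> f z = f x) = f x"
      by (rule someI[of _ x]) (use that in auto)
    then show ?thesis unfolding h_def using wd that by blast
  qed
  have "h \<in> lmod_hom R N L"
  proof (rule lmod_homI)
    fix y assume "y \<in> carrier N"
    then obtain x where "x \<in> carrier M" "y = f x" using onto by blast
    then show "h y \<in> carrier L" using h by simp
    fix a assume "a \<in> carrier R"
    then show "h (a \<odot>\<^bsub>N\<^esub> y) = a \<odot>\<^bsub>L\<^esub> h y"
      using \<open>x \<in> carrier M\<close> \<open>y = f x\<close> h by (simp add: f_smult[symmetric] k.f_smult)
  next
    fix y z assume "y \<in> carrier N" "z \<in> carrier N"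
    then obtain x w where "x \<in> carrier M" "y = f x" "w \<in> carrier M" "z = f w" using onto by blast
    then show "h (y \<oplus>\<^bsub>N\<^esub> z) = h y \<oplus>\<^bsub>L\<^esub> h z" using h by (simp add: f_add[symmetric] k.f_add)
  qed
  then show ?thesis using h by blast
qed

end

lemma lmod_homomorphismI:
  "left_module R M \<Longrightarrow> left_module R N \<Longrightarrow> f \<in> lmod_hom R M N \<Longrightarrow> lmod_homomorphism R M N f"
  by (simp add: lmod_homomorphism_def lmod_homomorphism_axioms_def)

lemma (in left_module) lmod_hom_add:
  assumes "f \<in> lmod_hom R L M" "g \<in> lmod_hom R L M"
  shows "(\<lambda>x. f x \<oplus>\<^bsub>M\<^esub> g x) \<in> lmod_hom R L M"
  using lmod_homD[OF assms(1)] lmod_homD[OF assms(2)]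
  by (intro lmod_homI) (auto simp: M.a_ac smult_r_distr)

lemma (in left_module) lmod_hom_zero: "(\<lambda>x. \<zero>\<^bsub>M\<^esub>) \<in> lmod_hom R L M"
  by (intro lmod_homI) auto

lemma (in left_module) lmod_hom_neg:
  assumes "f \<in> lmod_hom R L M"
  shows "(\<lambda>x. \<ominus>\<^bsub>M\<^esub> f x) \<in> lmod_hom R L M"
  using lmod_homD[OF assms] by (intro lmod_homI) (auto simp: M.minus_add smult_r_neg)

lemma (in left_module) lmod_hom_minus:
  assumes "f \<in> lmod_hom R L M" "g \<in> lmod_hom R L M"
  shows "(\<lambda>x. f x \<ominus>\<^bsub>M\<^esub> g x) \<in> lmod_hom R L M"
  unfolding a_minus_def using assms by (intro lmod_hom_add lmod_hom_neg)

lemma (in left_module) lmod_hom_msum: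
  "(\<And>i. i < n \<Longrightarrow> f i \<in> lmod_hom R L M) \<Longrightarrow> (\<lambda>x. msum M n (\<lambda>i. f i x)) \<in> lmod_hom R L M"
proof (induction n)
  case (Suc n)
  then show ?case by (simp add: lmod_hom_add)
qed (simp add: lmod_hom_zero)

lemma regular_module_simps [simp]:
  "carrier (regular_module R) = carrier R" "add (regular_module R) = add R"
  "zero (regular_module R) = zero R" "smult (regular_module R) = monoid.mult R"
  by (simp_all add: regular_module_def)

lemma (in ring) regular_left_module: "left_module R (regular_module R)"
proof -
  have "abelian_group (regular_module R)"
    by (rule abelian_groupI) (use l_neg add.inv_closed in \<open>auto simp: a_ac\<close>)
  then show ?thesis
    by (simp add: left_module_def left_module_axioms_def ring_axioms m_assoc l_distr r_distr)
qed

lemma (in left_module) lmod_hom_smult_fixed: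
  assumes "f \<in> lmod_hom R L (regular_module R)" "y \<in> carrier M"
  shows "(\<lambda>x. f x \<odot>\<^bsub>M\<^esub> y) \<in> lmod_hom R L M"
  using lmod_homD[OF assms(1)] assms(2) by (intro lmod_homI) (auto simp: smult_l_distr smult_assoc1)

lemma (in ring) lmod_hom_mult_right:
  assumes "f \<in> lmod_hom R L (regular_module R)" "e \<in> carrier R"
  shows "(\<lambda>x. f x \<otimes> e) \<in> lmod_hom R L (regular_module R)"
  using lmod_homD[OF assms(1)] assms(2) by (intro lmod_homI) (auto simp: l_distr m_assoc)

section \<open>Free modules and dual bases\<close>

text \<open>\<open>(R e)\<^sup>n\<close>, which is free for \<open>e = 1\<close> and projective for idempotent \<open>e\<close>.\<close>

definition free_mod :: "('r, 'x) ring_scheme \<Rightarrow> 'r \<Rightarrow> nat \<Rightarrow> 'r small_module"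
  where "free_mod R e n =
    \<lparr>carrier = {f. (\<forall>i<n. f i \<in> carrier R \<and> f i \<otimes>\<^bsub>R\<^esub> e = f i) \<and> (\<forall>i\<ge>n. f i = \<zero>\<^bsub>R\<^esub>)},
     monoid.mult = (\<lambda>f g. f), one = (\<lambda>i. \<zero>\<^bsub>R\<^esub>), zero = (\<lambda>i. \<zero>\<^bsub>R\<^esub>),
     add = (\<lambda>f g i. f i \<oplus>\<^bsub>R\<^esub> g i), smult = (\<lambda>a f i. a \<otimes>\<^bsub>R\<^esub> f i)\<rparr>"

text \<open>For fixed \<open>x\<close>, the map from coefficient vectors to \<open>M\<close> that
  sends the \<open>i\<close>-th unit vector to \<open>x i\<close>. Generators, dual bases and free
  covers are all expressed through it.\<close>

definition comb :: "('r, 'm) module \<Rightarrow> nat \<Rightarrow> (nat \<Rightarrow> 'm) \<Rightarrow> (nat \<Rightarrow> 'r) \<Rightarrow> 'm"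
  where "comb M n x f = msum M n (\<lambda>i. f i \<odot>\<^bsub>M\<^esub> x i)"

lemma comb_carrier_update [simp]: "comb (M\<lparr>carrier := N\<rparr>) n x f = comb M n x f"
  by (simp add: comb_def)

lemma free_mod_simps [simp]:
  "zero (free_mod R e n) = (\<lambda>i. \<zero>\<^bsub>R\<^esub>)"
  "add (free_mod R e n) = (\<lambda>f g i. f i \<oplus>\<^bsub>R\<^esub> g i)"
  "smult (free_mod R e n) = (\<lambda>a f i. a \<otimes>\<^bsub>R\<^esub> f i)"
  by (simp_all add: free_mod_def)

lemma free_mod_carrier:
  "f \<in> carrier (free_mod R e n) \<longleftrightarrow>
    (\<forall>i<n. f i \<in> carrier R \<and> f i \<otimes>\<^bsub>R\<^esub> e = f i) \<and> (\<forall>i\<ge>n. f i = \<zero>\<^bsub>R\<^esub>)"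
  by (simp add: free_mod_def)

context ring
begin

lemma free_mod_closed: "f \<in> carrier (free_mod R e n) \<Longrightarrow> f i \<in> carrier R"
  by (cases "i < n") (auto simp: free_mod_carrier)

lemma free_mod_left_module:
  assumes e: "e \<in> carrier R"
  shows "left_module R (free_mod R e n)"
proof -
  have "abelian_group (free_mod R e n)"
  proof (rule abelian_groupI)
    fix f assume f: "f \<in> carrier (free_mod R e n)"
    show "\<exists>g\<in>carrier (free_mod R e n). g \<oplus>\<^bsub>free_mod R e n\<^esub> f = \<zero>\<^bsub>free_mod R e n\<^esub>"
      using f e by (intro bexI[of _ "\<lambda>i. \<ominus> f i"])
        (auto simp: free_mod_carrier l_neg l_minus free_mod_closed[OF f])
  next
    fix f g assume *: "f \<in> carrier (free_mod R e n)" "g \<in> carrier (free_mod R e n)"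
    show "f \<oplus>\<^bsub>free_mod R e n\<^esub> g \<in> carrier (free_mod R e n)"
      using * e by (auto simp: free_mod_carrier l_distr)
    show "f \<oplus>\<^bsub>free_mod R e n\<^esub> g = g \<oplus>\<^bsub>free_mod R e n\<^esub> f"
      using * by (auto simp: a_comm free_mod_closed)
    fix h assume "h \<in> carrier (free_mod R e n)"
    then show "f \<oplus>\<^bsub>free_mod R e n\<^esub> g \<oplus>\<^bsub>free_mod R e n\<^esub> h = f \<oplus>\<^bsub>free_mod R e n\<^esub> (g \<oplus>\<^bsub>free_mod R e n\<^esub> h)"
      using * by (auto simp: a_assoc free_mod_closed)
    show "\<zero>\<^bsub>free_mod R e n\<^esub> \<oplus>\<^bsub>free_mod R e n\<^esub> f = f"
      using * by (auto simp: free_mod_closed)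
  qed (use e in \<open>auto simp: free_mod_carrier\<close>)
  then show ?thesis
  proof (intro left_module.intro left_module_axioms.intro ring_axioms)
    fix a f assume *: "a \<in> carrier R" "f \<in> carrier (free_mod R e n)"
    note fc = free_mod_closed[OF *(2)]
    show "a \<odot>\<^bsub>free_mod R e n\<^esub> f \<in> carrier (free_mod R e n)"
      using * e by (simp add: free_mod_carrier m_assoc)
    show "(a \<oplus> b) \<odot>\<^bsub>free_mod R e n\<^esub> f =
        a \<odot>\<^bsub>free_mod R e n\<^esub> f \<oplus>\<^bsub>free_mod R e n\<^esub> b \<odot>\<^bsub>free_mod R e n\<^esub> f"
      "(a \<otimes> b) \<odot>\<^bsub>free_mod R e n\<^esub> f = a \<odot>\<^bsub>free_mod R e n\<^esub> (b \<odot>\<^bsub>free_mod R e n\<^esub> f)"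
      if "b \<in> carrier R" for b
      using * fc that by (simp_all add: l_distr m_assoc)
    fix g assume "g \<in> carrier (free_mod R e n)"
    from free_mod_closed[OF this] show "a \<odot>\<^bsub>free_mod R e n\<^esub> (f \<oplus>\<^bsub>free_mod R e n\<^esub> g) =
        a \<odot>\<^bsub>free_mod R e n\<^esub> f \<oplus>\<^bsub>free_mod R e n\<^esub> a \<odot>\<^bsub>free_mod R e n\<^esub> g"
      using * fc by (simp add: r_distr)
  next
    fix f assume "f \<in> carrier (free_mod R e n)"
    from free_mod_closed[OF this] show "\<one> \<odot>\<^bsub>free_mod R e n\<^esub> f = f" by simp
  qed
qed

lemma free_mod_coord_hom: "(\<lambda>f. f i) \<in> lmod_hom R (free_mod R e n) (regular_module R)"
  by (intro lmod_homI) (auto simp: free_mod_closed)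

lemma free_mod_msum: "msum (free_mod R e n) k F i = msum R k (\<lambda>j. F j i)"
  by (induction k) auto

text \<open>The generators of \<open>(R e)^n\<close>: the nonzero coordinate has to lie in
  \<open>R e\<close>, so it is \<open>e\<close> rather than \<open>1\<close>.\<close>

definition unit_vec :: "'a \<Rightarrow> nat \<Rightarrow> nat \<Rightarrow> 'a"
  where "unit_vec e i = (\<lambda>j. if j = i then e else \<zero>)"

lemma unit_vec_closed:
  "e \<in> carrier R \<Longrightarrow> e \<otimes> e = e \<Longrightarrow> i < n \<Longrightarrow> unit_vec e i \<in> carrier (free_mod R e n)"
  by (auto simp: free_mod_carrier unit_vec_def)

lemma free_mod_incl:
  "e \<in> carrier R \<Longrightarrow> (\<lambda>f. f) \<in> lmod_hom R (free_mod R e n) (free_mod R \<one> n)"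
  by (intro lmod_homI) (auto simp: free_mod_carrier)

text \<open>Right multiplication commutes with the left action and is the identity on
  \<open>R e\<close> for idempotent \<open>e\<close>; it is the retraction of \<open>R^n\<close>
  onto \<open>(R e)^n\<close> whose section is \<open>free_mod_incl\<close>.\<close>

lemma free_mod_mult_right:
  assumes e: "e \<in> carrier R" "e \<otimes> e = e"
  shows "(\<lambda>f i. f i \<otimes> e) \<in> lmod_hom R (free_mod R \<one> n) (free_mod R e n)"
proof (rule lmod_homI)
  fix f assume f: "f \<in> carrier (free_mod R \<one> n)"
  have fc: "f i \<in> carrier R" for i by (rule free_mod_closed[OF f])
  show "(\<lambda>i. f i \<otimes> e) \<in> carrier (free_mod R e n)"
    using f fc e by (simp add: free_mod_carrier m_assoc)
  show "(\<lambda>i. (a \<odot>\<^bsub>free_mod R \<one> n\<^esub> f) i \<otimes> e) = a \<odot>\<^bsub>free_mod R e n\<^esub> (\<lambda>i. f i \<otimes> e)"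
    if "a \<in> carrier R" for a
    using that fc e by (simp add: m_assoc)
  fix g assume g: "g \<in> carrier (free_mod R \<one> n)"
  have "g i \<in> carrier R" for i by (rule free_mod_closed[OF g])
  then show "(\<lambda>i. (f \<oplus>\<^bsub>free_mod R \<one> n\<^esub> g) i \<otimes> e)
      = (\<lambda>i. f i \<otimes> e) \<oplus>\<^bsub>free_mod R e n\<^esub> (\<lambda>i. g i \<otimes> e)"
    using fc e by (simp add: l_distr)
qed

end

context left_module
begin

lemma comb_hom:
  assumes "\<And>i. i < n \<Longrightarrow> x i \<in> carrier M"
  shows "comb M n x \<in> lmod_hom R (free_mod R e n) M"
  unfolding comb_def
  by (intro lmod_hom_msum lmod_hom_smult_fixed R.free_mod_coord_hom assms)

lemma comb_closed:
  "(\<And>i. i < n \<Longrightarrow> x i \<in> carrier M) \<Longrightarrow> (\<And>i. i < n \<Longrightarrow> f i \<in> carrier R) \<Longrightarrow> comb M n x f \<in> carrier M"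
  by (simp add: comb_def M.msum_closed)

lemma comb_unit_vec:
  assumes "\<And>i. i < n \<Longrightarrow> x i \<in> carrier M" "i < n" "e \<in> carrier R"
  shows "comb M n x (unit_vec e i) = e \<odot>\<^bsub>M\<^esub> x i"
proof -
  have "comb M n x (unit_vec e i) = msum M n (\<lambda>j. if j = i then e \<odot>\<^bsub>M\<^esub> x i else \<zero>\<^bsub>M\<^esub>)"
    unfolding comb_def unit_vec_def by (rule msum_cong) (auto simp: assms)
  then show ?thesis using assms by (simp add: M.msum_single)
qed

lemma comb_right_mult:
  assumes "\<And>i. i < n \<Longrightarrow> x i \<in> carrier M" "\<And>i. i < n \<Longrightarrow> e \<odot>\<^bsub>M\<^esub> x i = x i"
    "\<And>i. i < n \<Longrightarrow> f i \<in> carrier R" "e \<in> carrier R"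
  shows "comb M n x (\<lambda>i. f i \<otimes> e) = comb M n x f"
  unfolding comb_def by (rule msum_cong) (simp add: assms smult_assoc1)

text \<open>The definition compares the generating set with all submodules containing it; the image
  of \<open>comb\<close> is the least of these, which turns the condition into a surjection from
  \<open>R^n\<close>.\<close>

lemma finitely_generated_iff:
  "finitely_generated R M \<longleftrightarrow> (\<exists>n x. (\<forall>i<n. x i \<in> carrier M) \<and>
    comb M n x ` carrier (free_mod R \<one> n) = carrier M)"
proof
  assume "finitely_generated R M"
  then obtain S where S: "finite S" "S \<subseteq> carrier M" "\<And>N. submodule N R M \<Longrightarrow> S \<subseteq> N \<Longrightarrow> N = carrier M"
    by (auto simp: finitely_generated_def)
  from S(1) obtain xs where xs: "set xs = S" using finite_list by blast
  define n where "n = length xs"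
  have x: "xs ! i \<in> carrier M" if "i < n" for i using that xs S(2) unfolding n_def by auto
  interpret F: left_module R "free_mod R \<one> n" by (rule R.free_mod_left_module) simp
  interpret c: lmod_homomorphism R "free_mod R \<one> n" M "comb M n ((!) xs)"
    by (unfold_locales) (use x comb_hom in auto)
  have "S \<subseteq> comb M n ((!) xs) ` carrier (free_mod R \<one> n)"
  proof
    fix s assume "s \<in> S"
    then obtain i where i: "i < n" "s = xs ! i" using xs n_def by (metis in_set_conv_nth)
    have "comb M n ((!) xs) (R.unit_vec \<one> i) = s" using comb_unit_vec[of n "(!) xs" i \<one>] x i by simp
    then show "s \<in> comb M n ((!) xs) ` carrier (free_mod R \<one> n)"
      using R.unit_vec_closed[of \<one> i n] i by force
  qed
  then have "comb M n ((!) xs) ` carrier (free_mod R \<one> n) = carrier M"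
    by (intro S(3) c.image_submodule F.carrier_submodule)
  then show "\<exists>n x. (\<forall>i<n. x i \<in> carrier M) \<and> comb M n x ` carrier (free_mod R \<one> n) = carrier M"
    using x by blast
next
  assume "\<exists>n x. (\<forall>i<n. x i \<in> carrier M) \<and> comb M n x ` carrier (free_mod R \<one> n) = carrier M"
  then obtain n x where x: "\<And>i. i < n \<Longrightarrow> x i \<in> carrier M"
    and s: "comb M n x ` carrier (free_mod R \<one> n) = carrier M" by auto
  show "finitely_generated R M"
    unfolding finitely_generated_def
  proof (intro exI[of _ "x ` {..<n}"] conjI allI impI)
    fix N assume N: "submodule N R M" "x ` {..<n} \<subseteq> N"
    have "comb M n x f \<in> N" if "f \<in> carrier (free_mod R \<one> n)" for f
      unfolding comb_def
      by (rule submodule_msum[OF N(1)])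
        (use N(2) submoduleD[OF N(1)] R.free_mod_closed[OF that] in auto)
    then show "N = carrier M" using s submoduleD(1)[OF N(1)] by (metis image_subsetI subset_antisym)
  qed (use x in auto)
qed

end

text \<open>The dual basis criterion: for an idempotent \<open>e\<close>, the maps
  \<open>p \<mapsto> (\<phi> i p)\<close> and \<open>comb P n x\<close> exhibit \<open>P\<close> as
  a direct summand of \<open>(R e)^n\<close>. For \<open>e = 1\<close> this is finitely generated
  projectivity, in a form that does not quantify over test modules of one fixed type;
  \<open>e = e1\<close> and \<open>e = e2\<close> single out the summands of powers of
  \<open>R e1\<close> and of \<open>R e2\<close>.\<close>

definition has_dual_basis :: "('r, 'x) ring_scheme \<Rightarrow> 'r \<Rightarrow> ('r, 'm) module \<Rightarrow> bool"
  where "has_dual_basis R e P \<longleftrightarrow> (\<exists>n x \<phi>.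
    (\<forall>i<n. x i \<in> carrier P \<and> e \<odot>\<^bsub>P\<^esub> x i = x i \<and> \<phi> i \<in> lmod_hom R P (regular_module R) \<and>
      (\<forall>p\<in>carrier P. \<phi> i p \<otimes>\<^bsub>R\<^esub> e = \<phi> i p)) \<and>
    (\<forall>p\<in>carrier P. p = comb P n x (\<lambda>i. \<phi> i p)))"

abbreviation "proj R P \<equiv> has_dual_basis R \<one>\<^bsub>R\<^esub> P"

lemma has_dual_basisE:
  assumes "has_dual_basis R e P"
  obtains n x \<phi> where "\<And>i. i < n \<Longrightarrow> x i \<in> carrier P" "\<And>i. i < n \<Longrightarrow> e \<odot>\<^bsub>P\<^esub> x i = x i"
    "\<And>i. i < n \<Longrightarrow> \<phi> i \<in> lmod_hom R P (regular_module R)"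
    "\<And>i p. i < n \<Longrightarrow> p \<in> carrier P \<Longrightarrow> \<phi> i p \<otimes>\<^bsub>R\<^esub> e = \<phi> i p"
    "\<And>p. p \<in> carrier P \<Longrightarrow> comb P n x (\<lambda>i. \<phi> i p) = p"
  using assms unfolding has_dual_basis_def by metis

lemma has_dual_basisI:
  assumes "\<And>i. i < n \<Longrightarrow> x i \<in> carrier P" "\<And>i. i < n \<Longrightarrow> e \<odot>\<^bsub>P\<^esub> x i = x i"
    "\<And>i. i < n \<Longrightarrow> \<phi> i \<in> lmod_hom R P (regular_module R)"
    "\<And>i p. i < n \<Longrightarrow> p \<in> carrier P \<Longrightarrow> \<phi> i p \<otimes>\<^bsub>R\<^esub> e = \<phi> i p"
    "\<And>p. p \<in> carrier P \<Longrightarrow> comb P n x (\<lambda>i. \<phi> i p) = p"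
  shows "has_dual_basis R e P"
  unfolding has_dual_basis_def using assms by (intro exI[of _ n] exI[of _ x] exI[of _ \<phi>]) auto

lemma (in left_module) has_dual_basis_proj: "has_dual_basis R e M \<Longrightarrow> proj R M"
proof (erule has_dual_basisE)
  fix n x \<phi>
  assume *: "\<And>i. i < n \<Longrightarrow> x i \<in> carrier M" "\<And>i. i < n \<Longrightarrow> \<phi> i \<in> lmod_hom R M (regular_module R)"
    "\<And>p. p \<in> carrier M \<Longrightarrow> comb M n x (\<lambda>i. \<phi> i p) = p"
  show "proj R M"
    by (rule has_dual_basisI[of n x _ _ \<phi>]) (use * lmod_homD(1)[OF *(2)] in auto)
qed

lemma (in ring) free_mod_dual_basis:
  assumes e: "e \<in> carrier R" "e \<otimes> e = e"
  shows "has_dual_basis R e (free_mod R e n)"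
proof (rule has_dual_basisI[of n "unit_vec e" _ _ "\<lambda>i f. f i"])
  interpret F: left_module R "free_mod R e n" by (rule free_mod_left_module) fact
  show "unit_vec e i \<in> carrier (free_mod R e n)" if "i < n" for i using that e by (simp add: unit_vec_closed)
  show "e \<odot>\<^bsub>free_mod R e n\<^esub> unit_vec e i = unit_vec e i" for i
    using e by (auto simp: unit_vec_def)
  show "(\<lambda>f. f i) \<in> lmod_hom R (free_mod R e n) (regular_module R)" for i by (rule free_mod_coord_hom)
  show "f i \<otimes> e = f i" if "i < n" "f \<in> carrier (free_mod R e n)" for i f
    using that by (simp add: free_mod_carrier)
  fix f assume f: "f \<in> carrier (free_mod R e n)"
  show "comb (free_mod R e n) n (unit_vec e) (\<lambda>i. f i) = f"
  proof
    fix j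
    have fj: "f j \<in> carrier R" by (rule free_mod_closed[OF f])
    have "comb (free_mod R e n) n (unit_vec e) f j = msum R n (\<lambda>i. if i = j then f j else \<zero>)"
      unfolding comb_def free_mod_msum
      by (rule msum_cong) (use f in \<open>auto simp: free_mod_carrier unit_vec_def\<close>)
    also have "\<dots> = f j"
      using f fj by (cases "j < n") (simp_all add: msum_single msum_zero free_mod_carrier)
    finally show "comb (free_mod R e n) n (unit_vec e) f j = f j" .
  qed
qed

lemma (in left_module) proj_finitely_generated:
  assumes "has_dual_basis R e M"
  shows "finitely_generated R M"
proof -
  obtain n x \<phi> where *: "\<And>j. j < n \<Longrightarrow> x j \<in> carrier M" "\<And>j. j < n \<Longrightarrow> e \<odot>\<^bsub>M\<^esub> x j = x j"
    "\<And>j. j < n \<Longrightarrow> \<phi> j \<in> lmod_hom R M (regular_module R)"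
    "\<And>j p. j < n \<Longrightarrow> p \<in> carrier M \<Longrightarrow> \<phi> j p \<otimes>\<^bsub>R\<^esub> e = \<phi> j p"
    "\<And>p. p \<in> carrier M \<Longrightarrow> comb M n x (\<lambda>j. \<phi> j p) = p"
    by (rule has_dual_basisE[OF assms]) (rule that)
  have "p \<in> comb M n x ` carrier (free_mod R \<one> n)" if p: "p \<in> carrier M" for p
  proof -
    \<comment> \<open>Elements of \<open>free_mod\<close> vanish from index \<open>n\<close> on,
      whereas nothing is known about \<open>\<phi> i\<close> there; the coefficients are cut off at
      \<open>n\<close>.\<close>
    have "comb M n x (\<lambda>i. if i < n then \<phi> i p else \<zero>) = p"
      using *(5)[OF p] msum_cong[of n "\<lambda>i. (if i < n then \<phi> i p else \<zero>) \<odot>\<^bsub>M\<^esub> x i" "\<lambda>i. \<phi> i p \<odot>\<^bsub>M\<^esub> x i" M]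
      by (simp add: comb_def)
    moreover have "(\<lambda>i. if i < n then \<phi> i p else \<zero>) \<in> carrier (free_mod R \<one> n)"
      using lmod_homD(1)[OF *(3)] p by (auto simp: free_mod_carrier)
    ultimately show ?thesis by force
  qed
  then show ?thesis
    unfolding finitely_generated_iff using *(1) comb_closed R.free_mod_closed
    by (intro exI[of _ n] exI[of _ x]) auto
qed

text \<open>Preimages of the finitely many \<open>f (x i)\<close> are chosen and combined with the
  coefficients \<open>\<phi> i p\<close>. Asking only that the image of \<open>f\<close> lie in that
  of \<open>g\<close> permits lifting along maps that are not surjective, such as a restriction to a
  submodule.\<close>

lemma proj_lift:
  assumes P: "left_module R P" "has_dual_basis R e P" and M: "left_module R M" and N: "left_module R N"
    and g: "g \<in> lmod_hom R M N" and f: "f \<in> lmod_hom R P N"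
    and im: "\<And>p. p \<in> carrier P \<Longrightarrow> f p \<in> g ` carrier M"
  shows "\<exists>h \<in> lmod_hom R P M. \<forall>p \<in> carrier P. g (h p) = f p"
proof -
  interpret P: left_module R P by fact
  interpret M: left_module R M by fact
  interpret N: left_module R N by fact
  interpret g: lmod_homomorphism R M N g by unfold_locales fact
  interpret f: lmod_homomorphism R P N f by unfold_locales fact
  obtain n x \<phi> where *: "\<And>j. j < n \<Longrightarrow> x j \<in> carrier P" "\<And>j. j < n \<Longrightarrow> e \<odot>\<^bsub>P\<^esub> x j = x j"
    "\<And>j. j < n \<Longrightarrow> \<phi> j \<in> lmod_hom R P (regular_module R)"
    "\<And>j p. j < n \<Longrightarrow> p \<in> carrier P \<Longrightarrow> \<phi> j p \<otimes>\<^bsub>R\<^esub> e = \<phi> j p"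
    "\<And>p. p \<in> carrier P \<Longrightarrow> comb P n x (\<lambda>j. \<phi> j p) = p"
    by (rule has_dual_basisE[OF P(2)]) (rule that)
  have "\<exists>m. m \<in> carrier M \<and> g m = f (x i)" if "i < n" for i
    using im[OF *(1)[OF that]] by auto
  then obtain m where m: "\<And>i. i < n \<Longrightarrow> m i \<in> carrier M" "\<And>i. i < n \<Longrightarrow> g (m i) = f (x i)"
    by metis
  note c = lmod_homD(1)[OF *(3), simplified]
  show ?thesis
  proof (intro bexI ballI)
    show "(\<lambda>p. comb M n m (\<lambda>i. \<phi> i p)) \<in> lmod_hom R P M"
      unfolding comb_def by (intro M.lmod_hom_msum M.lmod_hom_smult_fixed *(3) m)
    fix p assume p: "p \<in> carrier P"
    have "g (comb M n m (\<lambda>i. \<phi> i p)) = msum N n (\<lambda>i. g (\<phi> i p \<odot>\<^bsub>M\<^esub> m i))"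
      unfolding comb_def by (rule g.f_msum) (use c m p in auto)
    also have "\<dots> = msum N n (\<lambda>i. f (\<phi> i p \<odot>\<^bsub>P\<^esub> x i))"
      by (rule msum_cong) (use c m p * in \<open>simp add: g.f_smult f.f_smult\<close>)
    also have "\<dots> = f (comb P n x (\<lambda>i. \<phi> i p))"
      unfolding comb_def by (rule f.f_msum[symmetric]) (use c * p in auto)
    finally show "g (comb M n m (\<lambda>i. \<phi> i p)) = f p" using *(5) p by simp
  qed
qed

text \<open>The dual basis is carried along the retraction, vectors by \<open>r\<close> and
  functionals by \<open>i\<close>. With \<open>i\<close> and \<open>r\<close> inverse to each other
  this also transfers projectivity between isomorphic modules.\<close>

lemma proj_retract:
  assumes P: "left_module R P" "has_dual_basis R e P" and A: "left_module R A" and e: "e \<in> carrier R"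
    and i: "i \<in> lmod_hom R A P" and r: "r \<in> lmod_hom R P A" and ri: "\<And>a. a \<in> carrier A \<Longrightarrow> r (i a) = a"
  shows "has_dual_basis R e A"
proof -
  interpret r: lmod_homomorphism R P A r by (rule lmod_homomorphismI) fact+
  note ic = lmod_homD(1)[OF i]
  obtain n x \<phi> where *: "\<And>j. j < n \<Longrightarrow> x j \<in> carrier P" "\<And>j. j < n \<Longrightarrow> e \<odot>\<^bsub>P\<^esub> x j = x j"
    "\<And>j. j < n \<Longrightarrow> \<phi> j \<in> lmod_hom R P (regular_module R)"
    "\<And>j p. j < n \<Longrightarrow> p \<in> carrier P \<Longrightarrow> \<phi> j p \<otimes>\<^bsub>R\<^esub> e = \<phi> j p"
    "\<And>p. p \<in> carrier P \<Longrightarrow> comb P n x (\<lambda>j. \<phi> j p) = p"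
    by (rule has_dual_basisE[OF P(2)]) (rule that)
  note c = lmod_homD(1)[OF *(3), simplified]
  show ?thesis
  proof (rule has_dual_basisI[of n "\<lambda>j. r (x j)" _ _ "\<lambda>j a. \<phi> j (i a)"])
    fix j assume j: "j < n"
    show "r (x j) \<in> carrier A" using * j by simp
    show "e \<odot>\<^bsub>A\<^esub> r (x j) = r (x j)" using * j e by (simp add: r.f_smult[symmetric])
    show "(\<lambda>a. \<phi> j (i a)) \<in> lmod_hom R A (regular_module R)"
      using * j i by (intro lmod_hom_comp[OF i]) auto
    show "\<phi> j (i a) \<otimes>\<^bsub>R\<^esub> e = \<phi> j (i a)" if "a \<in> carrier A" for a using * j ic that by simp
  next
    fix a assume a: "a \<in> carrier A"
    have "comb A n (\<lambda>j. r (x j)) (\<lambda>j. \<phi> j (i a)) = msum A n (\<lambda>j. r (\<phi> j (i a) \<odot>\<^bsub>P\<^esub> x j))"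
      unfolding comb_def by (rule msum_cong) (use c ic[OF a] * in \<open>simp add: r.f_smult\<close>)
    also have "\<dots> = r (comb P n x (\<lambda>j. \<phi> j (i a)))"
      unfolding comb_def by (rule r.f_msum[symmetric]) (use c ic[OF a] * in auto)
    finally show "comb A n (\<lambda>j. r (x j)) (\<lambda>j. \<phi> j (i a)) = a"
      using * ic[OF a] ri[OF a] by simp
  qed
qed

lemma (in abelian_group) msum_split:
  "(\<And>i. i < n + k \<Longrightarrow> f i \<in> carrier G) \<Longrightarrow>
    msum G (n + k) f = msum G n f \<oplus> msum G k (\<lambda>i. f (n + i))"
  by (induction k) (auto simp: a_assoc msum_closed)

text \<open>Since \<open>N\<close> is projective, \<open>q\<close> has a section \<open>s\<close>,
  and \<open>M\<close> is the direct sum of the image of \<open>s\<close> and the kernel of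
  \<open>q\<close>; the two dual bases are concatenated.\<close>

lemma proj_extension:
  assumes M: "left_module R M" and N: "left_module R N" "has_dual_basis R e N"
    and q: "q \<in> lmod_hom R M N" "q ` carrier M = carrier N"
    and K: "has_dual_basis R e (M\<lparr>carrier := {x \<in> carrier M. q x = \<zero>\<^bsub>N\<^esub>}\<rparr>)" and e: "e \<in> carrier R"
  shows "has_dual_basis R e M"
proof -
  interpret M: left_module R M by fact
  interpret N: left_module R N by fact
  interpret q: lmod_homomorphism R M N q by unfold_locales fact
  define L where "L = {x \<in> carrier M. q x = \<zero>\<^bsub>N\<^esub>}"
  have L: "submodule L R M" unfolding L_def by (rule q.kernel_submodule)
  note LD = M.submoduleD[OF L]
  obtain s where s: "s \<in> lmod_hom R N M" "\<And>y. y \<in> carrier N \<Longrightarrow> q (s y) = y"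
    using proj_lift[OF N M N(1) q(1) lmod_hom_id] q(2) by blast
  interpret s: lmod_homomorphism R N M s by unfold_locales fact
  \<comment> \<open>The projection onto the kernel of \<open>q\<close> along the image of
    \<open>s\<close>.\<close>
  define t where "t m = m \<ominus>\<^bsub>M\<^esub> s (q m)" for m
  have t: "t \<in> lmod_hom R M M"
    unfolding t_def by (intro M.lmod_hom_minus lmod_hom_id lmod_hom_comp[OF q(1) s(1)])
  have tL: "t m \<in> L" if "m \<in> carrier M" for m
    unfolding t_def L_def using that s(2) by (simp add: q.f_minus)
  have tL': "t \<in> lmod_hom R M (M\<lparr>carrier := L\<rparr>)" by (rule lmod_hom_codomain[OF t tL])
  obtain n x \<phi> where x: "\<And>j. j < n \<Longrightarrow> x j \<in> carrier N" "\<And>j. j < n \<Longrightarrow> e \<odot>\<^bsub>N\<^esub> x j = x j"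
    "\<And>j. j < n \<Longrightarrow> \<phi> j \<in> lmod_hom R N (regular_module R)"
    "\<And>j p. j < n \<Longrightarrow> p \<in> carrier N \<Longrightarrow> \<phi> j p \<otimes>\<^bsub>R\<^esub> e = \<phi> j p"
    "\<And>p. p \<in> carrier N \<Longrightarrow> comb N n x (\<lambda>j. \<phi> j p) = p"
    by (rule has_dual_basisE[OF N(2)]) (rule that)
  obtain k y \<psi> where y: "\<And>j. j < k \<Longrightarrow> y j \<in> L" "\<And>j. j < k \<Longrightarrow> e \<odot>\<^bsub>M\<^esub> y j = y j"
    "\<And>j. j < k \<Longrightarrow> \<psi> j \<in> lmod_hom R (M\<lparr>carrier := L\<rparr>) (regular_module R)"
    "\<And>j p. j < k \<Longrightarrow> p \<in> L \<Longrightarrow> \<psi> j p \<otimes>\<^bsub>R\<^esub> e = \<psi> j p"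
    "\<And>p. p \<in> L \<Longrightarrow> comb M k y (\<lambda>j. \<psi> j p) = p"
    using has_dual_basisE[OF K] unfolding L_def[symmetric] comb_carrier_update by auto
  note cx = lmod_homD(1)[OF x(3), simplified] and cy = lmod_homD(1)[OF y(3), simplified]
  \<comment> \<open>Indices below \<open>n\<close> belong to \<open>N\<close>, the next
    \<open>k\<close> indices to the kernel, whence the shift by \<open>n\<close>.\<close>
  define z where "z j = (if j < n then s (x j) else y (j - n))" for j
  define \<chi> where "\<chi> j m = (if j < n then \<phi> j (q m) else \<psi> (j - n) (t m))" for j m
  have z: "z j \<in> carrier M" if "j < n + k" for j
    using that x(1) y(1) LD by (auto simp: z_def)
  show ?thesis
  proof (rule has_dual_basisI[of "n + k" z _ _ \<chi>])
    fix j assume j: "j < n + k"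
    show "z j \<in> carrier M" by (rule z[OF j])
    show "e \<odot>\<^bsub>M\<^esub> z j = z j"
      using j x y e by (auto simp: z_def s.f_smult[symmetric])
    show "\<chi> j \<in> lmod_hom R M (regular_module R)"
    proof (cases "j < n")
      case True
      then show ?thesis unfolding \<chi>_def using lmod_hom_comp[OF q(1) x(3)[OF True]] by simp
    next
      case False
      then have "j - n < k" using j by auto
      then show ?thesis unfolding \<chi>_def using False lmod_hom_comp[OF tL' y(3)] by simp
    qed
    show "\<chi> j m \<otimes>\<^bsub>R\<^esub> e = \<chi> j m" if "m \<in> carrier M" for m
      using that j x(4) y(4) tL by (auto simp: \<chi>_def)
  next
    fix m assume m: "m \<in> carrier M"
    have \<chi>: "\<chi> j m \<in> carrier R" if "j < n + k" for j
      using that cx cy tL[OF m] m unfolding \<chi>_def by auto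
    have "comb M (n + k) z (\<lambda>j. \<chi> j m)
        = msum M n (\<lambda>j. \<chi> j m \<odot>\<^bsub>M\<^esub> z j) \<oplus>\<^bsub>M\<^esub> msum M k (\<lambda>j. \<chi> (n + j) m \<odot>\<^bsub>M\<^esub> z (n + j))"
      unfolding comb_def by (rule M.M.msum_split) (use z \<chi> in auto)
    also have "msum M n (\<lambda>j. \<chi> j m \<odot>\<^bsub>M\<^esub> z j) = msum M n (\<lambda>j. s (\<phi> j (q m) \<odot>\<^bsub>N\<^esub> x j))"
      by (rule msum_cong) (use cx x(1) m in \<open>simp add: \<chi>_def z_def s.f_smult\<close>)
    also have "\<dots> = s (comb N n x (\<lambda>j. \<phi> j (q m)))"
      unfolding comb_def by (rule s.f_msum[symmetric]) (use cx x(1) m in auto)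
    also have "\<dots> = s (q m)" using x(5) m by simp
    also have "msum M k (\<lambda>j. \<chi> (n + j) m \<odot>\<^bsub>M\<^esub> z (n + j)) = comb M k y (\<lambda>j. \<psi> j (t m))"
      by (simp add: comb_def \<chi>_def z_def)
    also have "\<dots> = t m" using y(5) tL m by simp
    also have "s (q m) \<oplus>\<^bsub>M\<^esub> t m = m"
      unfolding t_def a_minus_def using m
      by (metis M.M.a_closed M.M.add.inv_closed M.M.add.m_lcomm M.M.r_neg M.M.r_zero q.f_closed s.f_closed)
    finally show "comb M (n + k) z (\<lambda>j. \<chi> j m) = m" .
  qed
qed

section \<open>Projective resolutions of length at most one\<close>

lemma finitely_generated_image:
  assumes M: "left_module R M" "finitely_generated R M" and N: "left_module R N"
    and f: "f \<in> lmod_hom R M N" "f ` carrier M = carrier N"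
  shows "finitely_generated R N"
proof -
  interpret M: left_module R M by fact
  interpret N: left_module R N by fact
  interpret f: lmod_homomorphism R M N f by unfold_locales fact
  obtain n x where x: "\<And>i. i < n \<Longrightarrow> x i \<in> carrier M"
    and s: "comb M n x ` carrier (free_mod R \<one>\<^bsub>R\<^esub> n) = carrier M"
    using M(2) unfolding M.finitely_generated_iff by auto
  have "f (comb M n x g) = comb N n (\<lambda>i. f (x i)) g" if g: "g \<in> carrier (free_mod R \<one>\<^bsub>R\<^esub> n)" for g
  proof -
    note gc = M.R.free_mod_closed[OF g]
    have "f (comb M n x g) = msum N n (\<lambda>i. f (g i \<odot>\<^bsub>M\<^esub> x i))"
      unfolding comb_def by (rule f.f_msum) (use gc x in auto)
    also have "\<dots> = comb N n (\<lambda>i. f (x i)) g"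
      unfolding comb_def by (rule msum_cong) (use gc x in \<open>simp add: f.f_smult\<close>)
    finally show ?thesis .
  qed
  then have "comb N n (\<lambda>i. f (x i)) ` carrier (free_mod R \<one>\<^bsub>R\<^esub> n) = f ` carrier M"
    unfolding s[symmetric] image_image by (intro image_cong) auto
  then show ?thesis
    unfolding N.finitely_generated_iff using f(2) x by (intro exI[of _ n] exI[of _ "\<lambda>i. f (x i)"]) auto
qed

text \<open>Projectivity and resolutions are defined through modules carried by
  \<open>nat \<Rightarrow> 'r\<close>. A finitely generated module of any type is moved there by
  naming each element by one chosen coefficient vector.\<close>

lemma small_copy:
  fixes R :: "('r, 'x) ring_scheme" and M :: "('r, 'm) module"
  assumes M: "left_module R M" "finitely_generated R M"
  obtains S :: "'r small_module" and f g
  where "left_module R S" "f \<in> lmod_hom R M S" "g \<in> lmod_hom R S M"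
    "\<And>x. x \<in> carrier M \<Longrightarrow> g (f x) = x" "\<And>y. y \<in> carrier S \<Longrightarrow> f (g y) = y"
proof -
  interpret M: left_module R M by fact
  obtain n x where x: "\<And>i. i < n \<Longrightarrow> x i \<in> carrier M"
    and s: "comb M n x ` carrier (free_mod R \<one>\<^bsub>R\<^esub> n) = carrier M"
    using M(2) unfolding M.finitely_generated_iff by auto
  have "\<exists>h. comb M n x h = m" if "m \<in> carrier M" for m
    using that unfolding s[symmetric] by auto
  then obtain f where f: "\<And>m. m \<in> carrier M \<Longrightarrow> comb M n x (f m) = m" by metis
  define g where "g = comb M n x"
  \<comment> \<open>The names \<open>f m\<close> form the carrier, and the operations are
    transported through \<open>g\<close>, which reads a name as a linear combination.\<close>
  define S where "S = \<lparr>carrier = f ` carrier M, monoid.mult = (\<lambda>a b. a), one = f \<zero>\<^bsub>M\<^esub>,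
    zero = f \<zero>\<^bsub>M\<^esub>, add = (\<lambda>a b. f (g a \<oplus>\<^bsub>M\<^esub> g b)), smult = (\<lambda>r a. f (r \<odot>\<^bsub>M\<^esub> g a))\<rparr>"
  have gf: "g (f m) = m" if "m \<in> carrier M" for m using f that by (simp add: g_def)
  have S [simp]: "carrier S = f ` carrier M" "zero S = f \<zero>\<^bsub>M\<^esub>" "add S = (\<lambda>a b. f (g a \<oplus>\<^bsub>M\<^esub> g b))"
    "smult S = (\<lambda>r a. f (r \<odot>\<^bsub>M\<^esub> g a))" by (simp_all add: S_def)
  have "abelian_group S"
  proof (rule abelian_groupI)
    fix a assume "a \<in> carrier S"
    then obtain m where m: "m \<in> carrier M" "a = f m" by auto
    then show "\<exists>b\<in>carrier S. b \<oplus>\<^bsub>S\<^esub> a = \<zero>\<^bsub>S\<^esub>"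
      by (intro bexI[of _ "f (\<ominus>\<^bsub>M\<^esub> m)"]) (auto simp: gf M.M.l_neg)
  qed (auto simp: gf M.M.a_ac)
  then have SL: "left_module R S"
    by (auto simp: left_module_def left_module_axioms_def M.R.ring_axioms gf M.smult_l_distr
        M.smult_r_distr M.smult_assoc1)
  show thesis
  proof (rule that[OF SL])
    show "f \<in> lmod_hom R M S" "g \<in> lmod_hom R S M" by (auto intro!: lmod_homI simp: gf)
  qed (auto simp: gf)
qed

lemma proj_projective:
  assumes P: "left_module R P" "has_dual_basis R e P"
  shows "projective R P"
  unfolding projective_def fg_left_module_def
proof (intro conjI allI impI ballI)
  interpret P: left_module R P by fact
  show "left_module R P" "finitely_generated R P" using P P.proj_finitely_generated by auto
  fix M N :: "'a small_module" and g f
  assume *: "g \<in> lmod_hom R M N" "f \<in> lmod_hom R P N" "left_module R M \<and> finitely_generated R M"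
    "left_module R N \<and> finitely_generated R N" "g ` carrier M = carrier N"
  show "\<exists>h\<in>lmod_hom R P M. \<forall>x\<in>carrier P. g (h x) = f x"
    by (rule proj_lift[OF P _ _ *(1,2)]) (use * lmod_homD(1)[OF *(2)] in auto)
qed

text \<open>The lifting property may be tested only against small modules, so \<open>P\<close> is
  replaced as a target by its small copy \<open>S\<close>. Lifting \<open>f\<close> through the
  cover of \<open>S\<close> by \<open>R^n\<close> makes \<open>P\<close> a retract of
  \<open>R^n\<close>.\<close>

lemma projective_proj:
  assumes "projective R P"
  shows "left_module R P" "proj R P"
proof -
  show P: "left_module R P" using assms by (simp add: projective_def fg_left_module_def)
  interpret P: left_module R P by fact
  have fg: "finitely_generated R P" using assms by (simp add: projective_def fg_left_module_def)
  then obtain n x where x: "\<And>i. i < n \<Longrightarrow> x i \<in> carrier P"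
    and s: "comb P n x ` carrier (free_mod R \<one>\<^bsub>R\<^esub> n) = carrier P"
    unfolding P.finitely_generated_iff by auto
  obtain S :: "'a small_module" and f g where
    S: "left_module R S" "f \<in> lmod_hom R P S" "g \<in> lmod_hom R S P"
      "\<And>x. x \<in> carrier P \<Longrightarrow> g (f x) = x" "\<And>y. y \<in> carrier S \<Longrightarrow> f (g y) = y"
    by (rule small_copy[OF P fg]) (rule that)
  define F where "F = free_mod R \<one>\<^bsub>R\<^esub> n"
  have F: "left_module R F" "proj R F"
    unfolding F_def by (simp_all add: P.R.free_mod_left_module P.R.free_mod_dual_basis)
  have fS: "f ` carrier P = carrier S"
  proof (intro equalityI image_subsetI subsetI)
    fix y assume y: "y \<in> carrier S"
    then show "y \<in> f ` carrier P"
      using S(5)[OF y] lmod_homD(1)[OF S(3) y] by (intro image_eqI[of _ _ "g y"]) auto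
  qed (rule lmod_homD(1)[OF S(2)])
  have c: "comb P n x \<in> lmod_hom R F P" unfolding F_def by (rule P.comb_hom[OF x])
  have "fg_left_module R F"
    unfolding fg_left_module_def using F left_module.proj_finitely_generated[OF F] by simp
  moreover have "fg_left_module R S"
    unfolding fg_left_module_def using S(1) finitely_generated_image[OF P fg S(1) S(2) fS] by simp
  moreover have "(\<lambda>y. f (comb P n x y)) ` carrier F = carrier S"
    unfolding fS[symmetric] s[symmetric] F_def by (simp add: image_image)
  ultimately have "\<exists>h\<in>lmod_hom R P F. \<forall>p\<in>carrier P. f (comb P n x (h p)) = f p"
    using lmod_hom_comp[OF c S(2)] S(2)
    by (intro assms[unfolded projective_def, THEN conjunct2, rule_format])
  then obtain h where h: "h \<in> lmod_hom R P F" "\<And>p. p \<in> carrier P \<Longrightarrow> f (comb P n x (h p)) = f p"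
    by auto
  have "comb P n x (h p) = p" if "p \<in> carrier P" for p
    using h(2)[OF that] S(4) lmod_homD(1)[OF c] lmod_homD(1)[OF h(1)] that by metis
  then show "proj R P"
    by (rule proj_retract[OF F P P.R.one_closed h(1) c])
qed

text \<open>The surjection and its kernel already form a resolution; since the terms must live in
  the fixed type, both are replaced by small copies and continued by zero. The case
  \<open>n = 0\<close> covers an injective \<open>p\<close>.\<close>

lemma proj_has_resolution:
  assumes P: "left_module R P" "proj R P" and X: "left_module R X"
    and p: "p \<in> lmod_hom R P X" "p ` carrier P = carrier X"
    and K: "proj R (P\<lparr>carrier := {x \<in> carrier P. p x = \<zero>\<^bsub>X\<^esub>}\<rparr>)"
    and n: "n = 0 \<longrightarrow> (\<forall>x \<in> carrier P. p x = \<zero>\<^bsub>X\<^esub> \<longrightarrow> x = \<zero>\<^bsub>P\<^esub>)"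
  shows "has_projective_resolution R X n"
proof -
  interpret P: left_module R P by fact
  interpret X: left_module R X by fact
  interpret p: lmod_homomorphism R P X p by unfold_locales fact
  define L where "L = {x \<in> carrier P. p x = \<zero>\<^bsub>X\<^esub>}"
  have L: "left_module R (P\<lparr>carrier := L\<rparr>)"
    unfolding L_def by (rule P.submodule_left_module[OF p.kernel_submodule])
  interpret L: left_module R "P\<lparr>carrier := L\<rparr>" by fact
  have i: "(\<lambda>x. x) \<in> lmod_hom R (P\<lparr>carrier := L\<rparr>) P"
    by (rule lmod_hom_restrict[OF lmod_hom_id]) (auto simp: L_def)
  have KL: "proj R (P\<lparr>carrier := L\<rparr>)" using K by (simp add: L_def)
  obtain S0 :: "'a small_module" and f0 g0 where
    S0: "left_module R S0" "f0 \<in> lmod_hom R P S0" "g0 \<in> lmod_hom R S0 P"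
      "\<And>x. x \<in> carrier P \<Longrightarrow> g0 (f0 x) = x" "\<And>y. y \<in> carrier S0 \<Longrightarrow> f0 (g0 y) = y"
    by (rule small_copy[OF P(1) P.proj_finitely_generated[OF P(2)]]) (rule that)
  obtain S1 :: "'a small_module" and f1 g1 where
    S1: "left_module R S1" "f1 \<in> lmod_hom R (P\<lparr>carrier := L\<rparr>) S1" "g1 \<in> lmod_hom R S1 (P\<lparr>carrier := L\<rparr>)"
      "\<And>x. x \<in> carrier (P\<lparr>carrier := L\<rparr>) \<Longrightarrow> g1 (f1 x) = x" "\<And>y. y \<in> carrier S1 \<Longrightarrow> f1 (g1 y) = y"
    by (rule small_copy[OF L L.proj_finitely_generated[OF KL]]) (rule that)
  interpret f0: lmod_homomorphism R P S0 f0 by (rule lmod_homomorphismI) (use P S0 in auto)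
  interpret g0: lmod_homomorphism R S0 P g0 by (rule lmod_homomorphismI) (use P S0 in auto)
  interpret f1: lmod_homomorphism R "P\<lparr>carrier := L\<rparr>" S1 f1 by (rule lmod_homomorphismI) (use L S1 in auto)
  interpret g1: lmod_homomorphism R S1 "P\<lparr>carrier := L\<rparr>" g1 by (rule lmod_homomorphismI) (use L S1 in auto)
  \<comment> \<open>The free module of rank zero serves as the term in all degrees above
    one.\<close>
  define Z where "Z = free_mod R \<one>\<^bsub>R\<^esub> 0"
  have "carrier Z = {\<zero>\<^bsub>Z\<^esub>}" unfolding Z_def by (auto simp: free_mod_carrier fun_eq_iff)
  then have Z: "left_module R Z" "proj R Z" "carrier Z = {\<zero>\<^bsub>Z\<^esub>}"
    unfolding Z_def by (simp_all add: P.R.free_mod_left_module P.R.free_mod_dual_basis)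
  have pS0: "projective R S0"
    using proj_retract[OF P S0(1) P.R.one_closed S0(3,2,5)] S0(1) by (rule proj_projective[rotated])
  have pS1: "projective R S1"
    using proj_retract[OF L KL S1(1) P.R.one_closed S1(3,2,5)] S1(1) by (rule proj_projective[rotated])
  have pZ: "projective R Z" by (rule proj_projective[OF Z(1,2)])
  define Q where "Q i = (if i = 0 then S0 else if i = 1 then S1 else Z)" for i :: nat
  define d where "d i = (if i = 0 then (\<lambda>y. f0 (g1 y)) else (\<lambda>_. \<zero>\<^bsub>Q i\<^esub>))" for i :: nat
  have Q: "left_module R (Q i)" for i using S0 S1 Z by (simp add: Q_def)
  have g1L: "g1 y \<in> L" if "y \<in> carrier S1" for y using g1.f_closed[OF that] by simp
  have f0g1: "f0 (g1 y) = \<zero>\<^bsub>S0\<^esub> \<longleftrightarrow> y = \<zero>\<^bsub>S1\<^esub>" if "y \<in> carrier S1" for y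
  proof
    assume *: "f0 (g1 y) = \<zero>\<^bsub>S0\<^esub>"
    have "g1 y = g0 (f0 (g1 y))" using S0(4) g1L[OF that] by (simp add: L_def)
    then have "g1 y = \<zero>\<^bsub>P\<^esub>" using * by simp
    then have "f1 (g1 y) = \<zero>\<^bsub>S1\<^esub>" using f1.f_zero by simp
    then show "y = \<zero>\<^bsub>S1\<^esub>" using S1(5) that by simp
  next
    assume "y = \<zero>\<^bsub>S1\<^esub>"
    then show "f0 (g1 y) = \<zero>\<^bsub>S0\<^esub>" using g1.f_zero by simp
  qed
  show ?thesis
    unfolding has_projective_resolution_def
  proof (intro exI[of _ Q] exI[of _ d] exI[of _ "\<lambda>y. p (g0 y)"] conjI allI impI)
    show "projective R (Q i)" for i using pS0 pS1 pZ by (simp add: Q_def)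
    \<comment> \<open>The only index above \<open>n\<close> at which the term is not
      \<open>Z\<close> is 1, and it exceeds \<open>n\<close> only for \<open>n = 0\<close>, where
      \<open>p\<close> is injective.\<close>
    show "carrier (Q i) = {\<zero>\<^bsub>Q i\<^esub>}" if "i > n" for i
    proof (cases "i = 1")
      case True
      then have "L = {\<zero>\<^bsub>P\<^esub>}" using that n by (auto simp: L_def)
      then have "g1 y = \<zero>\<^bsub>P\<^esub>" if "y \<in> carrier S1" for y using g1L[OF that] by simp
      then have "carrier S1 = {\<zero>\<^bsub>S1\<^esub>}" using f0g1 by auto
      then show ?thesis using True by (simp add: Q_def)
    qed (use that Z in \<open>auto simp: Q_def\<close>)
    show "d i \<in> lmod_hom R (Q (Suc i)) (Q i)" for i
    proof (cases "i = 0")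
      case True
      have "(\<lambda>y. f0 (g1 y)) \<in> lmod_hom R S1 S0"
        by (rule lmod_hom_comp[OF S1(3) lmod_hom_comp[OF i S0(2)]])
      then show ?thesis using True by (simp add: d_def Q_def)
    next
      case False
      then show ?thesis using left_module.lmod_hom_zero[OF Q] by (simp add: d_def)
    qed
    show "(\<lambda>y. p (g0 y)) \<in> lmod_hom R (Q 0) X"
      using lmod_hom_comp[OF S0(3) p(1)] by (simp add: Q_def)
    have "carrier P = g0 ` carrier S0"
    proof (intro equalityI subsetI)
      fix x assume x: "x \<in> carrier P"
      then show "x \<in> g0 ` carrier S0" by (intro image_eqI[of _ _ "f0 x"]) (simp_all add: S0(4))
    qed auto
    then show "(\<lambda>y. p (g0 y)) ` carrier (Q 0) = carrier X"
      using p(2) by (simp add: Q_def image_image[symmetric])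
    have "f0 (g1 y) \<in> a_kernel S0 X (\<lambda>y. p (g0 y))" if "y \<in> carrier S1" for y
      using g1L[OF that] S0(4) by (simp add: a_kernel_def' L_def)
    moreover have "z \<in> (\<lambda>y. f0 (g1 y)) ` carrier S1" if z: "z \<in> a_kernel S0 X (\<lambda>y. p (g0 y))" for z
    proof -
      have "g0 z \<in> L" using z by (auto simp: a_kernel_def' L_def)
      then show ?thesis using z S1(4) S0(5) f1.f_closed
        by (intro image_eqI[of _ _ "f1 (g0 z)"]) (auto simp: a_kernel_def')
    qed
    ultimately show "d 0 ` carrier (Q 1) = a_kernel (Q 0) X (\<lambda>y. p (g0 y))"
      by (auto simp: d_def Q_def)
    show "d (Suc i) ` carrier (Q (Suc (Suc i))) = a_kernel (Q (Suc i)) (Q i) (d i)" for i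
    proof (cases "i = 0")
      case True
      have "a_kernel S1 S0 (\<lambda>y. f0 (g1 y)) = {\<zero>\<^bsub>S1\<^esub>}"
        using f0g1 by (auto simp: a_kernel_def')
      then show ?thesis using True Z by (simp add: d_def Q_def)
    next
      case False
      then show ?thesis using Z by (auto simp: d_def Q_def a_kernel_def')
    qed
  qed
qed

lemma proj_has_resolution_0:
  assumes "left_module R X" "proj R X"
  shows "has_projective_resolution R X 0"
proof -
  interpret left_module R X by fact
  have "proj R (X\<lparr>carrier := {\<zero>\<^bsub>X\<^esub>}\<rparr>)"
    by (rule has_dual_basisI[of 0]) (auto simp: comb_def)
  moreover have "{x \<in> carrier X. x = \<zero>\<^bsub>X\<^esub>} = {\<zero>\<^bsub>X\<^esub>}" by auto
  ultimately show ?thesis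
    by (intro proj_has_resolution[OF assms assms(1) lmod_hom_id]) auto
qed

text \<open>As the terms beyond degree one vanish, exactness makes \<open>d 0\<close> injective,
  hence an isomorphism from the projective \<open>Q 1\<close> onto the kernel of
  \<open>p\<close>.\<close>

lemma resolution_1_proj:
  fixes R :: "('r, 'x) ring_scheme" and X :: "('r, 'm) module"
  assumes "has_projective_resolution R X 1" and X: "left_module R X"
  obtains P :: "'r small_module" and p where "left_module R P" "proj R P" "p \<in> lmod_hom R P X"
    "p ` carrier P = carrier X" "proj R (P\<lparr>carrier := {x \<in> carrier P. p x = \<zero>\<^bsub>X\<^esub>}\<rparr>)"
proof -
  obtain Q :: "nat \<Rightarrow> 'r small_module" and d p where
    Q: "\<And>i. projective R (Q i)" "\<And>i. i > 1 \<Longrightarrow> carrier (Q i) = {\<zero>\<^bsub>Q i\<^esub>}"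
    "\<And>i. d i \<in> lmod_hom R (Q (Suc i)) (Q i)" "p \<in> lmod_hom R (Q 0) X"
    "p ` carrier (Q 0) = carrier X" "d 0 ` carrier (Q 1) = a_kernel (Q 0) X p"
    "\<And>i. d (Suc i) ` carrier (Q (Suc (Suc i))) = a_kernel (Q (Suc i)) (Q i) (d i)"
    using assms(1) unfolding has_projective_resolution_def by metis
  note QL = projective_proj(1)[OF Q(1)] and QP = projective_proj(2)[OF Q(1)]
  interpret Q0: left_module R "Q 0" by (rule QL)
  interpret Q1: left_module R "Q 1" by (rule QL)
  interpret d0: lmod_homomorphism R "Q 1" "Q 0" "d 0"
    by (rule lmod_homomorphismI) (use QL Q(3)[of 0] in auto)
  interpret d1: lmod_homomorphism R "Q 2" "Q 1" "d 1"
    by (rule lmod_homomorphismI) (use QL Q(3)[of 1] in \<open>auto simp: numeral_2_eq_2\<close>)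
  interpret p: lmod_homomorphism R "Q 0" X p by (rule lmod_homomorphismI) (use QL Q(4) X in auto)
  define L where "L = {x \<in> carrier (Q 0). p x = \<zero>\<^bsub>X\<^esub>}"
  have dL: "d 0 ` carrier (Q 1) = L" using Q(6) by (simp add: L_def a_kernel_def')
  have L: "left_module R ((Q 0)\<lparr>carrier := L\<rparr>)"
    unfolding L_def by (rule Q0.submodule_left_module[OF p.kernel_submodule])
  have "a_kernel (Q 1) (Q 0) (d 0) = {\<zero>\<^bsub>Q 1\<^esub>}"
    using Q(7)[of 0] Q(2)[of 2] d1.f_zero by (simp add: numeral_2_eq_2)
  then have ker: "x = \<zero>\<^bsub>Q 1\<^esub>" if "x \<in> carrier (Q 1)" "d 0 x = \<zero>\<^bsub>Q 0\<^esub>" for x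
    using that by (auto simp: a_kernel_def')
  have dh: "d 0 \<in> lmod_hom R (Q 1) ((Q 0)\<lparr>carrier := L\<rparr>)"
    using Q(3)[of 0] dL by (intro lmod_hom_codomain) auto
  interpret dL: lmod_homomorphism R "Q 1" "(Q 0)\<lparr>carrier := L\<rparr>" "d 0"
    by (rule lmod_homomorphismI) (use QL L dh in auto)
  obtain h where h: "h \<in> lmod_hom R ((Q 0)\<lparr>carrier := L\<rparr>) (Q 1)"
    "\<And>x. x \<in> carrier (Q 1) \<Longrightarrow> h (d 0 x) = x"
    using dL.factor[OF QL lmod_hom_id] dL ker by auto
  have "proj R ((Q 0)\<lparr>carrier := L\<rparr>)"
    by (rule proj_retract[OF QL QP L Q0.R.one_closed h(1) dh]) (use dL h(2) in auto)
  then show thesis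
    using that[OF QL QP Q(4,5)] by (simp add: L_def)
qed

text \<open>A finite infimum cannot come from the empty set, whose infimum is
  \<open>\<infinity>\<close>, and the infimum of a nonempty set of naturals is attained.\<close>

lemma pd_eq_enat:
  assumes "pd R X = enat n"
  shows "has_projective_resolution R X n" "\<And>m. m < n \<Longrightarrow> \<not> has_projective_resolution R X m"
proof -
  let ?A = "{n. has_projective_resolution R X n}"
  have "?A \<noteq> {}"
  proof
    assume "?A = {}"
    then have "pd R X = \<infinity>" unfolding pd_def by (simp only: image_empty) (simp add: top_enat_def)
    then show False using assms by simp
  qed
  then have "(LEAST k. k \<in> ?A) \<in> ?A" by (auto intro: LeastI)
  moreover have "Inf (enat ` ?A) = enat (LEAST k. k \<in> ?A)"
    using calculation by (intro antisym Inf_lower Inf_greatest) (auto intro: Least_le)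
  ultimately show "has_projective_resolution R X n" using assms by (simp add: pd_def)
  show "\<not> has_projective_resolution R X m" if "m < n" for m
  proof
    assume "has_projective_resolution R X m"
    then have "pd R X \<le> enat m" unfolding pd_def by (intro Inf_lower) simp
    then show False using assms that by simp
  qed
qed

lemma pd_le_1: "has_projective_resolution R X 1 \<Longrightarrow> pd R X \<le> 1"
  unfolding pd_def one_enat_def by (intro Inf_lower) simp

section \<open>Complements\<close>

context left_module
begin

lemma add_minus_cancel [simp]:
  assumes "x \<in> carrier M" "y \<in> carrier M"
  shows "x \<oplus>\<^bsub>M\<^esub> y \<ominus>\<^bsub>M\<^esub> y = x" "y \<oplus>\<^bsub>M\<^esub> x \<ominus>\<^bsub>M\<^esub> y = x"
    "x \<ominus>\<^bsub>M\<^esub> y \<oplus>\<^bsub>M\<^esub> y = x" "y \<oplus>\<^bsub>M\<^esub> (x \<ominus>\<^bsub>M\<^esub> y) = x"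
proof -
  show "x \<oplus>\<^bsub>M\<^esub> y \<ominus>\<^bsub>M\<^esub> y = x" using assms by (simp add: a_minus_def M.a_assoc M.r_neg)
  then show "y \<oplus>\<^bsub>M\<^esub> x \<ominus>\<^bsub>M\<^esub> y = x" using assms by (simp add: M.a_comm)
  show "x \<ominus>\<^bsub>M\<^esub> y \<oplus>\<^bsub>M\<^esub> y = x" using assms by (simp add: a_minus_def M.a_assoc M.l_neg)
  then show "y \<oplus>\<^bsub>M\<^esub> (x \<ominus>\<^bsub>M\<^esub> y) = x" using assms by (simp add: M.a_comm)
qed

lemma submodule_Union_chain:
  assumes "C \<noteq> {}" "subset.chain A C" "\<And>N. N \<in> A \<Longrightarrow> submodule N R M"
  shows "submodule (\<Union>C) R M"
proof -
  have s: "submodule N R M" if "N \<in> C" for N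
    using assms(2,3) that by (auto simp: subset.chain_def)
  note d = submoduleD[OF s]
  have ch: "N \<subseteq> L \<or> L \<subseteq> N" if "N \<in> C" "L \<in> C" for N L
    using assms(2) that by (auto simp: subset.chain_def)
  show ?thesis
  proof (rule submoduleI)
    show "\<Union>C \<subseteq> carrier M" using d(1) by auto
    show "\<zero>\<^bsub>M\<^esub> \<in> \<Union>C" using assms(1) d(2) by auto
    show "a \<odot>\<^bsub>M\<^esub> x \<in> \<Union>C" if "a \<in> carrier R" "x \<in> \<Union>C" for a x
      using that d(4) by auto
    fix x y assume "x \<in> \<Union>C" "y \<in> \<Union>C"
    then obtain N L where *: "N \<in> C" "L \<in> C" "x \<in> N" "y \<in> L" by auto
    then show "x \<oplus>\<^bsub>M\<^esub> y \<in> \<Union>C"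
      using ch[OF *(1,2)] d(3)[OF *(1)] d(3)[OF *(2)] by (metis UnionI subsetD)
  qed
qed

text \<open>Zorn's lemma for complements of \<open>U\<close> relative to \<open>B\<close>. For
  \<open>B = 0\<close> this is the usual maximal complement; taking for \<open>B\<close> the
  \<open>e2\<close>-part of a module gives complements that concern the \<open>e1\<close>-part
  only.\<close>

lemma maximal_relative_complement:
  assumes B: "submodule B R M" "B \<subseteq> U"
  obtains W where "submodule W R M" "U \<inter> W = B"
    "\<And>W'. submodule W' R M \<Longrightarrow> W \<subseteq> W' \<Longrightarrow> U \<inter> W' = B \<Longrightarrow> W' = W"
proof -
  define A where "A = {W. submodule W R M \<and> U \<inter> W = B}"
  have "B \<in> A" using B by (auto simp: A_def)
  moreover have "\<Union>C \<in> A" if "C \<noteq> {}" "subset.chain A C" for C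
  proof -
    have "submodule (\<Union>C) R M" by (rule submodule_Union_chain[OF that]) (simp add: A_def)
    moreover have "U \<inter> N = B" if "N \<in> C" for N
      using \<open>subset.chain A C\<close> that by (auto simp: subset.chain_def A_def)
    ultimately show ?thesis using \<open>C \<noteq> {}\<close> unfolding A_def by blast
  qed
  ultimately have "\<exists>W\<in>A. \<forall>X\<in>A. W \<subseteq> X \<longrightarrow> X = W"
    using subset_Zorn_nonempty[of A] by blast
  then show thesis using that by (auto simp: A_def)
qed

text \<open>Zorn's lemma applies because a finite generating set inside the union of a chain already
  lies in one member, so the union of a chain of proper submodules is proper.\<close>

lemma maximal_submodule:
  assumes fg: "finitely_generated R M" and N: "submodule N R M" "N \<noteq> carrier M"
  obtains W where "submodule W R M" "N \<subseteq> W" "W \<noteq> carrier M"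
    "\<And>W'. submodule W' R M \<Longrightarrow> W \<subseteq> W' \<Longrightarrow> W' = W \<or> W' = carrier M"
proof -
  obtain S where S: "finite S" "S \<subseteq> carrier M" "\<And>N. submodule N R M \<Longrightarrow> S \<subseteq> N \<Longrightarrow> N = carrier M"
    using fg by (auto simp: finitely_generated_def)
  define A where "A = {W. submodule W R M \<and> N \<subseteq> W \<and> W \<noteq> carrier M}"
  have "N \<in> A" using N by (auto simp: A_def)
  moreover have "\<Union>C \<in> A" if C: "C \<noteq> {}" "subset.chain A C" for C
  proof -
    have CA: "L \<in> A" if "L \<in> C" for L using C that by (auto simp: subset.chain_def)
    have "submodule (\<Union>C) R M" by (rule submodule_Union_chain[OF C]) (simp add: A_def)
    moreover have "N \<subseteq> \<Union>C" using C(1) CA by (auto simp: A_def)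
    moreover have "\<Union>C \<noteq> carrier M"
    proof
      assume "\<Union>C = carrier M"
      then have "S \<subseteq> \<Union>C" using S(2) by simp
      then obtain L where "L \<in> C" "S \<subseteq> L"
        using finite_subset_Union_chain[OF S(1) _ C] by metis
      then show False using CA[of L] S(3)[of L] by (auto simp: A_def)
    qed
    ultimately show ?thesis by (simp add: A_def)
  qed
  ultimately have "\<exists>W\<in>A. \<forall>X\<in>A. W \<subseteq> X \<longrightarrow> X = W"
    using subset_Zorn_nonempty[of A] by blast
  then obtain W where W: "W \<in> A" "\<And>X. X \<in> A \<Longrightarrow> W \<subseteq> X \<Longrightarrow> X = W" by auto
  have "W' = W \<or> W' = carrier M" if "submodule W' R M" "W \<subseteq> W'" for W'
    using W(2)[of W'] W(1) that unfolding A_def by blast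
  then show thesis using that[of W] W(1) by (simp add: A_def)
qed

lemma direct_sum_projection:
  assumes A: "submodule A R M" and B: "submodule B R M"
    and AB: "A <+>\<^bsub>M\<^esub> B = carrier M" "A \<inter> B = {\<zero>\<^bsub>M\<^esub>}"
  obtains r where "r \<in> lmod_hom R M M" "\<And>m. m \<in> carrier M \<Longrightarrow> r m \<in> A"
    "\<And>m. m \<in> carrier M \<Longrightarrow> m \<ominus>\<^bsub>M\<^esub> r m \<in> B" "\<And>a. a \<in> A \<Longrightarrow> r a = a"
    "\<And>b. b \<in> B \<Longrightarrow> r b = \<zero>\<^bsub>M\<^esub>"
proof -
  note a = submoduleD[OF A] and b = submoduleD[OF B]
  have uniq: "x = x'" if "x \<in> A" "x' \<in> A" "y \<in> B" "y' \<in> B" "x \<oplus>\<^bsub>M\<^esub> y = x' \<oplus>\<^bsub>M\<^esub> y'" for x x' y y'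
  proof -
    have c: "x \<in> carrier M" "x' \<in> carrier M" "y \<in> carrier M" "y' \<in> carrier M" using that a(7) b(7) by auto
    have "x \<ominus>\<^bsub>M\<^esub> x' = y' \<ominus>\<^bsub>M\<^esub> y"
    proof -
      have "x = (x' \<oplus>\<^bsub>M\<^esub> y') \<ominus>\<^bsub>M\<^esub> y" using c by (simp flip: that(5))
      also have "\<dots> = y' \<ominus>\<^bsub>M\<^esub> y \<oplus>\<^bsub>M\<^esub> x'" using c by (simp add: a_minus_def M.a_ac)
      also have "\<dots> \<ominus>\<^bsub>M\<^esub> x' = y' \<ominus>\<^bsub>M\<^esub> y" using c by simp
      finally show ?thesis .
    qed
    then have "x \<ominus>\<^bsub>M\<^esub> x' \<in> A \<inter> B" using a(6)[OF that(1,2)] b(6)[OF that(4,3)] by simp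
    then show "x = x'" using AB(2) c by simp
  qed
  have "\<exists>x. x \<in> A \<and> (\<exists>y \<in> B. m = x \<oplus>\<^bsub>M\<^esub> y)" if "m \<in> carrier M" for m
    using that AB(1)[symmetric] by (auto simp: set_add_iff)
  then obtain r where r: "\<And>m. m \<in> carrier M \<Longrightarrow> r m \<in> A"
    "\<And>m. m \<in> carrier M \<Longrightarrow> \<exists>y \<in> B. m = r m \<oplus>\<^bsub>M\<^esub> y" by metis
  have r_eq: "r (x \<oplus>\<^bsub>M\<^esub> y) = x" if "x \<in> A" "y \<in> B" for x y
    using r[of "x \<oplus>\<^bsub>M\<^esub> y"] uniq that a(7) b(7) by (metis M.a_closed)
  show thesis
  proof (rule that)
    show "r \<in> lmod_hom R M M"
    proof (rule lmod_homI)
      fix m assume m: "m \<in> carrier M"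
      then show "r m \<in> carrier M" using r a(7) by auto
      obtain y where y: "y \<in> B" "m = r m \<oplus>\<^bsub>M\<^esub> y" using r(2)[OF m] by auto
      fix c assume c: "c \<in> carrier R"
      have "c \<odot>\<^bsub>M\<^esub> m = c \<odot>\<^bsub>M\<^esub> r m \<oplus>\<^bsub>M\<^esub> c \<odot>\<^bsub>M\<^esub> y"
        using y c a(7) b(7) r(1)[OF m] by (metis smult_r_distr)
      then show "r (c \<odot>\<^bsub>M\<^esub> m) = c \<odot>\<^bsub>M\<^esub> r m" using r_eq a(4) b(4) c y(1) r(1)[OF m] by simp
    next
      fix m l assume m: "m \<in> carrier M" "l \<in> carrier M"
      obtain y z where y: "y \<in> B" "m = r m \<oplus>\<^bsub>M\<^esub> y" "z \<in> B" "l = r l \<oplus>\<^bsub>M\<^esub> z" using r(2) m by metis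
      have c: "r m \<in> carrier M" "r l \<in> carrier M" "y \<in> carrier M" "z \<in> carrier M"
        using y m r(1) a(7) b(7) by auto
      have "m \<oplus>\<^bsub>M\<^esub> l = (r m \<oplus>\<^bsub>M\<^esub> y) \<oplus>\<^bsub>M\<^esub> (r l \<oplus>\<^bsub>M\<^esub> z)" using y by simp
      also have "\<dots> = (r m \<oplus>\<^bsub>M\<^esub> r l) \<oplus>\<^bsub>M\<^esub> (y \<oplus>\<^bsub>M\<^esub> z)" using c by (simp add: M.a_ac)
      finally show "r (m \<oplus>\<^bsub>M\<^esub> l) = r m \<oplus>\<^bsub>M\<^esub> r l"
        using r_eq[of "r m \<oplus>\<^bsub>M\<^esub> r l" "y \<oplus>\<^bsub>M\<^esub> z"] a(3) b(3) y r(1) m by simp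
    qed
    fix m assume m: "m \<in> carrier M"
    show "r m \<in> A" using r m by simp
    obtain y where y: "y \<in> B" "m = r m \<oplus>\<^bsub>M\<^esub> y" using r(2)[OF m] by auto
    have c: "r m \<in> carrier M" "y \<in> carrier M" using y m r(1) a(7) b(7) by auto
    have "m \<ominus>\<^bsub>M\<^esub> r m = (r m \<oplus>\<^bsub>M\<^esub> y) \<ominus>\<^bsub>M\<^esub> r m" using y(2) by simp
    also have "\<dots> = y" using c by simp
    finally show "m \<ominus>\<^bsub>M\<^esub> r m \<in> B" using y(1) by simp
  next
    show "r x = x" if "x \<in> A" for x using r_eq[OF that b(2)] a(7)[OF that] by simp
    show "r x = \<zero>\<^bsub>M\<^esub>" if "x \<in> B" for x using r_eq[OF a(2) that] b(7)[OF that] by simp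
  qed
qed

lemma direct_sum_projection':
  assumes r: "r \<in> lmod_hom R M M" "\<And>m. m \<in> carrier M \<Longrightarrow> r (r m) = r m"
  defines "A \<equiv> r ` carrier M" and "B \<equiv> {m \<in> carrier M. r m = \<zero>\<^bsub>M\<^esub>}"
  shows "submodule A R M" "submodule B R M" "A <+>\<^bsub>M\<^esub> B = carrier M" "A \<inter> B = {\<zero>\<^bsub>M\<^esub>}"
proof -
  interpret r: lmod_homomorphism R M M r by unfold_locales fact
  show A: "submodule A R M" unfolding A_def by (rule r.image_submodule[OF carrier_submodule])
  show B: "submodule B R M" unfolding B_def by (rule r.kernel_submodule)
  have "m \<in> A <+>\<^bsub>M\<^esub> B" if m: "m \<in> carrier M" for m
    unfolding set_add_iff
  proof (intro bexI)
    show "m = r m \<oplus>\<^bsub>M\<^esub> (m \<ominus>\<^bsub>M\<^esub> r m)" using m by (simp add: a_minus_def M.a_lcomm M.r_neg)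
    show "m \<ominus>\<^bsub>M\<^esub> r m \<in> B" using m r(2) by (simp add: B_def r.f_minus)
    show "r m \<in> A" using m by (simp add: A_def)
  qed
  then show "A <+>\<^bsub>M\<^esub> B = carrier M"
    using submoduleD(1)[OF submodule_set_add(1)[OF A B]] by auto
  show "A \<inter> B = {\<zero>\<^bsub>M\<^esub>}"
    using r(2) submoduleD(2)[OF A] submoduleD(2)[OF B] by (auto simp: A_def B_def)
qed

text \<open>Indecomposability in the form in which it is used later: whenever a summand has to be
  excluded, an idempotent endomorphism is constructed and compared with zero and with the
  identity.\<close>

lemma indecomposable_idempotent:
  assumes "indecomposable R M" "r \<in> lmod_hom R M M" "\<And>m. m \<in> carrier M \<Longrightarrow> r (r m) = r m"
  shows "(\<forall>m \<in> carrier M. r m = \<zero>\<^bsub>M\<^esub>) \<or> (\<forall>m \<in> carrier M. r m = m)"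
proof -
  interpret r: lmod_homomorphism R M M r by unfold_locales fact
  let ?B = "{m \<in> carrier M. r m = \<zero>\<^bsub>M\<^esub>}"
  have "r ` carrier M = {\<zero>\<^bsub>M\<^esub>} \<or> ?B = {\<zero>\<^bsub>M\<^esub>}"
    using assms(1) direct_sum_projection'[OF assms(2,3)] by (simp add: indecomposable_def)
  moreover have "m \<ominus>\<^bsub>M\<^esub> r m \<in> ?B" if "m \<in> carrier M" for m
    using that assms(3) by (simp add: r.f_minus)
  ultimately show ?thesis by (metis (no_types, lifting) image_eqI minus_eq_zero_iff r.f_closed singletonD)
qed

end

section \<open>Vector spaces\<close>

locale vector_space_mod = left_module K V for K :: "('k, 'x) ring_scheme" and V :: "('k, 'v) module" +
  assumes field: "field K"
begin

text \<open>A maximal \<open>W\<close> with \<open>U \<inter> W = 0\<close> is a complement: if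
  \<open>v\<close> were outside \<open>U + W\<close>, adding the line \<open>K v\<close> to
  \<open>W\<close> would keep the intersection trivial, because a nonzero coefficient of
  \<open>v\<close> can be inverted, and this would contradict maximality.\<close>

lemma retract:
  assumes U: "submodule U K V"
  obtains r where "r \<in> lmod_hom K V V" "\<And>v. v \<in> carrier V \<Longrightarrow> r v \<in> U" "\<And>u. u \<in> U \<Longrightarrow> r u = u"
proof -
  interpret field K by (rule field)
  note u = submoduleD[OF U]
  obtain W where W: "submodule W K V" "U \<inter> W = {\<zero>\<^bsub>V\<^esub>}"
    "\<And>W'. submodule W' K V \<Longrightarrow> W \<subseteq> W' \<Longrightarrow> U \<inter> W' = {\<zero>\<^bsub>V\<^esub>} \<Longrightarrow> W' = W"
    using maximal_relative_complement[OF zero_submodule, of U] u(2) by auto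
  note w = submoduleD[OF W(1)]
  have "U <+>\<^bsub>V\<^esub> W = carrier V"
  proof (rule ccontr)
    assume "U <+>\<^bsub>V\<^esub> W \<noteq> carrier V"
    note UW = submodule_set_add[OF U W(1)]
    then obtain v where v: "v \<in> carrier V" "v \<notin> U <+>\<^bsub>V\<^esub> W"
      using submoduleD(1)[OF UW(1)] \<open>U <+>\<^bsub>V\<^esub> W \<noteq> carrier V\<close> by auto
    define L where "L = {c \<odot>\<^bsub>V\<^esub> v | c. c \<in> carrier K}"
    have L: "submodule L K V"
      unfolding L_def
    proof (rule submoduleI)
      show "\<zero>\<^bsub>V\<^esub> \<in> {c \<odot>\<^bsub>V\<^esub> v |c. c \<in> carrier K}" using v(1) by (auto intro!: exI[of _ "\<zero>\<^bsub>K\<^esub>"])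
    qed (use v(1) in \<open>auto simp: smult_l_distr[symmetric] smult_assoc1[symmetric]\<close>)
    note WL = submodule_set_add[OF W(1) L]
    have "U \<inter> (W <+>\<^bsub>V\<^esub> L) \<subseteq> {\<zero>\<^bsub>V\<^esub>}"
    proof
      fix x assume x: "x \<in> U \<inter> (W <+>\<^bsub>V\<^esub> L)"
      then obtain y c where y: "y \<in> W" "c \<in> carrier K" "x = y \<oplus>\<^bsub>V\<^esub> c \<odot>\<^bsub>V\<^esub> v"
        by (auto simp: set_add_iff L_def)
      have yv: "y \<in> carrier V" "x \<in> carrier V" using y(1) w(7) x u(7) by auto
      show "x \<in> {\<zero>\<^bsub>V\<^esub>}"
      proof (cases "c = \<zero>\<^bsub>K\<^esub>")
        case True
        then have "x = y" using y v(1) yv by simp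
        then show ?thesis using x y W(2) by auto
      next
        case False
        then have c: "inv\<^bsub>K\<^esub> c \<in> carrier K" "inv\<^bsub>K\<^esub> c \<otimes>\<^bsub>K\<^esub> c = \<one>\<^bsub>K\<^esub>"
          using y(2) field_Units by auto
        have "c \<odot>\<^bsub>V\<^esub> v = x \<ominus>\<^bsub>V\<^esub> y"
          using y v(1) yv by simp
        also have "\<dots> \<in> U <+>\<^bsub>V\<^esub> W"
          using x y(1) UW submoduleD(6)[OF UW(1)] by auto
        finally have "inv\<^bsub>K\<^esub> c \<odot>\<^bsub>V\<^esub> (c \<odot>\<^bsub>V\<^esub> v) \<in> U <+>\<^bsub>V\<^esub> W"
          using submoduleD(4)[OF UW(1)] c(1) by blast
        then show ?thesis using v c y(2) by (simp add: smult_assoc1[symmetric])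
      qed
    qed
    then have "U \<inter> (W <+>\<^bsub>V\<^esub> L) = {\<zero>\<^bsub>V\<^esub>}"
      using u(2) submoduleD(2)[OF WL(1)] by auto
    then have "W <+>\<^bsub>V\<^esub> L = W" using W(3) WL by blast
    moreover have "v \<in> L" unfolding L_def using v(1) by (auto intro!: exI[of _ "\<one>\<^bsub>K\<^esub>"])
    ultimately have "v \<in> W" using WL by auto
    then show False using UW v(2) by auto
  qed
  then show thesis using direct_sum_projection[OF U W(1) _ W(2)] that by metis
qed

lemma extend_hom:
  assumes U: "submodule U K V" and f: "f \<in> lmod_hom K (V\<lparr>carrier := U\<rparr>) L"
  obtains g where "g \<in> lmod_hom K V L" "\<And>u. u \<in> U \<Longrightarrow> g u = f u"
proof -
  obtain r where r: "r \<in> lmod_hom K V V" "\<And>v. v \<in> carrier V \<Longrightarrow> r v \<in> U" "\<And>u. u \<in> U \<Longrightarrow> r u = u"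
    by (rule retract[OF U]) (rule that)
  show thesis
    by (rule that[OF lmod_hom_comp[OF lmod_hom_codomain[OF r(1,2)] f]]) (simp_all add: r(3))
qed

text \<open>A retraction \<open>r\<close> onto \<open>N\<close> leaves the nonzero remainder
  \<open>w = v - r v\<close>; a functional with value \<open>1\<close> at \<open>w\<close> is
  composed with \<open>x \<mapsto> x - r x\<close>, which kills \<open>N\<close>.\<close>

lemma separating_functional:
  assumes N: "submodule N K V" and v: "v \<in> carrier V" "v \<notin> N"
  obtains g where "g \<in> lmod_hom K V (regular_module K)" "\<And>n. n \<in> N \<Longrightarrow> g n = \<zero>\<^bsub>K\<^esub>" "g v \<noteq> \<zero>\<^bsub>K\<^esub>"
proof -
  interpret field K by (rule field)
  obtain r where r: "r \<in> lmod_hom K V V" "\<And>v. v \<in> carrier V \<Longrightarrow> r v \<in> N" "\<And>u. u \<in> N \<Longrightarrow> r u = u"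
    by (rule retract[OF N]) (rule that)
  interpret r: lmod_homomorphism K V V r by unfold_locales fact
  define w where "w = v \<ominus>\<^bsub>V\<^esub> r v"
  have w: "w \<in> carrier V" "w \<noteq> \<zero>\<^bsub>V\<^esub>" using v r(2)[OF v(1)] by (auto simp: w_def)
  have KL: "left_module K (regular_module K)" by (rule regular_left_module)
  have "(\<lambda>c. c \<odot>\<^bsub>V\<^esub> w) \<in> lmod_hom K (regular_module K) V"
    by (rule lmod_hom_smult_fixed) (use w lmod_hom_id in auto)
  then interpret m: lmod_homomorphism K "regular_module K" V "\<lambda>c. c \<odot>\<^bsub>V\<^esub> w"
    by (intro lmod_homomorphismI KL left_module_axioms)
  define U where "U = (\<lambda>c. c \<odot>\<^bsub>V\<^esub> w) ` carrier K"
  have U: "submodule U K V" unfolding U_def using m.image_submodule[OF m.M.carrier_submodule] by simp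
  note UL = submodule_left_module[OF U]
  interpret mU: lmod_homomorphism K "regular_module K" "V\<lparr>carrier := U\<rparr>" "\<lambda>c. c \<odot>\<^bsub>V\<^esub> w"
    by (intro lmod_homomorphismI KL UL lmod_hom_codomain[OF m.hom]) (auto simp: U_def)
  have inj: "c = \<zero>\<^bsub>K\<^esub>" if "c \<in> carrier K" "c \<odot>\<^bsub>V\<^esub> w = \<zero>\<^bsub>V\<^esub>" for c
  proof (rule ccontr)
    assume "c \<noteq> \<zero>\<^bsub>K\<^esub>"
    then have c: "inv\<^bsub>K\<^esub> c \<in> carrier K" "inv\<^bsub>K\<^esub> c \<otimes>\<^bsub>K\<^esub> c = \<one>\<^bsub>K\<^esub>"
      using that(1) field_Units by auto
    have "w = inv\<^bsub>K\<^esub> c \<odot>\<^bsub>V\<^esub> (c \<odot>\<^bsub>V\<^esub> w)" using c that(1) w by (simp add: smult_assoc1[symmetric])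
    then show False using that(2) w c by simp
  qed
  \<comment> \<open>The coordinate on the line \<open>K w\<close>, obtained by inverting
    \<open>c \<mapsto> c w\<close>.\<close>
  have "\<exists>h\<in>lmod_hom K (V\<lparr>carrier := U\<rparr>) (regular_module K). \<forall>c \<in> carrier (regular_module K). h (c \<odot>\<^bsub>V\<^esub> w) = c"
    by (rule mU.factor[OF KL lmod_hom_id]) (auto simp: U_def inj)
  then obtain h where h: "h \<in> lmod_hom K (V\<lparr>carrier := U\<rparr>) (regular_module K)"
    "\<And>c. c \<in> carrier K \<Longrightarrow> h (c \<odot>\<^bsub>V\<^esub> w) = c" by auto
  obtain g where g: "g \<in> lmod_hom K V (regular_module K)" "\<And>u. u \<in> U \<Longrightarrow> g u = h u"
    by (rule extend_hom[OF U h(1)]) (rule that)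
  interpret g: lmod_homomorphism K V "regular_module K" g
    by (intro lmod_homomorphismI KL left_module_axioms g)
  have "\<one>\<^bsub>K\<^esub> \<odot>\<^bsub>V\<^esub> w \<in> U" unfolding U_def by (rule imageI) simp
  then have gw: "g w = \<one>\<^bsub>K\<^esub>" using g(2) h(2)[of "\<one>\<^bsub>K\<^esub>"] w by simp
  show thesis
  proof (rule that)
    show "(\<lambda>x. g (x \<ominus>\<^bsub>V\<^esub> r x)) \<in> lmod_hom K V (regular_module K)"
      by (rule lmod_hom_comp[OF lmod_hom_minus[OF lmod_hom_id r(1)] g(1)])
    show "g (n \<ominus>\<^bsub>V\<^esub> r n) = \<zero>\<^bsub>K\<^esub>" if "n \<in> N" for n
      using r(3)[OF that] submoduleD(7)[OF N that] g.f_zero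
      by (simp add: a_minus_def M.r_neg)
    show "g (v \<ominus>\<^bsub>V\<^esub> r v) \<noteq> \<zero>\<^bsub>K\<^esub>" using gw by (simp add: w_def)
  qed
qed

text \<open>A cover by \<open>K^n\<close> splits because its kernel has a retraction
  \<open>r\<close>: the section sends the image of \<open>f\<close> to
  \<open>f - r f\<close>.\<close>

lemma finitely_generated_proj:
  assumes "finitely_generated K V"
  shows "proj K V"
proof -
  obtain n x where x: "\<And>i. i < n \<Longrightarrow> x i \<in> carrier V"
    and s: "comb V n x ` carrier (free_mod K \<one>\<^bsub>K\<^esub> n) = carrier V"
    using assms unfolding finitely_generated_iff by auto
  define F where "F = free_mod K \<one>\<^bsub>K\<^esub> n"
  have F: "left_module K F" "proj K F"
    unfolding F_def by (simp_all add: R.free_mod_left_module R.free_mod_dual_basis)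
  have c: "comb V n x \<in> lmod_hom K F V" unfolding F_def by (rule comb_hom[OF x])
  interpret F: vector_space_mod K F by (simp add: vector_space_mod_def vector_space_mod_axioms_def F field)
  interpret c: lmod_homomorphism K F V "comb V n x" by (intro lmod_homomorphismI F left_module_axioms c)
  define U where "U = {f \<in> carrier F. comb V n x f = \<zero>\<^bsub>V\<^esub>}"
  have U: "submodule U K F" unfolding U_def by (rule c.kernel_submodule)
  obtain r where r: "r \<in> lmod_hom K F F" "\<And>v. v \<in> carrier F \<Longrightarrow> r v \<in> U" "\<And>u. u \<in> U \<Longrightarrow> r u = u"
    by (rule F.retract[OF U]) (rule that)
  note rc = lmod_homD(1)[OF r(1)]
  have "\<exists>h\<in>lmod_hom K V F. \<forall>f\<in>carrier F. h (comb V n x f) = f \<ominus>\<^bsub>F\<^esub> r f"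
  proof (rule c.factor[OF F(1) F.lmod_hom_minus[OF lmod_hom_id r(1)]])
    show "comb V n x ` carrier F = carrier V" using s by (simp add: F_def)
    show "f \<ominus>\<^bsub>F\<^esub> r f = \<zero>\<^bsub>F\<^esub>" if "f \<in> carrier F" "comb V n x f = \<zero>\<^bsub>V\<^esub>" for f
      using that r(3) rc by (simp add: U_def)
  qed
  then obtain h where h: "h \<in> lmod_hom K V F" "\<And>f. f \<in> carrier F \<Longrightarrow> h (comb V n x f) = f \<ominus>\<^bsub>F\<^esub> r f"
    by auto
  have "comb V n x (h v) = v" if "v \<in> carrier V" for v
  proof -
    obtain f where f: "f \<in> carrier F" "v = comb V n x f" using s \<open>v \<in> carrier V\<close> by (auto simp: F_def)
    then have "comb V n x (r f) = \<zero>\<^bsub>V\<^esub>" using r(2) by (auto simp: U_def)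
    then show ?thesis using f h(2) rc by (simp add: c.f_minus) (simp add: a_minus_def)
  qed
  then show ?thesis
    by (rule proj_retract[OF F left_module_axioms R.one_closed h(1) c])
qed

end

section \<open>Rings of the shape of the duplicated algebra\<close>

definition restrict_scalars :: "('k \<Rightarrow> 'r) \<Rightarrow> ('r, 'm) module \<Rightarrow> ('k, 'm) module"
  where "restrict_scalars \<iota> M = \<lparr>carrier = carrier M, monoid.mult = monoid.mult M, one = one M,
    zero = zero M, add = add M, smult = (\<lambda>c. smult M (\<iota> c))\<rparr>"

lemma restrict_scalars_simps [simp]:
  "carrier (restrict_scalars \<iota> M) = carrier M" "zero (restrict_scalars \<iota> M) = zero M"
  "add (restrict_scalars \<iota> M) = add M" "smult (restrict_scalars \<iota> M) = (\<lambda>c. smult M (\<iota> c))"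
  by (simp_all add: restrict_scalars_def)

text \<open>The properties of the duplicated algebra on which the argument rests, free of triples.
  \<open>\<iota>\<close> embeds \<open>K\<close> in the centre, \<open>e1\<close> and
  \<open>e2\<close> are the diagonal idempotents, and \<open>lam\<close> is the evaluation of the
  lower left entry at \<open>1\<close>. By \<open>pairing_surj\<close> and
  \<open>pairing_inj\<close>, pairing through \<open>lam\<close> identifies \<open>R e1\<close> with
  the dual of \<open>e2 R\<close>; by \<open>dual_surj\<close> and \<open>dual_inj\<close> it
  identifies \<open>e2 R e1\<close> with the dual of \<open>e1 R e1\<close>. The maps
  \<open>\<tau>\<close> and \<open>\<tau>'\<close> translate between the two copies
  \<open>e1 R e1\<close> and \<open>e2 R e2\<close> of \<open>H\<close>, and
  \<open>lam_\<tau>\<close> says that multiplying a functional by \<open>h\<close> from either side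
  and evaluating at \<open>1\<close> gives the same value. Heredity is required for left ideals
  inside \<open>R e2\<close>, the lower copy of \<open>H\<close>. Triangularity allows the corners
  to be described by one-sided conditions such as \<open>e1 \<otimes> h = h\<close>.\<close>

locale duplicated_ring = ring R for R :: "('r, 'x) ring_scheme" (structure) +
  fixes K :: "('k, 'y) ring_scheme" and \<iota> :: "'k \<Rightarrow> 'r" and e1 e2 :: 'r
    and lam :: "'r \<Rightarrow> 'k" and \<tau> \<tau>' :: "'r \<Rightarrow> 'r"
  assumes K: "field K"
    and \<iota>_closed [simp]: "c \<in> carrier K \<Longrightarrow> \<iota> c \<in> carrier R"
    and \<iota>_add: "c \<in> carrier K \<Longrightarrow> d \<in> carrier K \<Longrightarrow> \<iota> (c \<oplus>\<^bsub>K\<^esub> d) = \<iota> c \<oplus> \<iota> d"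
    and \<iota>_mult: "c \<in> carrier K \<Longrightarrow> d \<in> carrier K \<Longrightarrow> \<iota> (c \<otimes>\<^bsub>K\<^esub> d) = \<iota> c \<otimes> \<iota> d"
    and \<iota>_one: "\<iota> \<one>\<^bsub>K\<^esub> = \<one>"
    and \<iota>_central: "c \<in> carrier K \<Longrightarrow> r \<in> carrier R \<Longrightarrow> \<iota> c \<otimes> r = r \<otimes> \<iota> c"
    and e_closed [simp]: "e1 \<in> carrier R" "e2 \<in> carrier R"
    and e_sum: "e1 \<oplus> e2 = \<one>"
    and triangular: "r \<in> carrier R \<Longrightarrow> e1 \<otimes> r \<otimes> e2 = \<zero>"
    and lam: "lam \<in> lmod_hom K (restrict_scalars \<iota> (regular_module R)) (regular_module K)"
    and pairing_surj: "\<xi> \<in> lmod_hom K (restrict_scalars \<iota> (regular_module R)) (regular_module K) \<Longrightarrow>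
      \<exists>s \<in> carrier R. s \<otimes> e1 = s \<and> (\<forall>r \<in> carrier R. lam (e2 \<otimes> r \<otimes> s) = \<xi> (e2 \<otimes> r))"
    and pairing_inj: "s \<in> carrier R \<Longrightarrow> s \<otimes> e1 = s \<Longrightarrow>
      (\<And>r. r \<in> carrier R \<Longrightarrow> lam (e2 \<otimes> r \<otimes> s) = \<zero>\<^bsub>K\<^esub>) \<Longrightarrow> s = \<zero>"
    and hereditary_e2: "submodule J R (regular_module R) \<Longrightarrow> (\<And>x. x \<in> J \<Longrightarrow> x \<otimes> e2 = x) \<Longrightarrow>
      proj R ((regular_module R)\<lparr>carrier := J\<rparr>)"
    and \<tau>_closed: "h \<in> carrier R \<Longrightarrow> e1 \<otimes> h = h \<Longrightarrow> \<tau> h \<in> carrier R \<and> \<tau> h \<otimes> e2 = \<tau> h"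
    and \<tau>'_closed: "h \<in> carrier R \<Longrightarrow> h \<otimes> e2 = h \<Longrightarrow> \<tau>' h \<in> carrier R \<and> e1 \<otimes> \<tau>' h = \<tau>' h"
    and \<tau>_\<tau>': "h \<in> carrier R \<Longrightarrow> h \<otimes> e2 = h \<Longrightarrow> \<tau> (\<tau>' h) = h"
    and \<tau>'_add: "g \<in> carrier R \<Longrightarrow> g \<otimes> e2 = g \<Longrightarrow> h \<in> carrier R \<Longrightarrow> h \<otimes> e2 = h \<Longrightarrow>
      \<tau>' (g \<oplus> h) = \<tau>' g \<oplus> \<tau>' h"
    and \<tau>'_mult: "g \<in> carrier R \<Longrightarrow> e1 \<otimes> g = g \<Longrightarrow> h \<in> carrier R \<Longrightarrow> h \<otimes> e2 = h \<Longrightarrow>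
      \<tau>' (\<tau> g \<otimes> h) = g \<otimes> \<tau>' h"
    and dual_surj: "\<xi> \<in> lmod_hom K (restrict_scalars \<iota> (regular_module R)) (regular_module K) \<Longrightarrow>
      \<exists>p \<in> carrier R. e2 \<otimes> p = p \<and> p \<otimes> e1 = p \<and>
        (\<forall>h \<in> carrier R. e1 \<otimes> h = h \<longrightarrow> lam (p \<otimes> h) = \<xi> h)"
    and dual_inj: "p \<in> carrier R \<Longrightarrow> e2 \<otimes> p = p \<Longrightarrow> p \<otimes> e1 = p \<Longrightarrow>
      (\<And>h. h \<in> carrier R \<Longrightarrow> e1 \<otimes> h = h \<Longrightarrow> lam (p \<otimes> h) = \<zero>\<^bsub>K\<^esub>) \<Longrightarrow> p = \<zero>"
    and lam_\<tau>: "h \<in> carrier R \<Longrightarrow> e1 \<otimes> h = h \<Longrightarrow> p \<in> carrier R \<Longrightarrow> e2 \<otimes> p = p \<Longrightarrow> p \<otimes> e1 = p \<Longrightarrow>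
      lam (\<tau> h \<otimes> p) = lam (p \<otimes> h)"
begin

section \<open>Corners of the triangular ring\<close>

lemma e_idem [simp]: "e1 \<otimes> e1 = e1" "e2 \<otimes> e2 = e2" "e1 \<otimes> e2 = \<zero>" "e2 \<otimes> e1 = \<zero>"
proof -
  show e12: "e1 \<otimes> e2 = \<zero>" using triangular[of \<one>] by simp
  have "e1 \<otimes> (e1 \<oplus> e2) = e1" using e_sum by simp
  then show e11: "e1 \<otimes> e1 = e1" using e12 by (simp add: r_distr)
  have "(e1 \<oplus> e2) \<otimes> e2 = e2" using e_sum by simp
  then show "e2 \<otimes> e2 = e2" using e12 by (simp add: l_distr)
  have "(e1 \<oplus> e2) \<otimes> e1 = e1" using e_sum by simp
  then have "e1 \<oplus> e2 \<otimes> e1 = e1" using e11 by (simp add: l_distr)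
  then show "e2 \<otimes> e1 = \<zero>" by (simp add: add.l_cancel_one')
qed

lemma e_idem_l [simp]:
  "r \<in> carrier R \<Longrightarrow> e1 \<otimes> (e1 \<otimes> r) = e1 \<otimes> r" "r \<in> carrier R \<Longrightarrow> e2 \<otimes> (e2 \<otimes> r) = e2 \<otimes> r"
  "r \<in> carrier R \<Longrightarrow> e1 \<otimes> (e2 \<otimes> r) = \<zero>" "r \<in> carrier R \<Longrightarrow> e2 \<otimes> (e1 \<otimes> r) = \<zero>"
  by (simp_all add: m_assoc[symmetric])

lemma decomp_left: "r \<in> carrier R \<Longrightarrow> e1 \<otimes> r \<oplus> e2 \<otimes> r = r"
  by (simp add: l_distr[symmetric] e_sum)

lemma decomp_right: "r \<in> carrier R \<Longrightarrow> r \<otimes> e1 \<oplus> r \<otimes> e2 = r"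
  by (simp add: r_distr[symmetric] e_sum)

text \<open>Since \<open>e1 R e2 = 0\<close>, the row \<open>e1 R\<close> is already the corner
  \<open>e1 R e1\<close>; dually for the column \<open>R e2\<close> in the next lemma.\<close>

lemma e1_right:
  assumes "r \<in> carrier R"
  shows "e1 \<otimes> r \<otimes> e1 = e1 \<otimes> r"
  using decomp_right[of "e1 \<otimes> r"] triangular[OF assms] assms by simp

lemma e2_left:
  assumes "r \<in> carrier R"
  shows "e2 \<otimes> (r \<otimes> e2) = r \<otimes> e2"
  using decomp_left[of "r \<otimes> e2"] triangular[OF assms] assms by (simp add: m_assoc)

lemma mod_decomp:
  assumes "left_module R M" "m \<in> carrier M"
  shows "e1 \<odot>\<^bsub>M\<^esub> m \<oplus>\<^bsub>M\<^esub> e2 \<odot>\<^bsub>M\<^esub> m = m"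
proof -
  interpret M: left_module R M by fact
  show ?thesis using assms by (simp add: M.smult_l_distr[symmetric] e_sum)
qed

section \<open>Underlying vector spaces and injectivity of \<open>R e1\<close>\<close>

lemma restrict_vector_space:
  assumes "left_module R M"
  shows "vector_space_mod K (restrict_scalars \<iota> M)"
proof -
  interpret M: left_module R M by fact
  interpret K: field K by (rule K)
  have "abelian_group (restrict_scalars \<iota> M)"
    by (rule abelian_groupI) (auto simp: M.M.a_ac intro: M.M.l_neg bexI[of _ "\<ominus>\<^bsub>M\<^esub> x" for x])
  then show ?thesis
    by (simp add: vector_space_mod_def vector_space_mod_axioms_def K left_module_def
        left_module_axioms_def K.ring_axioms M.smult_r_distr \<iota>_add M.smult_l_distr \<iota>_mult
        M.smult_assoc1 \<iota>_one)
qed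

lemma restrict_submodule:
  assumes "left_module R M" "submodule N R M"
  shows "submodule N K (restrict_scalars \<iota> M)"
proof -
  interpret M: left_module R M by fact
  interpret V: vector_space_mod K "restrict_scalars \<iota> M" by (rule restrict_vector_space) fact
  show ?thesis using M.submoduleD[OF assms(2)] by (intro V.submoduleI) auto
qed

lemma lam_hom: "lmod_homomorphism K (restrict_scalars \<iota> (regular_module R)) (regular_module K) lam"
proof -
  interpret V: vector_space_mod K "restrict_scalars \<iota> (regular_module R)"
    by (rule restrict_vector_space[OF regular_left_module])
  show ?thesis by (rule lmod_homomorphismI[OF V.left_module_axioms V.R.regular_left_module lam])
qed

text \<open>A functional on \<open>M\<close> is pulled back to the ring along
  \<open>r \<mapsto> r m\<close>; this is the form in which the duality assumptions accept
  it.\<close>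

lemma orbit_functional:
  assumes "left_module R M" "m \<in> carrier M" "\<Theta> \<in> lmod_hom K (restrict_scalars \<iota> M) (regular_module K)"
  shows "(\<lambda>r. \<Theta> (r \<odot>\<^bsub>M\<^esub> m)) \<in> lmod_hom K (restrict_scalars \<iota> (regular_module R)) (regular_module K)"
proof -
  interpret M: left_module R M by fact
  show ?thesis
    using assms(2) lmod_homD[OF assms(3)]
    by (intro lmod_homI) (simp_all add: M.smult_l_distr M.smult_assoc1)
qed

text \<open>\<open>R e1\<close> is an injective module, being \<open>D(e2 R)\<close>.\<close>

lemma extend_hom_Re1:
  assumes M: "left_module R M" and U: "submodule U R M"
    and f: "f \<in> lmod_hom R (M\<lparr>carrier := U\<rparr>) (regular_module R)"
    and fe: "\<And>u. u \<in> U \<Longrightarrow> f u \<otimes> e1 = f u"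
  shows "\<exists>F \<in> lmod_hom R M (regular_module R). (\<forall>m \<in> carrier M. F m \<otimes> e1 = F m) \<and> (\<forall>u \<in> U. F u = f u)"
proof -
  interpret M: left_module R M by fact
  interpret V: vector_space_mod K "restrict_scalars \<iota> M" by (rule restrict_vector_space[OF M])
  interpret l: lmod_homomorphism K "restrict_scalars \<iota> (regular_module R)" "regular_module K" lam
    by (rule lam_hom)
  note ud = M.submoduleD[OF U]
  note fD = lmod_homD[OF f, simplified]
  \<comment> \<open>By duality with \<open>e2 R\<close>, maps into \<open>R e1\<close> correspond to
    functionals on the \<open>e2\<close>-part. So \<open>f\<close> is replaced by the functional
    \<open>u \<mapsto> lam (e2 \<otimes> f u)\<close>, which extends to \<open>M\<close> because
    \<open>K\<close> is a field.\<close>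
  have "(\<lambda>u. lam (e2 \<otimes> f u)) \<in> lmod_hom K ((restrict_scalars \<iota> M)\<lparr>carrier := U\<rparr>) (regular_module K)"
  proof (rule lmod_homI)
    fix u assume u: "u \<in> carrier ((restrict_scalars \<iota> M)\<lparr>carrier := U\<rparr>)"
    then show "lam (e2 \<otimes> f u) \<in> carrier (regular_module K)"
      using l.f_closed[of "e2 \<otimes> f u"] fD by simp
    fix c assume c: "c \<in> carrier K"
    have "e2 \<otimes> (\<iota> c \<otimes> f u) = \<iota> c \<otimes> (e2 \<otimes> f u)"
      using \<iota>_central[OF c e_closed(2)] c u fD(1) by (simp add: m_assoc[symmetric])
    then show "lam (e2 \<otimes> f (c \<odot>\<^bsub>(restrict_scalars \<iota> M)\<lparr>carrier := U\<rparr>\<^esub> u))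
        = c \<odot>\<^bsub>regular_module K\<^esub> lam (e2 \<otimes> f u)"
      using l.f_smult[of c "e2 \<otimes> f u"] c u fD by simp
  next
    fix u v assume "u \<in> carrier ((restrict_scalars \<iota> M)\<lparr>carrier := U\<rparr>)"
      "v \<in> carrier ((restrict_scalars \<iota> M)\<lparr>carrier := U\<rparr>)"
    then show "lam (e2 \<otimes> f (u \<oplus>\<^bsub>(restrict_scalars \<iota> M)\<lparr>carrier := U\<rparr>\<^esub> v))
        = lam (e2 \<otimes> f u) \<oplus>\<^bsub>regular_module K\<^esub> lam (e2 \<otimes> f v)"
      using l.f_add[of "e2 \<otimes> f u" "e2 \<otimes> f v"] fD by (simp add: r_distr)
  qed
  then obtain \<Theta> where \<Theta>: "\<Theta> \<in> lmod_hom K (restrict_scalars \<iota> M) (regular_module K)"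
    "\<And>u. u \<in> U \<Longrightarrow> \<Theta> u = lam (e2 \<otimes> f u)"
    using V.extend_hom[OF restrict_submodule[OF M U]] by metis
  note \<Theta>D = lmod_homD[OF \<Theta>(1), simplified]
  \<comment> \<open>\<open>s\<close> represents \<open>m\<close> if its pairing with
    \<open>e2 R\<close> is the extended functional on the orbit of \<open>m\<close>. Uniqueness of
    representatives yields both the linearity of \<open>F\<close> and its agreement with
    \<open>f\<close> on \<open>U\<close>.\<close>
  define rep where "rep m s \<longleftrightarrow> s \<in> carrier R \<and> s \<otimes> e1 = s \<and>
    (\<forall>r \<in> carrier R. lam (e2 \<otimes> r \<otimes> s) = \<Theta> ((e2 \<otimes> r) \<odot>\<^bsub>M\<^esub> m))" for m s
  have ex: "\<exists>s. rep m s" if "m \<in> carrier M" for m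
    using pairing_surj[OF orbit_functional[OF M that \<Theta>(1)]] unfolding rep_def by blast
  have uniq: "s = t" if "rep m s" "rep m t" for m s t
  proof -
    have st: "s \<in> carrier R" "t \<in> carrier R" "s \<otimes> e1 = s" "t \<otimes> e1 = t" using that by (auto simp: rep_def)
    have "s \<ominus> t = \<zero>"
    proof (rule pairing_inj)
      show "s \<ominus> t \<in> carrier R" using st by simp
      show "(s \<ominus> t) \<otimes> e1 = s \<ominus> t" using st by (simp add: a_minus_def l_distr l_minus)
      fix r assume r: "r \<in> carrier R"
      have "e2 \<otimes> r \<otimes> (s \<ominus> t) = e2 \<otimes> r \<otimes> s \<ominus> e2 \<otimes> r \<otimes> t"
        using st r by (simp add: a_minus_def r_distr r_minus)
      moreover have "lam (e2 \<otimes> r \<otimes> s) = lam (e2 \<otimes> r \<otimes> t)" using that r by (simp add: rep_def)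
      moreover have "e2 \<otimes> r \<otimes> s = (e2 \<otimes> r \<otimes> s \<ominus> e2 \<otimes> r \<otimes> t) \<oplus> e2 \<otimes> r \<otimes> t"
        using st r by (simp add: a_minus_def a_assoc l_neg)
      ultimately have "lam (e2 \<otimes> r \<otimes> t) = lam (e2 \<otimes> r \<otimes> (s \<ominus> t)) \<oplus>\<^bsub>K\<^esub> lam (e2 \<otimes> r \<otimes> t)"
        using l.f_add[of "e2 \<otimes> r \<otimes> (s \<ominus> t)" "e2 \<otimes> r \<otimes> t"] st r by simp
      then show "lam (e2 \<otimes> r \<otimes> (s \<ominus> t)) = \<zero>\<^bsub>K\<^esub>"
        using l.f_closed[of "e2 \<otimes> r \<otimes> t"] l.f_closed[of "e2 \<otimes> r \<otimes> (s \<ominus> t)"] st r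
        by (metis V.R.add.r_cancel_one' m_closed minus_closed e_closed(2) regular_module_simps(1) restrict_scalars_simps(1))
    qed
    then show ?thesis using st by simp
  qed
  define F where "F m = (SOME s. rep m s)" for m
  have F: "rep m (F m)" if "m \<in> carrier M" for m
    unfolding F_def using someI_ex[OF ex[OF that]] .
  have Fc: "F m \<in> carrier R" "F m \<otimes> e1 = F m" if "m \<in> carrier M" for m
    using F[OF that] by (auto simp: rep_def)
  show ?thesis
  proof (intro bexI conjI ballI)
    show "F m \<otimes> e1 = F m" if "m \<in> carrier M" for m using Fc that by simp
    show "F u = f u" if u: "u \<in> U" for u
    proof (rule uniq[of u])
      show "rep u (F u)" using F ud(7)[OF u] .
      have "lam (e2 \<otimes> r \<otimes> f u) = \<Theta> ((e2 \<otimes> r) \<odot>\<^bsub>M\<^esub> u)" if r: "r \<in> carrier R" for r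
        using r u \<Theta>(2)[of "(e2 \<otimes> r) \<odot>\<^bsub>M\<^esub> u"] ud(4) fD by (simp add: m_assoc)
      then show "rep u (f u)" using u fD fe by (simp add: rep_def)
    qed
    show "F \<in> lmod_hom R M (regular_module R)"
    proof (rule lmod_homI)
      fix m assume m: "m \<in> carrier M"
      show "F m \<in> carrier (regular_module R)" using Fc m by simp
      fix a assume a: "a \<in> carrier R"
      have "rep (a \<odot>\<^bsub>M\<^esub> m) (a \<otimes> F m)"
      proof -
        have "lam (e2 \<otimes> r \<otimes> (a \<otimes> F m)) = \<Theta> ((e2 \<otimes> r) \<odot>\<^bsub>M\<^esub> (a \<odot>\<^bsub>M\<^esub> m))" if r: "r \<in> carrier R" for r
        proof -
          have "lam (e2 \<otimes> (r \<otimes> a) \<otimes> F m) = \<Theta> ((e2 \<otimes> (r \<otimes> a)) \<odot>\<^bsub>M\<^esub> m)"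
            using F[OF m] r a by (simp add: rep_def)
          then show ?thesis using r a m Fc by (simp add: m_assoc M.smult_assoc1)
        qed
        then show ?thesis using a Fc[OF m] by (simp add: rep_def m_assoc)
      qed
      then show "F (a \<odot>\<^bsub>M\<^esub> m) = a \<odot>\<^bsub>regular_module R\<^esub> F m"
        using uniq[OF F] a m by simp
    next
      fix m n assume m: "m \<in> carrier M" "n \<in> carrier M"
      have "rep (m \<oplus>\<^bsub>M\<^esub> n) (F m \<oplus> F n)"
        using F[OF m(1)] F[OF m(2)] m l.f_add by (simp add: rep_def l_distr r_distr M.smult_r_distr \<Theta>D)
      then show "F (m \<oplus>\<^bsub>M\<^esub> n) = F m \<oplus>\<^bsub>regular_module R\<^esub> F n"
        using uniq[OF F] m by simp
    qed
  qed
qed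

text \<open>A summand of \<open>(R e1)^n\<close> inherits injectivity from \<open>R e1\<close>: the
  coordinate functions of \<open>f\<close> are extended one by one and recombined.\<close>

lemma extend_hom:
  assumes P: "left_module R P" "has_dual_basis R e1 P" and M: "left_module R M" and U: "submodule U R M"
    and f: "f \<in> lmod_hom R (M\<lparr>carrier := U\<rparr>) P"
  shows "\<exists>F \<in> lmod_hom R M P. \<forall>u \<in> U. F u = f u"
proof -
  interpret P: left_module R P by fact
  obtain n x \<phi> where *: "\<And>j. j < n \<Longrightarrow> x j \<in> carrier P" "\<And>j. j < n \<Longrightarrow> e1 \<odot>\<^bsub>P\<^esub> x j = x j"
    "\<And>j. j < n \<Longrightarrow> \<phi> j \<in> lmod_hom R P (regular_module R)"
    "\<And>j p. j < n \<Longrightarrow> p \<in> carrier P \<Longrightarrow> \<phi> j p \<otimes> e1 = \<phi> j p"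
    "\<And>p. p \<in> carrier P \<Longrightarrow> comb P n x (\<lambda>j. \<phi> j p) = p"
    by (rule has_dual_basisE[OF P(2)]) (rule that)
  have "\<exists>F \<in> lmod_hom R M (regular_module R). (\<forall>m \<in> carrier M. F m \<otimes> e1 = F m) \<and> (\<forall>u \<in> U. F u = \<phi> j (f u))"
    if "j < n" for j
    by (rule extend_hom_Re1[OF M U lmod_hom_comp[OF f *(3)[OF that]]])
      (use lmod_homD(1)[OF f] *(4)[OF that] in simp)
  then obtain \<Phi> where \<Phi>: "\<And>j. j < n \<Longrightarrow> \<Phi> j \<in> lmod_hom R M (regular_module R)"
    "\<And>j u. j < n \<Longrightarrow> u \<in> U \<Longrightarrow> \<Phi> j u = \<phi> j (f u)" by metis
  show ?thesis
  proof (intro bexI ballI)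
    show "(\<lambda>m. comb P n x (\<lambda>j. \<Phi> j m)) \<in> lmod_hom R M P"
      unfolding comb_def by (intro P.lmod_hom_msum P.lmod_hom_smult_fixed *(1) \<Phi>)
    fix u assume u: "u \<in> U"
    have "comb P n x (\<lambda>j. \<Phi> j u) = comb P n x (\<lambda>j. \<phi> j (f u))"
      unfolding comb_def by (rule msum_cong) (simp add: \<Phi>(2)[OF _ u])
    then show "comb P n x (\<lambda>j. \<Phi> j u) = f u" using *(5) lmod_homD(1)[OF f] u by simp
  qed
qed

text \<open>The hypotheses embed \<open>M\<close> in a power of \<open>R e2\<close>. In the
  induction the image of the last coordinate is a left ideal inside \<open>R e2\<close>, projective
  by heredity, and its kernel embeds in the power with one factor less.\<close>

lemma torsionless_proj:
  assumes "left_module R M" "\<And>i. i < (n :: nat) \<Longrightarrow> \<phi> i \<in> lmod_hom R M (regular_module R)"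
    "\<And>i m. i < n \<Longrightarrow> m \<in> carrier M \<Longrightarrow> \<phi> i m \<otimes> e2 = \<phi> i m"
    "\<And>m. m \<in> carrier M \<Longrightarrow> (\<And>i. i < n \<Longrightarrow> \<phi> i m = \<zero>) \<Longrightarrow> m = \<zero>\<^bsub>M\<^esub>"
  shows "proj R M"
  using assms
proof (induction n arbitrary: M)
  case 0
  then interpret M: left_module R M by simp
  show ?case by (rule has_dual_basisI[of 0]) (use 0 in \<open>auto simp: comb_def\<close>)
next
  case (Suc n)
  interpret M: left_module R M by fact
  interpret q: lmod_homomorphism R M "regular_module R" "\<phi> n"
    by (rule lmod_homomorphismI) (use Suc.prems regular_left_module in auto)
  define J where "J = \<phi> n ` carrier M"
  have J: "submodule J R (regular_module R)"
    unfolding J_def by (rule q.image_submodule[OF M.carrier_submodule])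
  have JL: "left_module R ((regular_module R)\<lparr>carrier := J\<rparr>)"
    by (rule q.N.submodule_left_module[OF J])
  have Jp: "proj R ((regular_module R)\<lparr>carrier := J\<rparr>)"
    by (rule hereditary_e2[OF J]) (use Suc.prems(3) in \<open>auto simp: J_def\<close>)
  let ?L = "{x \<in> carrier M. \<phi> n x = \<zero>}"
  have L: "submodule ?L R M" using q.kernel_submodule by simp
  have "proj R (M\<lparr>carrier := ?L\<rparr>)"
  proof (rule Suc.IH)
    show "left_module R (M\<lparr>carrier := ?L\<rparr>)" by (rule M.submodule_left_module[OF L])
    show "\<phi> i \<in> lmod_hom R (M\<lparr>carrier := ?L\<rparr>) (regular_module R)" if "i < n" for i
      by (rule lmod_hom_restrict) (use Suc.prems(2) that in auto)
    show "m = \<zero>\<^bsub>M\<lparr>carrier := ?L\<rparr>\<^esub>" if "m \<in> carrier (M\<lparr>carrier := ?L\<rparr>)" "\<And>i. i < n \<Longrightarrow> \<phi> i m = \<zero>" for m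
    proof -
      have "\<phi> i m = \<zero>" if "i < Suc n" for i
        using that \<open>\<And>i. i < n \<Longrightarrow> \<phi> i m = \<zero>\<close> \<open>m \<in> carrier (M\<lparr>carrier := ?L\<rparr>)\<close>
        by (cases "i = n") auto
      then show ?thesis using Suc.prems(4) \<open>m \<in> carrier (M\<lparr>carrier := ?L\<rparr>)\<close> by simp
    qed
  qed (use Suc.prems(3) in auto)
  then show ?case
    by (intro proj_extension[OF M.left_module_axioms JL Jp lmod_hom_codomain[OF Suc.prems(2)]])
      (auto simp: J_def)
qed

text \<open>A projective module with \<open>e1 P = 0\<close> embeds in a power of
  \<open>R e2\<close>, so heredity applies to its submodules.\<close>

lemma submodule_proj:
  assumes P: "left_module R P" "proj R P" and e: "\<And>p. p \<in> carrier P \<Longrightarrow> e1 \<odot>\<^bsub>P\<^esub> p = \<zero>\<^bsub>P\<^esub>"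
    and L: "submodule L R P"
  shows "proj R (P\<lparr>carrier := L\<rparr>)"
proof -
  interpret P: left_module R P by fact
  note ld = P.submoduleD[OF L]
  obtain n x \<phi> where *: "\<And>j. j < n \<Longrightarrow> x j \<in> carrier P"
    "\<And>j. j < n \<Longrightarrow> \<one> \<odot>\<^bsub>P\<^esub> x j = x j"
    "\<And>j. j < n \<Longrightarrow> \<phi> j \<in> lmod_hom R P (regular_module R)"
    "\<And>j p. j < n \<Longrightarrow> p \<in> carrier P \<Longrightarrow> \<phi> j p \<otimes> \<one> = \<phi> j p"
    "\<And>p. p \<in> carrier P \<Longrightarrow> comb P n x (\<lambda>j. \<phi> j p) = p"
    by (rule has_dual_basisE[OF P(2)]) (rule that)
  note c = lmod_homD(1)[OF *(3), simplified]
  show ?thesis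
  proof (rule torsionless_proj[of _ n "\<lambda>i p. \<phi> i p \<otimes> e2"])
    show "left_module R (P\<lparr>carrier := L\<rparr>)" by (rule P.submodule_left_module[OF L])
    show "(\<lambda>p. \<phi> i p \<otimes> e2) \<in> lmod_hom R (P\<lparr>carrier := L\<rparr>) (regular_module R)" if "i < n" for i
      by (intro lmod_hom_mult_right lmod_hom_restrict[OF *(3)[OF that] ld(1)]) simp
    show "\<phi> i m \<otimes> e2 \<otimes> e2 = \<phi> i m \<otimes> e2" if "i < n" "m \<in> carrier (P\<lparr>carrier := L\<rparr>)" for i m
      using c that ld(7) by (simp add: m_assoc)
    fix m assume m: "m \<in> carrier (P\<lparr>carrier := L\<rparr>)" "\<And>i. i < n \<Longrightarrow> \<phi> i m \<otimes> e2 = \<zero>"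
    then have mP: "m \<in> carrier P" using ld(7) by simp
    have "\<phi> i m \<odot>\<^bsub>P\<^esub> x i = \<zero>\<^bsub>P\<^esub>" if i: "i < n" for i
    proof -
      \<comment> \<open>On \<open>P\<close> the idempotent \<open>e2\<close> acts as the identity,
        so \<open>\<phi> i m\<close> may be replaced by \<open>\<phi> i m \<otimes> e2\<close>
        without losing \<open>m\<close>.\<close>
      have "x i = e2 \<odot>\<^bsub>P\<^esub> x i" using mod_decomp[OF P(1) *(1)[OF i]] e *(1)[OF i] by simp
      then have "\<phi> i m \<odot>\<^bsub>P\<^esub> x i = (\<phi> i m \<otimes> e2) \<odot>\<^bsub>P\<^esub> x i"
        using c[OF i mP] *(1)[OF i] by (simp add: P.smult_assoc1)
      then show ?thesis using m(2)[OF i] *(1)[OF i] by simp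
    qed
    then have "comb P n x (\<lambda>j. \<phi> j m) = \<zero>\<^bsub>P\<^esub>" unfolding comb_def by (intro P.M.msum_zero) simp
    then show "m = \<zero>\<^bsub>P\<lparr>carrier := L\<rparr>\<^esub>" using *(5)[OF mP] by simp
  qed
qed

section \<open>Modules generated by their \<open>e1\<close>-part, and the direct summand
  \<open>R e1 X\<close>\<close>

text \<open>\<open>M = R e1 M\<close>\<close>

definition gen1 :: "('r, 'm) module \<Rightarrow> bool"
  where "gen1 M \<longleftrightarrow> (\<forall>N. submodule N R M \<longrightarrow> (\<forall>m \<in> carrier M. e1 \<odot>\<^bsub>M\<^esub> m \<in> N) \<longrightarrow> N = carrier M)"

lemma gen1D: "gen1 M \<Longrightarrow> submodule N R M \<Longrightarrow> (\<And>m. m \<in> carrier M \<Longrightarrow> e1 \<odot>\<^bsub>M\<^esub> m \<in> N) \<Longrightarrow> N = carrier M"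
  by (simp add: gen1_def)

lemma gen1_image:
  assumes M: "left_module R M" and N: "left_module R N" and f: "f \<in> lmod_hom R M N" and g: "gen1 M"
  shows "gen1 (N\<lparr>carrier := f ` carrier M\<rparr>)"
  unfolding gen1_def
proof (intro allI impI)
  interpret f: lmod_homomorphism R M N f by (rule lmod_homomorphismI) fact+
  have im: "submodule (f ` carrier M) R N" by (rule f.image_submodule[OF f.M.carrier_submodule])
  fix L assume L: "submodule L R (N\<lparr>carrier := f ` carrier M\<rparr>)"
    "\<forall>m\<in>carrier (N\<lparr>carrier := f ` carrier M\<rparr>). e1 \<odot>\<^bsub>N\<lparr>carrier := f ` carrier M\<rparr>\<^esub> m \<in> L"
  then have LN: "L \<subseteq> f ` carrier M" "submodule L R N" using f.N.submodule_trans[OF im] by auto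
  have "{m \<in> carrier M. f m \<in> L} = carrier M"
    by (rule gen1D[OF g f.preimage_submodule[OF LN(2)]]) (use L in \<open>auto simp: f.f_smult\<close>)
  then have "f ` carrier M \<subseteq> L" by auto
  then show "L = carrier (N\<lparr>carrier := f ` carrier M\<rparr>)" using LN by simp
qed

lemma dual_basis_gen1:
  assumes P: "left_module R P" "has_dual_basis R e1 P"
  shows "gen1 P"
  unfolding gen1_def
proof (intro allI impI)
  interpret P: left_module R P by fact
  fix N assume N: "submodule N R P" "\<forall>m\<in>carrier P. e1 \<odot>\<^bsub>P\<^esub> m \<in> N"
  obtain n x \<phi> where *: "\<And>j. j < n \<Longrightarrow> x j \<in> carrier P" "\<And>j. j < n \<Longrightarrow> e1 \<odot>\<^bsub>P\<^esub> x j = x j"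
    "\<And>j. j < n \<Longrightarrow> \<phi> j \<in> lmod_hom R P (regular_module R)"
    "\<And>j p. j < n \<Longrightarrow> p \<in> carrier P \<Longrightarrow> \<phi> j p \<otimes> e1 = \<phi> j p"
    "\<And>p. p \<in> carrier P \<Longrightarrow> comb P n x (\<lambda>j. \<phi> j p) = p"
    by (rule has_dual_basisE[OF P(2)]) (rule that)
  have "p \<in> N" if p: "p \<in> carrier P" for p
  proof -
    have "comb P n x (\<lambda>j. \<phi> j p) \<in> N"
      unfolding comb_def
    proof (rule P.submodule_msum[OF N(1)])
      fix i assume i: "i < n"
      have "x i \<in> N" using *(1,2)[OF i] N(2) by metis
      then show "\<phi> i p \<odot>\<^bsub>P\<^esub> x i \<in> N"
        using P.submoduleD(4)[OF N(1)] lmod_homD(1)[OF *(3)[OF i] p] by simp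
    qed
    then show ?thesis using *(5)[OF p] by simp
  qed
  then show "N = carrier P" using P.submoduleD(1)[OF N(1)] by auto
qed

text \<open>The vectors \<open>e1 x j\<close> and the functionals \<open>\<phi> j\<close> followed
  by right multiplication with \<open>e1\<close> replace the given ones; the endomorphism
  \<open>h\<close> they define is the identity on \<open>e1 P\<close>, hence on the module generated
  by it.\<close>

lemma proj_gen1_dual_basis:
  assumes P: "left_module R P" "proj R P" "gen1 P"
  shows "has_dual_basis R e1 P"
proof -
  interpret P: left_module R P by fact
  obtain n x \<phi> where *: "\<And>j. j < n \<Longrightarrow> x j \<in> carrier P" "\<And>j. j < n \<Longrightarrow> \<one> \<odot>\<^bsub>P\<^esub> x j = x j"
    "\<And>j. j < n \<Longrightarrow> \<phi> j \<in> lmod_hom R P (regular_module R)"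
    "\<And>j p. j < n \<Longrightarrow> p \<in> carrier P \<Longrightarrow> \<phi> j p \<otimes> \<one> = \<phi> j p"
    "\<And>p. p \<in> carrier P \<Longrightarrow> comb P n x (\<lambda>j. \<phi> j p) = p"
    by (rule has_dual_basisE[OF P(2)]) (rule that)
  note c = lmod_homD(1)[OF *(3), simplified]
  define y where "y j = e1 \<odot>\<^bsub>P\<^esub> x j" for j
  have y: "y j \<in> carrier P" if "j < n" for j using * that by (simp add: y_def)
  define h where "h p = comb P n y (\<lambda>j. \<phi> j p \<otimes> e1)" for p
  have hh: "h \<in> lmod_hom R P P"
    unfolding h_def comb_def
    by (intro P.lmod_hom_msum P.lmod_hom_smult_fixed lmod_hom_mult_right * y) simp_all
  interpret h: lmod_homomorphism R P P h by unfold_locales fact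
  have d: "(\<lambda>p. p \<ominus>\<^bsub>P\<^esub> h p) \<in> lmod_hom R P P" by (intro P.lmod_hom_minus lmod_hom_id hh)
  interpret d: lmod_homomorphism R P P "\<lambda>p. p \<ominus>\<^bsub>P\<^esub> h p" by unfold_locales fact
  \<comment> \<open>On \<open>e1 P\<close> the functionals take values in
    \<open>e1 R = e1 R e1\<close>, so the extra factors \<open>e1\<close> have no effect and
    \<open>h\<close> is the identity there.\<close>
  have "{p \<in> carrier P. p \<ominus>\<^bsub>P\<^esub> h p = \<zero>\<^bsub>P\<^esub>} = carrier P"
  proof (rule gen1D[OF P(3) d.kernel_submodule])
    fix p assume p: "p \<in> carrier P"
    let ?q = "e1 \<odot>\<^bsub>P\<^esub> p"
    have "h ?q = comb P n x (\<lambda>j. \<phi> j ?q)"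
      unfolding h_def comb_def
    proof (rule msum_cong)
      fix j assume j: "j < n"
      have "\<phi> j ?q = e1 \<otimes> \<phi> j p" using lmod_homD(3)[OF *(3)[OF j]] p by simp
      then have "\<phi> j ?q \<otimes> e1 = \<phi> j ?q" using e1_right c[OF j p] by simp
      then show "(\<phi> j ?q \<otimes> e1) \<odot>\<^bsub>P\<^esub> y j = \<phi> j ?q \<odot>\<^bsub>P\<^esub> x j"
        using *(1)[OF j] c[OF j, of ?q] p by (simp add: y_def P.smult_assoc1[symmetric])
    qed
    then show "?q \<in> {p \<in> carrier P. p \<ominus>\<^bsub>P\<^esub> h p = \<zero>\<^bsub>P\<^esub>}"
      using p *(5) by simp
  qed
  then have hp: "h p = p" if "p \<in> carrier P" for p
  proof -
    have "p \<ominus>\<^bsub>P\<^esub> h p = \<zero>\<^bsub>P\<^esub>" using that \<open>_ = carrier P\<close> by blast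
    then show ?thesis using that by simp
  qed
  show ?thesis
  proof (rule has_dual_basisI[of n y _ _ "\<lambda>j p. \<phi> j p \<otimes> e1"])
    show "e1 \<odot>\<^bsub>P\<^esub> y j = y j" if "j < n" for j
      using *(1)[OF that] by (simp add: y_def P.smult_assoc1[symmetric])
    show "(\<lambda>p. \<phi> j p \<otimes> e1) \<in> lmod_hom R P (regular_module R)" if "j < n" for j
      by (rule lmod_hom_mult_right[OF *(3)[OF that]]) simp
    show "\<phi> j p \<otimes> e1 \<otimes> e1 = \<phi> j p \<otimes> e1" if "j < n" "p \<in> carrier P" for j p
      using c[OF that] by (simp add: m_assoc)
    show "comb P n y (\<lambda>j. \<phi> j p \<otimes> e1) = p" if "p \<in> carrier P" for p
      using hp[OF that] by (simp add: h_def)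
  qed (rule y)
qed

lemma e1_comb:
  assumes X: "left_module R X" and g: "\<And>i. i < n \<Longrightarrow> g i \<in> carrier X"
    and f: "\<And>i. i < n \<Longrightarrow> f i \<in> carrier R"
  shows "e1 \<odot>\<^bsub>X\<^esub> comb X n g f = comb X n (\<lambda>i. e1 \<odot>\<^bsub>X\<^esub> g i) (\<lambda>i. e1 \<otimes> f i)"
proof -
  interpret X: left_module R X by fact
  have "e1 \<odot>\<^bsub>X\<^esub> comb X n g f = msum X n (\<lambda>i. e1 \<odot>\<^bsub>X\<^esub> (f i \<odot>\<^bsub>X\<^esub> g i))"
    unfolding comb_def by (rule X.msum_smult) (use f g in auto)
  also have "\<dots> = comb X n (\<lambda>i. e1 \<odot>\<^bsub>X\<^esub> g i) (\<lambda>i. e1 \<otimes> f i)"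
    unfolding comb_def
    by (rule msum_cong) (use f g in \<open>simp add: X.smult_assoc1[symmetric] e1_right\<close>)
  finally show ?thesis .
qed

text \<open>Applying \<open>e1\<close> to a combination replaces the coefficients by
  \<open>e1 f i = e1 f i e1\<close>; hence \<open>e1 X\<close> is reached from
  \<open>(R e1)^n\<close> through the elements \<open>e1 g i\<close>.\<close>

lemma gen1_cover:
  assumes X: "left_module R X" and g: "\<And>i. i < n \<Longrightarrow> g i \<in> carrier X"
    and onto: "comb X n g ` carrier (free_mod R \<one> n) = carrier X"
    and y: "y = (\<lambda>i. e1 \<odot>\<^bsub>X\<^esub> g i)" and x: "x \<in> carrier X"
  shows "e1 \<odot>\<^bsub>X\<^esub> x \<in> comb X n y ` carrier (free_mod R e1 n)"
proof -
  interpret X: left_module R X by fact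
  obtain f where f: "f \<in> carrier (free_mod R \<one> n)" "x = comb X n g f" using x onto by blast
  have "e1 \<odot>\<^bsub>X\<^esub> x = comb X n y (\<lambda>i. e1 \<otimes> f i)"
    unfolding f(2) y using free_mod_closed[OF f(1)] by (intro e1_comb[OF X g])
  moreover have "(\<lambda>i. e1 \<otimes> f i) \<in> carrier (free_mod R e1 n)"
    using f(1) by (auto simp: free_mod_carrier e1_right)
  ultimately show ?thesis by blast
qed

text \<open>The submodule \<open>T = R e1 X\<close> is a quotient of the injective module
  \<open>(R e1)^n\<close>, and heredity makes it a direct summand. A retraction is built on the free
  cover \<open>F\<close> of \<open>X\<close> and then descended: on the part \<open>(R e1)^n\<close>
  it is forced, on the part \<open>(R e2)^n\<close> only its values on the preimage of
  \<open>T\<close> are prescribed.\<close>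

lemma torsion_decomposition:
  assumes X: "left_module R X" "finitely_generated R X"
  shows "\<exists>r \<in> lmod_hom R X X. (\<forall>x \<in> carrier X. r (r x) = r x) \<and>
    (\<forall>x \<in> carrier X. e1 \<odot>\<^bsub>X\<^esub> r x = e1 \<odot>\<^bsub>X\<^esub> x) \<and> gen1 (X\<lparr>carrier := r ` carrier X\<rparr>)"
proof -
  interpret X: left_module R X by fact
  obtain n g where g: "\<And>i. i < n \<Longrightarrow> g i \<in> carrier X"
    and s: "comb X n g ` carrier (free_mod R \<one> n) = carrier X"
    using X(2) unfolding X.finitely_generated_iff by auto
  define y where "y = (\<lambda>i. e1 \<odot>\<^bsub>X\<^esub> g i)"
  have y: "y i \<in> carrier X" if "i < n" for i using g that by (simp add: y_def)
  define F where "F = free_mod R \<one> n"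
  define E where "E = free_mod R e1 n"
  have E: "left_module R E" "has_dual_basis R e1 E"
    unfolding E_def by (simp_all add: free_mod_left_module free_mod_dual_basis)
  have F: "left_module R F" unfolding F_def by (simp add: free_mod_left_module)
  interpret E: left_module R E by fact
  interpret F: left_module R F by fact
  have cg: "comb X n g \<in> lmod_hom R F X" unfolding F_def by (rule X.comb_hom[OF g])
  have cy: "comb X n y \<in> lmod_hom R E X" unfolding E_def by (rule X.comb_hom[OF y])
  interpret cg: lmod_homomorphism R F X "comb X n g" by (rule lmod_homomorphismI[OF F X(1) cg])
  interpret cy: lmod_homomorphism R E X "comb X n y" by (rule lmod_homomorphismI[OF E(1) X(1) cy])
  define T where "T = comb X n y ` carrier E"
  have T: "submodule T R X" unfolding T_def by (rule cy.image_submodule[OF E.carrier_submodule])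
  have e1T: "e1 \<odot>\<^bsub>X\<^esub> x \<in> T" if "x \<in> carrier X" for x
    unfolding T_def E_def by (rule gen1_cover[OF X(1) g s y_def that])
  \<comment> \<open>The elements of the \<open>e2\<close>-part of the cover that are mapped into
    \<open>T\<close>; as a submodule of \<open>(R e2)^n\<close> it is projective.\<close>
  define Q where "Q = {f \<in> carrier F. comb X n g f \<in> T} \<inter> carrier (free_mod R e2 n)"
  have De: "carrier (free_mod R e n) \<subseteq> carrier F" if "e \<in> carrier R" for e
    unfolding F_def using lmod_homD(1)[OF free_mod_incl[OF that]] by auto
  have D: "submodule (carrier (free_mod R e2 n)) R F"
  proof (rule F.submoduleI)
    interpret D: left_module R "free_mod R e2 n" by (rule free_mod_left_module) simp
    show "\<zero>\<^bsub>F\<^esub> \<in> carrier (free_mod R e2 n)" using D.M.zero_closed by (simp add: F_def)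
    show "x \<oplus>\<^bsub>F\<^esub> z \<in> carrier (free_mod R e2 n)"
      if "x \<in> carrier (free_mod R e2 n)" "z \<in> carrier (free_mod R e2 n)" for x z
      using D.M.a_closed[OF that] by (simp add: F_def)
    show "a \<odot>\<^bsub>F\<^esub> x \<in> carrier (free_mod R e2 n)"
      if "a \<in> carrier R" "x \<in> carrier (free_mod R e2 n)" for a x
      using D.smult_closed[OF that] by (simp add: F_def)
  qed (rule De, simp)
  have Q: "submodule Q R F" unfolding Q_def by (intro F.submodule_Int cg.preimage_submodule T D)
  have QL: "left_module R (F\<lparr>carrier := Q\<rparr>)" by (rule F.submodule_left_module[OF Q])
  have Qp: "proj R (F\<lparr>carrier := Q\<rparr>)"
  proof (rule torsionless_proj[OF QL, of n "\<lambda>i f. f i"])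
    show "(\<lambda>f. f i) \<in> lmod_hom R (F\<lparr>carrier := Q\<rparr>) (regular_module R)" for i
      unfolding F_def by (intro lmod_hom_restrict[OF free_mod_coord_hom]) (auto simp: Q_def F_def)
    show "f i \<otimes> e2 = f i" if "i < n" "f \<in> carrier (F\<lparr>carrier := Q\<rparr>)" for i f
      using that by (simp add: Q_def free_mod_carrier)
    show "f = \<zero>\<^bsub>F\<lparr>carrier := Q\<rparr>\<^esub>" if "f \<in> carrier (F\<lparr>carrier := Q\<rparr>)" "\<And>i. i < n \<Longrightarrow> f i = \<zero>" for f
    proof
      fix i show "f i = \<zero>\<^bsub>F\<lparr>carrier := Q\<rparr>\<^esub> i"
        using that by (cases "i < n") (auto simp: Q_def F_def free_mod_carrier)
    qed
  qed
  \<comment> \<open>Projectivity of \<open>Q\<close> lifts the cover, restricted to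
    \<open>Q\<close>, to the injective module \<open>E\<close>; afterwards the lift extends to all
    of \<open>F\<close>.\<close>
  obtain \<sigma> where \<sigma>: "\<sigma> \<in> lmod_hom R (F\<lparr>carrier := Q\<rparr>) E" "\<And>q. q \<in> Q \<Longrightarrow> comb X n y (\<sigma> q) = comb X n g q"
  proof -
    have "\<exists>h\<in>lmod_hom R (F\<lparr>carrier := Q\<rparr>) E. \<forall>q\<in>carrier (F\<lparr>carrier := Q\<rparr>). comb X n y (h q) = comb X n g q"
      by (rule proj_lift[OF QL Qp E(1) X(1) cy lmod_hom_restrict[OF cg]])
        (use F.submoduleD(1)[OF Q] in \<open>auto simp: Q_def T_def\<close>)
    then show thesis using that by auto
  qed
  obtain \<sigma>' where \<sigma>': "\<sigma>' \<in> lmod_hom R F E" "\<And>q. q \<in> Q \<Longrightarrow> \<sigma>' q = \<sigma> q"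
    using extend_hom[OF E F Q \<sigma>(1)] by auto
  define m1 where "m1 = (\<lambda>(f :: nat \<Rightarrow> 'r) i. f i \<otimes> e1)"
  define m2 where "m2 = (\<lambda>(f :: nat \<Rightarrow> 'r) i. f i \<otimes> e2)"
  have m1: "m1 \<in> lmod_hom R F E" unfolding m1_def F_def E_def by (rule free_mod_mult_right) simp_all
  have m2': "m2 \<in> lmod_hom R F (free_mod R e2 n)" unfolding m2_def F_def by (rule free_mod_mult_right) simp_all
  have m2: "m2 \<in> lmod_hom R F F"
    unfolding F_def by (rule lmod_hom_comp[OF m2'[unfolded F_def] free_mod_incl]) simp
  have m12: "m1 f \<oplus>\<^bsub>F\<^esub> m2 f = f" if "f \<in> carrier F" for f
    using free_mod_closed[OF that[unfolded F_def]] decomp_right by (auto simp: m1_def m2_def F_def)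
  have gy: "comb X n g (m1 f) = comb X n y (m1 f)" if "f \<in> carrier F" for f
    unfolding comb_def
  proof (rule msum_cong)
    fix i assume "i < n"
    then show "m1 f i \<odot>\<^bsub>X\<^esub> g i = m1 f i \<odot>\<^bsub>X\<^esub> y i"
      using g free_mod_closed[OF that[unfolded F_def], of i]
      by (simp add: m1_def y_def X.smult_assoc1[symmetric] m_assoc)
  qed
  have EF: "f \<in> carrier F" if "f \<in> carrier E" for f using De[of e1] that by (auto simp: E_def)
  note m1c = lmod_homD(1)[OF m1] and m2c = lmod_homD(1)[OF m2] and m2c' = lmod_homD(1)[OF m2']
  \<comment> \<open>\<open>m1\<close> and \<open>m2\<close> split \<open>F\<close> into its
    \<open>e1\<close>- and \<open>e2\<close>-parts. The map \<open>k\<close> takes values in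
    \<open>T\<close> and agrees with the cover of \<open>X\<close> wherever the
    \<open>e2\<close>-part lies in \<open>Q\<close>.\<close>
  define k where "k f = comb X n y (m1 f) \<oplus>\<^bsub>X\<^esub> comb X n y (\<sigma>' (m2 f))" for f
  have k: "k \<in> lmod_hom R F X"
    unfolding k_def
    by (intro X.lmod_hom_add lmod_hom_comp[OF m1 cy] lmod_hom_comp[OF lmod_hom_comp[OF m2 \<sigma>'(1)] cy])
  have kQ: "k f = comb X n g f" if f: "f \<in> carrier F" "m2 f \<in> Q" for f
  proof -
    have "comb X n g f = comb X n g (m1 f \<oplus>\<^bsub>F\<^esub> m2 f)" using m12 f by simp
    also have "\<dots> = comb X n g (m1 f) \<oplus>\<^bsub>X\<^esub> comb X n g (m2 f)"
      using cg.f_add m1c m2c EF f by simp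
    finally show ?thesis using gy f \<sigma>' \<sigma> by (simp add: k_def)
  qed
  \<comment> \<open>If \<open>f\<close> is mapped to zero, the images of its two parts are opposite,
    so the \<open>e2\<close>-part lies in \<open>Q\<close>. Hence \<open>k\<close> descends to
    \<open>X\<close>.\<close>
  have "k f = \<zero>\<^bsub>X\<^esub>" if f: "f \<in> carrier F" "comb X n g f = \<zero>\<^bsub>X\<^esub>" for f
  proof -
    have "m2 f = f \<ominus>\<^bsub>F\<^esub> m1 f"
      using F.add_minus_cancel(2)[of "m2 f" "m1 f"] m12[OF f(1)] m1c m2c EF f(1) by simp
    then have "comb X n g (m2 f) = comb X n g f \<ominus>\<^bsub>X\<^esub> comb X n y (m1 f)"
      using cg.f_minus gy m1c EF f(1) by simp
    also have "\<dots> \<in> T"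
    proof (rule X.submoduleD(6)[OF T])
      show "comb X n g f \<in> T" using X.submoduleD(2)[OF T] f by simp
      show "comb X n y (m1 f) \<in> T" using m1c f by (simp add: T_def)
    qed
    finally have "m2 f \<in> Q" using m2c m2c' f by (simp add: Q_def)
    then show ?thesis using kQ f by simp
  qed
  then obtain r where r: "r \<in> lmod_hom R X X" "\<And>f. f \<in> carrier F \<Longrightarrow> r (comb X n g f) = k f"
    using cg.factor[OF X(1) k] s by (auto simp: F_def)
  interpret r: lmod_homomorphism R X X r by (rule lmod_homomorphismI[OF X(1) X(1) r(1)])
  have rT: "r x \<in> T" if "x \<in> carrier X" for x
  proof -
    obtain f where f: "f \<in> carrier F" "x = comb X n g f" using \<open>x \<in> carrier X\<close> s by (auto simp: F_def)
    have "k f \<in> T"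
      unfolding k_def
    proof (rule X.submoduleD(3)[OF T])
      show "comb X n y (m1 f) \<in> T" using m1c[OF f(1)] by (simp add: T_def)
      show "comb X n y (\<sigma>' (m2 f)) \<in> T" using lmod_homD(1)[OF \<sigma>'(1) m2c[OF f(1)]] by (simp add: T_def)
    qed
    then show ?thesis using r f by simp
  qed
  have rt: "r t = t" if "t \<in> T" for t
  proof -
    obtain f where f: "f \<in> carrier E" "t = comb X n y f" using \<open>t \<in> T\<close> by (auto simp: T_def)
    have fi: "f i \<in> carrier R" "f i \<otimes> e1 = f i" for i
      using f(1) free_mod_closed[of f e1 n i] by (cases "i < n"; simp add: E_def free_mod_carrier)+
    have "m1 f = f" using fi by (simp add: m1_def)
    then have t: "t = comb X n g f" using gy[OF EF[OF f(1)]] f by simp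
    have "f i \<otimes> e2 = \<zero>" for i
      using fi[of i] m_assoc[of "f i" e1 e2] by simp
    then have "m2 f = \<zero>\<^bsub>F\<^esub>" by (simp add: m2_def F_def)
    then have "m2 f \<in> Q" using F.submoduleD(2)[OF Q] by simp
    then show ?thesis using kQ r t EF f(1) by simp
  qed
  have rX: "r ` carrier X = T"
  proof (intro equalityI image_subsetI subsetI rT)
    fix t assume "t \<in> T"
    then show "t \<in> r ` carrier X"
      using rt[of t] X.submoduleD(7)[OF T] by (intro image_eqI[of _ _ t]) auto
  qed
  show ?thesis
  proof (intro bexI[OF _ r(1)] conjI ballI)
    show "r (r x) = r x" if "x \<in> carrier X" for x using rT rt that by simp
    show "e1 \<odot>\<^bsub>X\<^esub> r x = e1 \<odot>\<^bsub>X\<^esub> x" if "x \<in> carrier X" for x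
      using rt[OF e1T[OF that]] that by (simp add: r.f_smult)
    show "gen1 (X\<lparr>carrier := r ` carrier X\<rparr>)"
      unfolding rX T_def by (rule gen1_image[OF E(1) X(1) cy dual_basis_gen1[OF E]])
  qed
qed

text \<open>The idempotent of \<open>torsion_decomposition\<close> is zero or the identity; in the
  first case \<open>e1 X = e1 r X = 0\<close>.\<close>

lemma indecomposable_cases:
  assumes X: "left_module R X" "finitely_generated R X" "indecomposable R X"
  shows "gen1 X \<or> (\<forall>x \<in> carrier X. e1 \<odot>\<^bsub>X\<^esub> x = \<zero>\<^bsub>X\<^esub>)"
proof -
  interpret X: left_module R X by fact
  obtain r where r: "r \<in> lmod_hom R X X" "\<And>x. x \<in> carrier X \<Longrightarrow> r (r x) = r x"
    "\<And>x. x \<in> carrier X \<Longrightarrow> e1 \<odot>\<^bsub>X\<^esub> r x = e1 \<odot>\<^bsub>X\<^esub> x" "gen1 (X\<lparr>carrier := r ` carrier X\<rparr>)"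
    using torsion_decomposition[OF X(1,2)] by blast
  from X.indecomposable_idempotent[OF X(3) r(1,2)] show ?thesis
  proof
    assume "\<forall>m\<in>carrier X. r m = \<zero>\<^bsub>X\<^esub>"
    then show ?thesis using r(3) X.smult_r_null[of e1] by auto
  next
    assume "\<forall>m\<in>carrier X. r m = m"
    then have "r ` carrier X = carrier X" by force
    then show ?thesis using r(4) by simp
  qed
qed

section \<open>Presentations of modules and their transfer along nonzero maps\<close>

text \<open>\<open>e1 P\<close> is a semisimple \<open>e1 R e1\<close>-module.\<close>

definition top_semisimple :: "('r, 'm) module \<Rightarrow> bool"
  where "top_semisimple P \<longleftrightarrow> (\<forall>V. submodule V R P \<longrightarrow> gen1 (P\<lparr>carrier := V\<rparr>) \<longrightarrow>
    (\<exists>r \<in> lmod_hom R P P. (\<forall>p \<in> carrier P. r p \<in> V) \<and> (\<forall>v \<in> V. r v = v)))"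

text \<open>The kind of module meant in the overview: \<open>Y\<close> is the quotient of
  \<open>P\<close> by a projective submodule with vanishing \<open>e1\<close>-part. Essentiality of
  the kernel enters through its consequence \<open>top_semisimple\<close>, which is inherited by the
  summands of \<open>P\<close> occurring for predecessors. \<open>P\<close> is small so that its
  existence can be asserted at one type.\<close>

definition presents :: "'r small_module \<Rightarrow> ((nat \<Rightarrow> 'r) \<Rightarrow> 'm) \<Rightarrow> ('r, 'm) module \<Rightarrow> bool"
  where "presents P p Y \<longleftrightarrow> left_module R P \<and> has_dual_basis R e1 P \<and> top_semisimple P \<and>
    p \<in> lmod_hom R P Y \<and> p ` carrier P = carrier Y \<and>
    (\<forall>x \<in> carrier P. p x = \<zero>\<^bsub>Y\<^esub> \<longrightarrow> e1 \<odot>\<^bsub>P\<^esub> x = \<zero>\<^bsub>P\<^esub>) \<and>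
    proj R (P\<lparr>carrier := {x \<in> carrier P. p x = \<zero>\<^bsub>Y\<^esub>}\<rparr>)"

text \<open>The work goes into an idempotent \<open>e\<close> of \<open>Y\<close> with
  \<open>f e = f\<close>. As \<open>f\<close> is nonzero and \<open>Y\<close> indecomposable,
  \<open>e\<close> is the identity, and then \<open>V\<close> with kernel \<open>L\<close> presents
  \<open>Y\<close>.\<close>

lemma presents_pull:
  fixes Y :: "('r, 'n) module" and X :: "('r, 'm) module"
  assumes Y: "left_module R Y" "finitely_generated R Y" "indecomposable R Y" "gen1 Y"
    and X: "left_module R X" and p: "presents P p X"
    and f: "f \<in> lmod_hom R Y X" "y0 \<in> carrier Y" "f y0 \<noteq> \<zero>\<^bsub>X\<^esub>"
  shows "\<exists>(P' :: 'r small_module) p'. presents P' p' Y"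
proof -
  have P: "left_module R P" "has_dual_basis R e1 P" "top_semisimple P"
    and pX: "p \<in> lmod_hom R P X" "p ` carrier P = carrier X"
    and pe: "\<And>x. x \<in> carrier P \<Longrightarrow> p x = \<zero>\<^bsub>X\<^esub> \<Longrightarrow> e1 \<odot>\<^bsub>P\<^esub> x = \<zero>\<^bsub>P\<^esub>"
    and pK: "proj R (P\<lparr>carrier := {x \<in> carrier P. p x = \<zero>\<^bsub>X\<^esub>}\<rparr>)"
    using p by (auto simp: presents_def)
  interpret Y: left_module R Y by fact
  interpret X: left_module R X by fact
  interpret P: left_module R P by fact
  interpret f: lmod_homomorphism R Y X f by (rule lmod_homomorphismI[OF Y(1) X f(1)])
  interpret p: lmod_homomorphism R P X p by (rule lmod_homomorphismI[OF P(1) X pX(1)])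
  obtain n g where g: "\<And>i. i < n \<Longrightarrow> g i \<in> carrier Y"
    and s: "comb Y n g ` carrier (free_mod R \<one> n) = carrier Y"
    using Y(2) unfolding Y.finitely_generated_iff by auto
  define y where "y = (\<lambda>i. e1 \<odot>\<^bsub>Y\<^esub> g i)"
  have y: "y i \<in> carrier Y" if "i < n" for i using g that by (simp add: y_def)
  define Q where "Q = free_mod R e1 n"
  have Q: "left_module R Q" "has_dual_basis R e1 Q"
    unfolding Q_def by (simp_all add: free_mod_left_module free_mod_dual_basis)
  interpret Q: left_module R Q by fact
  define \<rho> where "\<rho> = comb Y n y"
  have \<rho>: "\<rho> \<in> lmod_hom R Q Y" unfolding Q_def \<rho>_def by (rule Y.comb_hom[OF y])
  interpret \<rho>: lmod_homomorphism R Q Y \<rho> by (rule lmod_homomorphismI[OF Q(1) Y(1) \<rho>])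
  have \<rho>Y: "\<rho> ` carrier Q = carrier Y"
    by (rule gen1D[OF Y(4) \<rho>.image_submodule[OF Q.carrier_submodule]])
      (unfold \<rho>_def Q_def, rule gen1_cover[OF Y(1) g s y_def])
  obtain F where F: "F \<in> lmod_hom R Q P" "\<And>q. q \<in> carrier Q \<Longrightarrow> p (F q) = f (\<rho> q)"
    using proj_lift[OF Q P(1) X pX(1) lmod_hom_comp[OF \<rho> f(1)]] pX(2) by auto
  interpret F: lmod_homomorphism R Q P F by (rule lmod_homomorphismI[OF Q(1) P(1) F(1)])
  define V where "V = F ` carrier Q"
  have V: "submodule V R P" unfolding V_def by (rule F.image_submodule[OF Q.carrier_submodule])
  note Vd = P.submoduleD[OF V]
  have VL: "left_module R (P\<lparr>carrier := V\<rparr>)" by (rule P.submodule_left_module[OF V])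
  have Vg: "gen1 (P\<lparr>carrier := V\<rparr>)"
    unfolding V_def by (rule gen1_image[OF Q(1) P(1) F(1) dual_basis_gen1[OF Q]])
  \<comment> \<open>\<open>V\<close> is the image of a module generated by its
    \<open>e1\<close>-part, so \<open>top_semisimple\<close> provides a retraction onto it.\<close>
  obtain r where r: "r \<in> lmod_hom R P P" "\<And>x. x \<in> carrier P \<Longrightarrow> r x \<in> V" "\<And>v. v \<in> V \<Longrightarrow> r v = v"
    using P(3) V Vg unfolding top_semisimple_def by blast
  have Vi: "(\<lambda>x. x) \<in> lmod_hom R (P\<lparr>carrier := V\<rparr>) P" by (rule lmod_hom_restrict[OF lmod_hom_id Vd(1)])
  have Vp: "has_dual_basis R e1 (P\<lparr>carrier := V\<rparr>)"
    by (rule proj_retract[OF P(1,2) VL _ Vi lmod_hom_codomain[OF r(1,2)]]) (use r(3) in auto)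
  obtain \<sigma> where \<sigma>: "\<sigma> \<in> lmod_hom R (P\<lparr>carrier := V\<rparr>) Q" "\<And>v. v \<in> V \<Longrightarrow> F (\<sigma> v) = v"
    using proj_lift[OF VL Vp Q(1) P(1) F(1) Vi] by (auto simp: V_def)
  define U where "U = {q \<in> carrier Q. \<rho> q = \<zero>\<^bsub>Y\<^esub>}"
  have U: "submodule U R Q" unfolding U_def by (rule \<rho>.kernel_submodule)
  note Ud = Q.submoduleD[OF U]
  have UL: "left_module R (Q\<lparr>carrier := U\<rparr>)" by (rule Q.submodule_left_module[OF U])
  define L where "L = F ` U"
  have L: "submodule L R P" unfolding L_def by (rule F.image_submodule[OF U])
  note Ld = P.submoduleD[OF L]
  have LL: "left_module R (P\<lparr>carrier := L\<rparr>)" by (rule P.submodule_left_module[OF L])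
  define Kr where "Kr = {x \<in> carrier P. p x = \<zero>\<^bsub>X\<^esub>}"
  have Kr: "submodule Kr R P" unfolding Kr_def by (rule p.kernel_submodule)
  have LKr: "L \<subseteq> Kr" using F(2) by (auto simp: L_def U_def Kr_def)
  have LV: "L \<subseteq> V" using Ud(7) by (auto simp: L_def V_def)
  \<comment> \<open>Heredity applies because \<open>L\<close> is contained in the kernel of
    \<open>p\<close>, a projective module on which \<open>e1\<close> acts as zero.\<close>
  have Lp: "proj R (P\<lparr>carrier := L\<rparr>)"
    using submodule_proj[OF P.submodule_left_module[OF Kr] pK[folded Kr_def], of L]
      P.submodule_trans[OF Kr, of L] LKr L pe by (simp add: Kr_def)
  have Li: "(\<lambda>x. x) \<in> lmod_hom R (P\<lparr>carrier := L\<rparr>) P" by (rule lmod_hom_restrict[OF lmod_hom_id Ld(1)])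
  \<comment> \<open>A second section of \<open>F\<close>, defined on \<open>L\<close> only but with
    values in \<open>U\<close>.\<close>
  obtain t where t: "t \<in> lmod_hom R (P\<lparr>carrier := L\<rparr>) (Q\<lparr>carrier := U\<rparr>)" "\<And>l. l \<in> L \<Longrightarrow> F (t l) = l"
    using proj_lift[OF LL Lp UL P(1) lmod_hom_restrict[OF F(1) Ud(1)] Li] by (auto simp: L_def)
  have tU: "t l \<in> U" if "l \<in> L" for l using lmod_homD(1)[OF t(1)] that by simp
  have tQ: "t \<in> lmod_hom R (P\<lparr>carrier := L\<rparr>) Q" by (rule lmod_hom_codomainD[OF t(1) Ud(1)])
  have LsubV: "submodule L R (P\<lparr>carrier := V\<rparr>)" using P.submodule_trans[OF V] L LV by simp
  have \<sigma>L: "\<sigma> \<in> lmod_hom R (P\<lparr>carrier := L\<rparr>) Q"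
    using lmod_hom_restrict[OF \<sigma>(1), of L] LV by simp
  \<comment> \<open>The defect of \<open>\<sigma>\<close> on \<open>L\<close>; its extension
    \<open>G\<close> to \<open>V\<close> exists because \<open>Q\<close> is injective.\<close>
  obtain G where G: "G \<in> lmod_hom R (P\<lparr>carrier := V\<rparr>) Q" "\<And>l. l \<in> L \<Longrightarrow> G l = \<sigma> l \<ominus>\<^bsub>Q\<^esub> t l"
    using extend_hom[OF Q VL LsubV, of "\<lambda>l. \<sigma> l \<ominus>\<^bsub>Q\<^esub> t l"] Q.lmod_hom_minus[OF \<sigma>L tQ] by auto
  have FV: "F \<in> lmod_hom R Q (P\<lparr>carrier := V\<rparr>)" by (rule lmod_hom_codomain[OF F(1)]) (simp add: V_def)
  \<comment> \<open>Only the component \<open>G - \<sigma> F G\<close> of \<open>G\<close> in the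
    kernel of \<open>F\<close> is subtracted, so \<open>\<sigma>'\<close> is still a section of
    \<open>F\<close>. On \<open>L\<close> one has \<open>F G = 0\<close>, whence
    \<open>\<sigma>' = \<sigma> - G = t\<close>.\<close>
  define \<sigma>' where "\<sigma>' v = \<sigma> v \<ominus>\<^bsub>Q\<^esub> (G v \<ominus>\<^bsub>Q\<^esub> \<sigma> (F (G v)))" for v
  have \<sigma>': "\<sigma>' \<in> lmod_hom R (P\<lparr>carrier := V\<rparr>) Q"
    unfolding \<sigma>'_def by (intro Q.lmod_hom_minus \<sigma>(1) G(1) lmod_hom_comp[OF lmod_hom_comp[OF G(1) FV] \<sigma>(1)])
  have \<sigma>c: "\<sigma> v \<in> carrier Q" "G v \<in> carrier Q" "F (G v) \<in> V" "\<sigma>' v \<in> carrier Q" if "v \<in> V" for v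
    using lmod_homD(1)[OF \<sigma>(1)] lmod_homD(1)[OF G(1)] lmod_homD(1)[OF \<sigma>'] that by (auto simp: V_def)
  have F\<sigma>': "F (\<sigma>' v) = v" if v: "v \<in> V" for v
  proof -
    have "F (\<sigma>' v) = F (\<sigma> v) \<ominus>\<^bsub>P\<^esub> (F (G v) \<ominus>\<^bsub>P\<^esub> F (\<sigma> (F (G v))))"
      unfolding \<sigma>'_def using \<sigma>c v by (simp add: F.f_minus)
    then show ?thesis using \<sigma>(2) \<sigma>c v Vd(7) by (simp add: a_minus_def P.M.r_neg)
  qed
  have \<sigma>'t: "\<sigma>' l = t l" if l: "l \<in> L" for l
  proof -
    have lV: "l \<in> V" using l LV by auto
    have tc: "t l \<in> carrier Q" using tU[OF l] Ud(7) by simp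
    have "F (G l) = l \<ominus>\<^bsub>P\<^esub> l" using G(2)[OF l] \<sigma>(2)[OF lV] t(2)[OF l] \<sigma>c[OF lV] tc by (simp add: F.f_minus)
    then have "F (G l) = \<zero>\<^bsub>P\<^esub>" using Vd(7)[OF lV] by (simp add: a_minus_def P.M.r_neg)
    moreover have "\<sigma> \<zero>\<^bsub>P\<^esub> = \<zero>\<^bsub>Q\<^esub>"
      using lmod_homomorphism.f_zero[OF lmod_homomorphismI[OF VL Q(1) \<sigma>(1)]] by simp
    moreover have "G l \<ominus>\<^bsub>Q\<^esub> \<zero>\<^bsub>Q\<^esub> = G l"
      using Q.add_minus_cancel(1)[of "G l" "\<zero>\<^bsub>Q\<^esub>"] \<sigma>c[OF lV] by simp
    ultimately have "\<sigma>' l = \<sigma> l \<ominus>\<^bsub>Q\<^esub> (\<sigma> l \<ominus>\<^bsub>Q\<^esub> t l)"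
      using G(2)[OF l] by (simp add: \<sigma>'_def)
    also have "\<dots> = (\<sigma> l \<ominus>\<^bsub>Q\<^esub> t l) \<oplus>\<^bsub>Q\<^esub> t l \<ominus>\<^bsub>Q\<^esub> (\<sigma> l \<ominus>\<^bsub>Q\<^esub> t l)" using \<sigma>c[OF lV] tc by simp
    also have "\<dots> = t l" using \<sigma>c[OF lV] tc by (intro Q.add_minus_cancel) auto
    finally show ?thesis .
  qed
  have FQV: "F q \<in> V" if "q \<in> carrier Q" for q using that by (simp add: V_def)
  \<comment> \<open>If \<open>\<rho> q = 0\<close>, then \<open>F q\<close> lies in
    \<open>L\<close>, where \<open>\<sigma>'\<close> agrees with \<open>t\<close> and takes values
    in the kernel of \<open>\<rho>\<close>. The induced map is idempotent since
    \<open>\<sigma>'\<close> is a section of \<open>F\<close>.\<close>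
  have "\<exists>e \<in> lmod_hom R Y Y. \<forall>q \<in> carrier Q. e (\<rho> q) = \<rho> (\<sigma>' (F q))"
  proof (rule \<rho>.factor[OF Y(1) lmod_hom_comp[OF lmod_hom_comp[OF FV \<sigma>'] \<rho>] \<rho>Y])
    fix q assume "q \<in> carrier Q" "\<rho> q = \<zero>\<^bsub>Y\<^esub>"
    then have "F q \<in> L" by (auto simp: L_def U_def)
    then show "\<rho> (\<sigma>' (F q)) = \<zero>\<^bsub>Y\<^esub>" using \<sigma>'t tU by (simp add: U_def)
  qed
  then obtain e where e: "e \<in> lmod_hom R Y Y" "\<And>q. q \<in> carrier Q \<Longrightarrow> e (\<rho> q) = \<rho> (\<sigma>' (F q))" by auto
  have "e (e z) = e z" if "z \<in> carrier Y" for z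
  proof -
    obtain q where q: "q \<in> carrier Q" "z = \<rho> q" using \<open>z \<in> carrier Y\<close> \<rho>Y by blast
    then show ?thesis using e(2) \<sigma>c(4)[OF FQV] F\<sigma>'[OF FQV] by simp
  qed
  from Y.indecomposable_idempotent[OF Y(3) e(1) this]
  have e1: "e z = z" if "z \<in> carrier Y" for z
  proof
    assume z: "\<forall>m\<in>carrier Y. e m = \<zero>\<^bsub>Y\<^esub>"
    obtain q where q: "q \<in> carrier Q" "y0 = \<rho> q" using f(2) \<rho>Y by blast
    \<comment> \<open>The chain \<open>f \<rho> = p F = p F \<sigma>' F = f e \<rho>\<close> shows
      \<open>f e = f\<close>, so \<open>e = 0\<close> would give \<open>f y0 = 0\<close>.\<close>
    have "f y0 = p (F (\<sigma>' (F q)))" using q F(2) F\<sigma>'[OF FQV] by simp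
    also have "\<dots> = f (e y0)" using q e(2) F(2) \<sigma>c(4)[OF FQV] by simp
    finally show ?thesis using z f(2,3) by simp
  qed (use that in auto)
  have pres: "presents (P\<lparr>carrier := V\<rparr>) (\<lambda>v. \<rho> (\<sigma>' v)) Y"
    unfolding presents_def
  proof (intro conjI ballI impI)
    show "left_module R (P\<lparr>carrier := V\<rparr>)" "has_dual_basis R e1 (P\<lparr>carrier := V\<rparr>)" by fact+
    show "top_semisimple (P\<lparr>carrier := V\<rparr>)"
      unfolding top_semisimple_def
    proof (intro allI impI)
      fix W assume W: "submodule W R (P\<lparr>carrier := V\<rparr>)" "gen1 (P\<lparr>carrier := V, carrier := W\<rparr>)"
      then have W': "W \<subseteq> V" "submodule W R P" using P.submodule_trans[OF V] by auto
      obtain r where r: "r \<in> lmod_hom R P P" "\<And>x. x \<in> carrier P \<Longrightarrow> r x \<in> W" "\<And>v. v \<in> W \<Longrightarrow> r v = v"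
        using P(3) W'(2) W(2) unfolding top_semisimple_def by auto
      have "r \<in> lmod_hom R (P\<lparr>carrier := V\<rparr>) (P\<lparr>carrier := V\<rparr>)"
        by (rule lmod_hom_codomain[OF lmod_hom_restrict[OF r(1) Vd(1)]]) (use r(2) W'(1) Vd(1) in auto)
      then show "\<exists>r\<in>lmod_hom R (P\<lparr>carrier := V\<rparr>) (P\<lparr>carrier := V\<rparr>).
          (\<forall>p\<in>carrier (P\<lparr>carrier := V\<rparr>). r p \<in> W) \<and> (\<forall>v\<in>W. r v = v)"
        using r Vd(7) by (intro bexI[of _ r]) auto
    qed
    show "(\<lambda>v. \<rho> (\<sigma>' v)) \<in> lmod_hom R (P\<lparr>carrier := V\<rparr>) Y" by (rule lmod_hom_comp[OF \<sigma>' \<rho>])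
    have "z \<in> (\<lambda>v. \<rho> (\<sigma>' v)) ` V" if "z \<in> carrier Y" for z
    proof -
      obtain q where q: "q \<in> carrier Q" "z = \<rho> q" using \<open>z \<in> carrier Y\<close> \<rho>Y by blast
      then have "z = \<rho> (\<sigma>' (F q))" using e(2) e1[OF \<open>z \<in> carrier Y\<close>] by metis
      then show ?thesis using FQV q by auto
    qed
    then show "(\<lambda>v. \<rho> (\<sigma>' v)) ` carrier (P\<lparr>carrier := V\<rparr>) = carrier Y" using \<sigma>c by auto
    \<comment> \<open>If \<open>\<sigma>' v\<close> lies in \<open>U\<close>, then
      \<open>v = F (\<sigma>' v)\<close> lies in \<open>F U = L\<close>.\<close>
    have ker: "v \<in> L" if "v \<in> V" "\<rho> (\<sigma>' v) = \<zero>\<^bsub>Y\<^esub>" for v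
      using that F\<sigma>'[OF that(1)] \<sigma>c(4) unfolding L_def U_def by (metis (mono_tags, lifting) imageI mem_Collect_eq)
    then have "{v \<in> V. \<rho> (\<sigma>' v) = \<zero>\<^bsub>Y\<^esub>} = L" using \<sigma>'t tU LV by (auto simp: U_def)
    then show "proj R (P\<lparr>carrier := V, carrier := {x \<in> carrier (P\<lparr>carrier := V\<rparr>). \<rho> (\<sigma>' x) = \<zero>\<^bsub>Y\<^esub>}\<rparr>)"
      using Lp by simp
    fix v assume "v \<in> carrier (P\<lparr>carrier := V\<rparr>)" "\<rho> (\<sigma>' v) = \<zero>\<^bsub>Y\<^esub>"
    then have "v \<in> Kr" using ker LKr by auto
    then show "e1 \<odot>\<^bsub>P\<lparr>carrier := V\<rparr>\<^esub> v = \<zero>\<^bsub>P\<lparr>carrier := V\<rparr>\<^esub>" using pe by (simp add: Kr_def)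
  qed
  then show ?thesis by blast
qed

text \<open>A given resolution is reduced twice. The summand of the kernel \<open>W\<close> that is
  generated by its \<open>e1\<close>-part is injective, hence splits off from \<open>P\<close> as
  well; after its removal \<open>e1\<close> kills the kernel. Then the cover is cut down to the
  submodule generated by its \<open>e1\<close>-part, which still maps onto \<open>X\<close>.\<close>

lemma gen1_resolution:
  fixes X :: "('r, 'm) module"
  assumes X: "left_module R X" "gen1 X" and res: "has_projective_resolution R X 1"
  shows "\<exists>(P :: 'r small_module) p. left_module R P \<and> has_dual_basis R e1 P \<and>
    p \<in> lmod_hom R P X \<and> p ` carrier P = carrier X \<and>
    (\<forall>x \<in> carrier P. p x = \<zero>\<^bsub>X\<^esub> \<longrightarrow> e1 \<odot>\<^bsub>P\<^esub> x = \<zero>\<^bsub>P\<^esub>) \<and>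
    proj R (P\<lparr>carrier := {x \<in> carrier P. p x = \<zero>\<^bsub>X\<^esub>}\<rparr>)"
proof -
  interpret X: left_module R X by fact
  obtain P :: "'r small_module" and p where P: "left_module R P" "proj R P" and p: "p \<in> lmod_hom R P X"
    "p ` carrier P = carrier X" and Wp: "proj R (P\<lparr>carrier := {x \<in> carrier P. p x = \<zero>\<^bsub>X\<^esub>}\<rparr>)"
    by (rule resolution_1_proj[OF res X(1)]) (rule that)
  interpret P: left_module R P by fact
  interpret p: lmod_homomorphism R P X p by (rule lmod_homomorphismI[OF P(1) X(1) p(1)])
  define W where "W = {x \<in> carrier P. p x = \<zero>\<^bsub>X\<^esub>}"
  have W: "submodule W R P" unfolding W_def by (rule p.kernel_submodule)
  note Wd = P.submoduleD[OF W]
  have WL: "left_module R (P\<lparr>carrier := W\<rparr>)" by (rule P.submodule_left_module[OF W])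
  interpret W: left_module R "P\<lparr>carrier := W\<rparr>" by fact
  have Wp: "proj R (P\<lparr>carrier := W\<rparr>)" using Wp by (simp add: W_def)
  obtain r where r: "r \<in> lmod_hom R (P\<lparr>carrier := W\<rparr>) (P\<lparr>carrier := W\<rparr>)"
    "\<And>x. x \<in> W \<Longrightarrow> r (r x) = r x" "\<And>x. x \<in> W \<Longrightarrow> e1 \<odot>\<^bsub>P\<^esub> r x = e1 \<odot>\<^bsub>P\<^esub> x"
    "gen1 (P\<lparr>carrier := r ` W\<rparr>)"
    using torsion_decomposition[OF WL W.proj_finitely_generated[OF Wp]] by auto
  interpret r: lmod_homomorphism R "P\<lparr>carrier := W\<rparr>" "P\<lparr>carrier := W\<rparr>" r by (rule lmod_homomorphismI) fact+
  define T where "T = r ` W"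
  have TW: "T \<subseteq> W" using r.f_closed by (auto simp: T_def)
  have T: "submodule T R P"
    using r.image_submodule[OF W.carrier_submodule] P.submodule_trans[OF W] by (simp add: T_def)
  note Td = P.submoduleD[OF T]
  have TL: "left_module R (P\<lparr>carrier := T\<rparr>)" by (rule P.submodule_left_module[OF T])
  have Ti: "(\<lambda>x. x) \<in> lmod_hom R (P\<lparr>carrier := T\<rparr>) (P\<lparr>carrier := W\<rparr>)"
    using TW by (auto simp: lmod_hom_def)
  have rT: "r \<in> lmod_hom R (P\<lparr>carrier := W\<rparr>) (P\<lparr>carrier := T\<rparr>)"
    using lmod_hom_codomain[OF r(1), of T] by (simp add: T_def)
  have "proj R (P\<lparr>carrier := T\<rparr>)"
    by (rule proj_retract[OF WL Wp TL one_closed Ti rT]) (use r(2) in \<open>auto simp: T_def\<close>)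
  then have Tb: "has_dual_basis R e1 (P\<lparr>carrier := T\<rparr>)"
    by (rule proj_gen1_dual_basis[OF TL]) (use r(4) in \<open>simp add: T_def\<close>)
  \<comment> \<open>A retraction of \<open>P\<close> onto \<open>T\<close>: the identity of
    \<open>T\<close> extends to \<open>P\<close> by injectivity of \<open>T\<close>. Its kernel
    \<open>A\<close> is the complement that is kept.\<close>
  obtain F where F: "F \<in> lmod_hom R P (P\<lparr>carrier := T\<rparr>)" "\<And>x. x \<in> T \<Longrightarrow> F x = x"
    using extend_hom[OF TL Tb P(1) T lmod_hom_id] by auto
  have FP: "F \<in> lmod_hom R P P" by (rule lmod_hom_codomainD[OF F(1) Td(1)])
  interpret F: lmod_homomorphism R P P F by (rule lmod_homomorphismI[OF P(1) P(1) FP])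
  have FT: "F x \<in> T" if "x \<in> carrier P" for x using lmod_homD(1)[OF F(1) that] by simp
  define A where "A = {x \<in> carrier P. F x = \<zero>\<^bsub>P\<^esub>}"
  have A: "submodule A R P" unfolding A_def by (rule F.kernel_submodule)
  note Ad = P.submoduleD[OF A]
  have AL: "left_module R (P\<lparr>carrier := A\<rparr>)" by (rule P.submodule_left_module[OF A])
  interpret A: left_module R "P\<lparr>carrier := A\<rparr>" by fact
  define d where "d x = x \<ominus>\<^bsub>P\<^esub> F x" for x
  have d: "d \<in> lmod_hom R P P" unfolding d_def by (intro P.lmod_hom_minus lmod_hom_id FP)
  have dA: "d x \<in> A" if "x \<in> carrier P" for x
    using that F(2)[OF FT[OF that]] by (simp add: d_def A_def F.f_minus)
  have dfix: "d x = x" if "x \<in> A" for x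
    using P.add_minus_cancel(1)[of x "\<zero>\<^bsub>P\<^esub>"] that by (simp add: d_def A_def)
  have pd: "p (d x) = p x" if "x \<in> carrier P" for x
  proof -
    have "p (F x) = \<zero>\<^bsub>X\<^esub>" using FT[OF that] TW by (auto simp: W_def)
    then show ?thesis using that X.add_minus_cancel(1)[of "p x" "\<zero>\<^bsub>X\<^esub>"] by (simp add: d_def p.f_minus)
  qed
  have Ai: "(\<lambda>x. x) \<in> lmod_hom R (P\<lparr>carrier := A\<rparr>) P" by (rule lmod_hom_restrict[OF lmod_hom_id Ad(1)])
  have Ap: "proj R (P\<lparr>carrier := A\<rparr>)"
    by (rule proj_retract[OF P AL one_closed Ai lmod_hom_codomain[OF d dA]]) (use dfix in auto)
  have pA: "p ` A = carrier X"
  proof (intro equalityI image_subsetI subsetI)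
    fix x assume "x \<in> carrier X"
    then obtain a where "a \<in> carrier P" "x = p a" using p(2) by blast
    then show "x \<in> p ` A" using dA pd by (intro image_eqI[of _ _ "d a"]) simp_all
  qed (use Ad(7) in simp)
  \<comment> \<open>The kernel of \<open>p\<close> on \<open>A\<close>. As \<open>d\<close> moves
    elements of \<open>W\<close> only by elements of \<open>T\<close>, which lies in
    \<open>W\<close>, it retracts \<open>W\<close> onto \<open>L\<close>.\<close>
  define L where "L = W \<inter> A"
  have L: "submodule L R P" unfolding L_def by (rule P.submodule_Int[OF W A])
  note Ld = P.submoduleD[OF L]
  have LL: "left_module R (P\<lparr>carrier := L\<rparr>)" by (rule P.submodule_left_module[OF L])
  have Lp: "proj R (P\<lparr>carrier := L\<rparr>)"
  proof (rule proj_retract[OF WL Wp LL one_closed])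
    show "(\<lambda>x. x) \<in> lmod_hom R (P\<lparr>carrier := L\<rparr>) (P\<lparr>carrier := W\<rparr>)" by (auto simp: lmod_hom_def L_def)
    have "d x \<in> L" if "x \<in> W" for x
      using dA pd Wd(7)[OF that] that Ad(7)[OF dA] by (simp add: L_def W_def)
    then show "d \<in> lmod_hom R (P\<lparr>carrier := W\<rparr>) (P\<lparr>carrier := L\<rparr>)"
      using lmod_hom_codomain[OF lmod_hom_restrict[OF d Wd(1)], of L] by simp
  qed (use dfix in \<open>simp add: L_def\<close>)
  \<comment> \<open>For \<open>w\<close> in \<open>W\<close> the element
    \<open>e1 w = e1 r w\<close> lies in \<open>T\<close>, which \<open>F\<close> fixes; for
    \<open>w\<close> in \<open>A\<close> it is also killed by \<open>F\<close>.\<close>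
  have Le: "e1 \<odot>\<^bsub>P\<^esub> w = \<zero>\<^bsub>P\<^esub>" if "w \<in> L" for w
  proof -
    have w: "w \<in> W" "w \<in> A" "w \<in> carrier P" using that Ld(7) by (auto simp: L_def)
    have "r w \<in> T" using w by (simp add: T_def)
    then have "e1 \<odot>\<^bsub>P\<^esub> w \<in> T" using r(3)[OF w(1)] Td(4)[of e1 "r w"] by simp
    then have "e1 \<odot>\<^bsub>P\<^esub> w = F (e1 \<odot>\<^bsub>P\<^esub> w)" using F(2) by simp
    then show ?thesis using w by (simp add: F.f_smult A_def)
  qed
  obtain s where s: "s \<in> lmod_hom R (P\<lparr>carrier := A\<rparr>) (P\<lparr>carrier := A\<rparr>)"
    "\<And>x. x \<in> A \<Longrightarrow> s (s x) = s x" "\<And>x. x \<in> A \<Longrightarrow> e1 \<odot>\<^bsub>P\<^esub> s x = e1 \<odot>\<^bsub>P\<^esub> x"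
    "gen1 (P\<lparr>carrier := s ` A\<rparr>)"
    using torsion_decomposition[OF AL A.proj_finitely_generated[OF Ap]] by auto
  interpret s: lmod_homomorphism R "P\<lparr>carrier := A\<rparr>" "P\<lparr>carrier := A\<rparr>" s by (rule lmod_homomorphismI) fact+
  define B where "B = s ` A"
  have BA: "B \<subseteq> A" using s.f_closed by (auto simp: B_def)
  have B: "submodule B R P"
    using s.image_submodule[OF A.carrier_submodule] P.submodule_trans[OF A] by (simp add: B_def)
  note Bd = P.submoduleD[OF B]
  have BL: "left_module R (P\<lparr>carrier := B\<rparr>)" by (rule P.submodule_left_module[OF B])
  have Bi: "(\<lambda>x. x) \<in> lmod_hom R (P\<lparr>carrier := B\<rparr>) (P\<lparr>carrier := A\<rparr>)"
    using BA by (auto simp: lmod_hom_def)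
  have sB: "s \<in> lmod_hom R (P\<lparr>carrier := A\<rparr>) (P\<lparr>carrier := B\<rparr>)"
    using lmod_hom_codomain[OF s(1), of B] by (simp add: B_def)
  have "proj R (P\<lparr>carrier := B\<rparr>)"
    by (rule proj_retract[OF AL Ap BL one_closed Bi sB]) (use s(2) in \<open>auto simp: B_def\<close>)
  then have Bb: "has_dual_basis R e1 (P\<lparr>carrier := B\<rparr>)"
    by (rule proj_gen1_dual_basis[OF BL]) (use s(4) in \<open>simp add: B_def\<close>)
  \<comment> \<open>\<open>X\<close> is generated by \<open>e1 X\<close>, and \<open>e1 A\<close> is
    contained in \<open>B\<close> because \<open>e1 s a = e1 a\<close>.\<close>
  have pB: "p ` B = carrier X"
  proof (rule gen1D[OF X(2) p.image_submodule[OF B]])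
    fix x assume "x \<in> carrier X"
    then obtain a where a: "a \<in> A" "x = p a" using pA by blast
    have "s a \<in> B" using a by (simp add: B_def)
    then have "e1 \<odot>\<^bsub>P\<^esub> a \<in> B" using s(3)[OF a(1)] Bd(4)[of e1 "s a"] by simp
    then show "e1 \<odot>\<^bsub>X\<^esub> x \<in> p ` B"
      using a Ad(7) by (intro image_eqI[of _ _ "e1 \<odot>\<^bsub>P\<^esub> a"]) (simp_all add: p.f_smult)
  qed
  have ker: "{x \<in> B. p x = \<zero>\<^bsub>X\<^esub>} = L \<inter> B" using BA Bd(7) by (auto simp: L_def W_def)
  have "proj R (P\<lparr>carrier := L \<inter> B\<rparr>)"
    using submodule_proj[OF LL Lp, of "L \<inter> B"] Le P.submodule_trans[OF L, of "L \<inter> B"]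
      P.submodule_Int[OF L B] by simp
  then have "left_module R (P\<lparr>carrier := B\<rparr>) \<and> has_dual_basis R e1 (P\<lparr>carrier := B\<rparr>) \<and>
    p \<in> lmod_hom R (P\<lparr>carrier := B\<rparr>) X \<and> p ` carrier (P\<lparr>carrier := B\<rparr>) = carrier X \<and>
    (\<forall>x \<in> carrier (P\<lparr>carrier := B\<rparr>). p x = \<zero>\<^bsub>X\<^esub> \<longrightarrow> e1 \<odot>\<^bsub>P\<lparr>carrier := B\<rparr>\<^esub> x = \<zero>\<^bsub>P\<lparr>carrier := B\<rparr>\<^esub>) \<and>
    proj R (P\<lparr>carrier := B, carrier := {x \<in> carrier (P\<lparr>carrier := B\<rparr>). p x = \<zero>\<^bsub>X\<^esub>}\<rparr>)"
    using BL Bb lmod_hom_restrict[OF p(1) Bd(1)] pB ker Le by auto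
  then show ?thesis by blast
qed

text \<open>A maximal essential extension of \<open>p\<^sup>-\<^sup>1(0)\<close> in the injective module \<open>P\<close> is a direct summand.\<close>

lemma kernel_essential:
  fixes X :: "('r, 'm) module"
  assumes X: "left_module R X" "indecomposable R X" "\<not> proj R X"
    and P: "left_module R P" "has_dual_basis R e1 P"
    and p: "p \<in> lmod_hom R P X" "p ` carrier P = carrier X"
    and x: "x \<in> carrier P" "x \<noteq> \<zero>\<^bsub>P\<^esub>"
  shows "\<exists>a \<in> carrier R. p (a \<odot>\<^bsub>P\<^esub> x) = \<zero>\<^bsub>X\<^esub> \<and> a \<odot>\<^bsub>P\<^esub> x \<noteq> \<zero>\<^bsub>P\<^esub>"
proof -
  interpret X: left_module R X by fact
  interpret P: left_module R P by fact
  interpret p: lmod_homomorphism R P X p by (rule lmod_homomorphismI[OF P(1) X(1) p(1)])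
  define L where "L = {x \<in> carrier P. p x = \<zero>\<^bsub>X\<^esub>}"
  have L: "submodule L R P" unfolding L_def by (rule p.kernel_submodule)
  \<comment> \<open>Extensions of \<open>L\<close> in which \<open>L\<close> is essential: every
    nonzero element has a nonzero multiple in \<open>L\<close>.\<close>
  define \<A> where "\<A> = {E. submodule E R P \<and> L \<subseteq> E \<and>
    (\<forall>x \<in> E. x \<noteq> \<zero>\<^bsub>P\<^esub> \<longrightarrow> (\<exists>a \<in> carrier R. a \<odot>\<^bsub>P\<^esub> x \<in> L \<and> a \<odot>\<^bsub>P\<^esub> x \<noteq> \<zero>\<^bsub>P\<^esub>))}"
  have "\<exists>a \<in> carrier R. a \<odot>\<^bsub>P\<^esub> x \<in> L \<and> a \<odot>\<^bsub>P\<^esub> x \<noteq> \<zero>\<^bsub>P\<^esub>" if "x \<in> L" "x \<noteq> \<zero>\<^bsub>P\<^esub>" for x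
    using that P.submoduleD(7)[OF L] by (intro bexI[of _ \<one>]) auto
  then have "L \<in> \<A>" using L by (auto simp: \<A>_def)
  moreover have "\<Union>C \<in> \<A>" if C: "C \<noteq> {}" "subset.chain \<A> C" for C
  proof -
    have CA: "E \<in> \<A>" if "E \<in> C" for E using C that by (auto simp: subset.chain_def)
    have "submodule (\<Union>C) R P" by (rule P.submodule_Union_chain[OF C]) (simp add: \<A>_def)
    moreover have "L \<subseteq> \<Union>C" using C(1) CA by (auto simp: \<A>_def)
    ultimately show ?thesis using CA by (auto simp: \<A>_def)
  qed
  ultimately have "\<exists>E\<in>\<A>. \<forall>X\<in>\<A>. E \<subseteq> X \<longrightarrow> X = E"
    using subset_Zorn_nonempty[of \<A>] by blast
  then obtain E where EA: "E \<in> \<A>" and Emax: "\<And>E'. E' \<in> \<A> \<Longrightarrow> E \<subseteq> E' \<Longrightarrow> E' = E" by auto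
  have E: "submodule E R P" "L \<subseteq> E"
    and Eess: "\<And>x. x \<in> E \<Longrightarrow> x \<noteq> \<zero>\<^bsub>P\<^esub> \<Longrightarrow> \<exists>a \<in> carrier R. a \<odot>\<^bsub>P\<^esub> x \<in> L \<and> a \<odot>\<^bsub>P\<^esub> x \<noteq> \<zero>\<^bsub>P\<^esub>"
    using EA by (auto simp: \<A>_def)
  note Ed = P.submoduleD[OF E(1)]
  \<comment> \<open>A maximal complement of \<open>E\<close>. That \<open>E + D\<close> exhausts
    \<open>P\<close> comes from injectivity, through an extension \<open>g\<close> of the projection
    of \<open>E + D\<close> onto \<open>E\<close>.\<close>
  obtain D where D: "submodule D R P" "E \<inter> D = {\<zero>\<^bsub>P\<^esub>}"
    and Dmax: "\<And>D'. submodule D' R P \<Longrightarrow> D \<subseteq> D' \<Longrightarrow> E \<inter> D' = {\<zero>\<^bsub>P\<^esub>} \<Longrightarrow> D' = D"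
    using P.maximal_relative_complement[OF P.zero_submodule, of E] Ed(2) by auto
  note Dd = P.submoduleD[OF D(1)]
  define S where "S = E <+>\<^bsub>P\<^esub> D"
  have S: "submodule S R P" "E \<subseteq> S" "D \<subseteq> S" unfolding S_def using P.submodule_set_add[OF E(1) D(1)] by auto
  have SL: "left_module R (P\<lparr>carrier := S\<rparr>)" by (rule P.submodule_left_module[OF S(1)])
  interpret S: left_module R "P\<lparr>carrier := S\<rparr>" by fact
  have SED: "submodule E R (P\<lparr>carrier := S\<rparr>)" "submodule D R (P\<lparr>carrier := S\<rparr>)"
    using P.submodule_trans[OF S(1)] E(1) D(1) S(2,3) by auto
  have SD: "E <+>\<^bsub>P\<lparr>carrier := S\<rparr>\<^esub> D = carrier (P\<lparr>carrier := S\<rparr>)"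
    "E \<inter> D = {\<zero>\<^bsub>P\<lparr>carrier := S\<rparr>\<^esub>}"
    using D(2) by (simp_all add: S_def set_add_def set_mult_def)
  obtain \<rho> where \<rho>': "\<rho> \<in> lmod_hom R (P\<lparr>carrier := S\<rparr>) (P\<lparr>carrier := S\<rparr>)"
    "\<And>m. m \<in> carrier (P\<lparr>carrier := S\<rparr>) \<Longrightarrow> \<rho> m \<in> E"
    "\<And>m. m \<in> carrier (P\<lparr>carrier := S\<rparr>) \<Longrightarrow> m \<ominus>\<^bsub>P\<lparr>carrier := S\<rparr>\<^esub> \<rho> m \<in> D"
    "\<And>x. x \<in> E \<Longrightarrow> \<rho> x = x" "\<And>x. x \<in> D \<Longrightarrow> \<rho> x = \<zero>\<^bsub>P\<lparr>carrier := S\<rparr>\<^esub>"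
    by (rule S.direct_sum_projection[OF SED SD]) (rule that)
  then have \<rho>: "\<rho> \<in> lmod_hom R (P\<lparr>carrier := S\<rparr>) (P\<lparr>carrier := S\<rparr>)"
    "\<And>x. x \<in> E \<Longrightarrow> \<rho> x = x" "\<And>x. x \<in> D \<Longrightarrow> \<rho> x = \<zero>\<^bsub>P\<^esub>" by simp_all
  obtain g where g: "g \<in> lmod_hom R P P" "\<And>x. x \<in> S \<Longrightarrow> g x = \<rho> x"
    using extend_hom[OF P P(1) S(1) lmod_hom_codomainD[OF \<rho>(1) P.submoduleD(1)[OF S(1)]]] by auto
  interpret g: lmod_homomorphism R P P g by (rule lmod_homomorphismI[OF P(1) P(1) g(1)])
  have gE: "g x = x" if "x \<in> E" for x using g(2) \<rho>(2) S(2) that by auto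
  have gD: "g x = \<zero>\<^bsub>P\<^esub>" if "x \<in> D" for x using g(2) \<rho>(3) S(3) that by auto
  have ker: "{x \<in> carrier P. g x = \<zero>\<^bsub>P\<^esub>} = D"
  proof (rule Dmax[OF g.kernel_submodule])
    show "D \<subseteq> {x \<in> carrier P. g x = \<zero>\<^bsub>P\<^esub>}" using gD Dd(7) by auto
    show "E \<inter> {x \<in> carrier P. g x = \<zero>\<^bsub>P\<^esub>} = {\<zero>\<^bsub>P\<^esub>}" using gE Ed(2) by auto
  qed
  have im: "g ` carrier P = E"
  proof (rule Emax)
    \<comment> \<open>When \<open>g x\<close> is nonzero, \<open>D + R x\<close> is larger than
      \<open>D\<close> and therefore meets \<open>E\<close>; applying \<open>g\<close> to a nonzero
      common element exhibits it as a multiple of \<open>g x\<close>. So \<open>L\<close> is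
      essential in the image of \<open>g\<close>, and the maximality of \<open>E\<close>
      applies.\<close>
    have 1: "\<exists>a \<in> carrier R. a \<odot>\<^bsub>P\<^esub> g x \<in> L \<and> a \<odot>\<^bsub>P\<^esub> g x \<noteq> \<zero>\<^bsub>P\<^esub>"
      if x: "x \<in> carrier P" "g x \<noteq> \<zero>\<^bsub>P\<^esub>" for x
    proof -
      define O1 where "O1 = (\<lambda>a. a \<odot>\<^bsub>P\<^esub> x) ` carrier R"
      have h: "(\<lambda>a. a \<odot>\<^bsub>P\<^esub> x) \<in> lmod_hom R (regular_module R) P"
        by (rule P.lmod_hom_smult_fixed) (use x lmod_hom_id in auto)
      interpret h: lmod_homomorphism R "regular_module R" P "\<lambda>a. a \<odot>\<^bsub>P\<^esub> x"
        by (rule lmod_homomorphismI[OF regular_left_module P(1) h])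
      have O1: "submodule O1 R P" unfolding O1_def using h.image_submodule[OF h.M.carrier_submodule] by simp
      have xO: "x \<in> O1" unfolding O1_def using x by (intro image_eqI[of _ _ \<one>]) simp_all
      note DO = P.submodule_set_add[OF D(1) O1]
      have "D <+>\<^bsub>P\<^esub> O1 \<noteq> D" using xO DO(3) gD x by auto
      then have "E \<inter> (D <+>\<^bsub>P\<^esub> O1) \<noteq> {\<zero>\<^bsub>P\<^esub>}" using Dmax DO by blast
      then obtain y where y: "y \<in> E" "y \<in> D <+>\<^bsub>P\<^esub> O1" "y \<noteq> \<zero>\<^bsub>P\<^esub>"
        using Ed(2) P.submoduleD(2)[OF DO(1)] by auto
      then obtain d a where da: "d \<in> D" "a \<in> carrier R" "y = d \<oplus>\<^bsub>P\<^esub> a \<odot>\<^bsub>P\<^esub> x"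
        by (auto simp: P.set_add_iff O1_def)
      have "y = g d \<oplus>\<^bsub>P\<^esub> a \<odot>\<^bsub>P\<^esub> g x"
        using gE[OF y(1)] da Dd(7) x by (simp add: g.f_add g.f_smult)
      then have ya: "y = a \<odot>\<^bsub>P\<^esub> g x" using gD da x by simp
      obtain b where b: "b \<in> carrier R" "b \<odot>\<^bsub>P\<^esub> y \<in> L" "b \<odot>\<^bsub>P\<^esub> y \<noteq> \<zero>\<^bsub>P\<^esub>" using Eess y by blast
      then show ?thesis using ya da x by (intro bexI[of _ "b \<otimes> a"]) (simp_all add: P.smult_assoc1)
    qed
    show Eg: "E \<subseteq> g ` carrier P"
    proof
      fix y assume "y \<in> E"
      then show "y \<in> g ` carrier P" using gE Ed(7) by (intro image_eqI[of _ _ y]) auto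
    qed
    show "g ` carrier P \<in> \<A>"
      using 1 Eg E(2) g.image_submodule[OF P.carrier_submodule] by (auto simp: \<A>_def)
  qed
  have gg: "g (g x) = g x" if "x \<in> carrier P" for x using gE im that by auto
  \<comment> \<open>\<open>g\<close> fixes \<open>L\<close>, so it induces an idempotent of
    \<open>X\<close>.\<close>
  have "\<exists>e \<in> lmod_hom R X X. \<forall>x \<in> carrier P. e (p x) = p (g x)"
  proof (rule p.factor[OF X(1) lmod_hom_comp[OF g(1) p(1)] p(2)])
    fix x assume x: "x \<in> carrier P" "p x = \<zero>\<^bsub>X\<^esub>"
    then have "x \<in> E" using E(2) by (auto simp: L_def)
    then show "p (g x) = \<zero>\<^bsub>X\<^esub>" using gE x by simp
  qed
  then obtain e where e: "e \<in> lmod_hom R X X" "\<And>x. x \<in> carrier P \<Longrightarrow> e (p x) = p (g x)" by auto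
  have "e (e z) = e z" if "z \<in> carrier X" for z
  proof -
    obtain x where "x \<in> carrier P" "z = p x" using \<open>z \<in> carrier X\<close> p(2) by blast
    then show ?thesis using e(2) gg by simp
  qed
  from X.indecomposable_idempotent[OF X(2) e(1) this]
  have ez: "e z = z" if "z \<in> carrier X" for z
  proof
    assume z: "\<forall>m\<in>carrier X. e m = \<zero>\<^bsub>X\<^esub>"
    have d: "(\<lambda>x. x \<ominus>\<^bsub>P\<^esub> g x) \<in> lmod_hom R P P" by (intro P.lmod_hom_minus lmod_hom_id g)
    \<comment> \<open>If that idempotent vanishes, \<open>x \<mapsto> x - g x\<close> induces a
      section of \<open>p\<close>, and \<open>X\<close> would be projective.\<close>
    have "\<exists>h \<in> lmod_hom R X P. \<forall>x \<in> carrier P. h (p x) = x \<ominus>\<^bsub>P\<^esub> g x"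
    proof (rule p.factor[OF P(1) d p(2)])
      fix x assume x: "x \<in> carrier P" "p x = \<zero>\<^bsub>X\<^esub>"
      then have "x \<in> E" using E(2) by (auto simp: L_def)
      then show "x \<ominus>\<^bsub>P\<^esub> g x = \<zero>\<^bsub>P\<^esub>" using gE x by simp
    qed
    then obtain h where h: "h \<in> lmod_hom R X P" "\<And>x. x \<in> carrier P \<Longrightarrow> h (p x) = x \<ominus>\<^bsub>P\<^esub> g x" by auto
    have "p (h z) = z" if "z \<in> carrier X" for z
    proof -
      obtain x where x: "x \<in> carrier P" "z = p x" using \<open>z \<in> carrier X\<close> p(2) by blast
      have "p (g x) = \<zero>\<^bsub>X\<^esub>" using e(2)[OF x(1)] z x by simp
      then show ?thesis using h(2)[OF x(1)] x X.add_minus_cancel(1)[of "p x" "\<zero>\<^bsub>X\<^esub>"] by (simp add: p.f_minus)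
    qed
    then have "proj R X"
      by (rule proj_retract[OF P(1) P.has_dual_basis_proj[OF P(2)] X(1) one_closed h(1) p(1)])
    then show ?thesis using X(3) by simp
  qed (use that in auto)
  \<comment> \<open>If the idempotent is the identity, \<open>x - g x\<close> lies in
    \<open>L\<close>; it is then fixed by \<open>g\<close> and also killed by \<open>g\<close>, so
    \<open>x = g x\<close> lies in the image \<open>E\<close>.\<close>
  have "x \<in> E"
  proof -
    have "p (g x) = p x" using ez e(2) x by simp
    then have "x \<ominus>\<^bsub>P\<^esub> g x \<in> L" using x by (simp add: L_def p.f_minus)
    then have "x \<ominus>\<^bsub>P\<^esub> g x = g (x \<ominus>\<^bsub>P\<^esub> g x)" using gE E(2) by auto
    also have "\<dots> = \<zero>\<^bsub>P\<^esub>" using x gg by (simp add: g.f_minus)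
    finally have "x = g x" using x by simp
    then show ?thesis using im x by blast
  qed
  then show ?thesis using Eess[of x] x by (auto simp: L_def)
qed

section \<open>The \<open>e2\<close>-part and the semisimplicity of \<open>e1 P\<close>\<close>

lemma e2_part_submodule:
  assumes P: "left_module R P"
  shows "submodule {x \<in> carrier P. e1 \<odot>\<^bsub>P\<^esub> x = \<zero>\<^bsub>P\<^esub>} R P"
proof -
  interpret P: left_module R P by fact
  show ?thesis
  proof (rule P.submoduleI)
    fix a x assume *: "a \<in> carrier R" "x \<in> {x \<in> carrier P. e1 \<odot>\<^bsub>P\<^esub> x = \<zero>\<^bsub>P\<^esub>}"
    \<comment> \<open>Triangularity in the form \<open>e1 a = e1 a e1\<close> brings
      \<open>e1\<close> next to \<open>x\<close>.\<close>
    then have "e1 \<odot>\<^bsub>P\<^esub> (a \<odot>\<^bsub>P\<^esub> x) = (e1 \<otimes> a \<otimes> e1) \<odot>\<^bsub>P\<^esub> x"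
      by (simp add: P.smult_assoc1[symmetric] e1_right)
    also have "\<dots> = (e1 \<otimes> a) \<odot>\<^bsub>P\<^esub> (e1 \<odot>\<^bsub>P\<^esub> x)" using * by (simp add: P.smult_assoc1)
    finally show "a \<odot>\<^bsub>P\<^esub> x \<in> {x \<in> carrier P. e1 \<odot>\<^bsub>P\<^esub> x = \<zero>\<^bsub>P\<^esub>}" using * by simp
  qed (auto simp: P.smult_r_distr)
qed

text \<open>A semilinear map \<open>e1 P \<rightarrow> e2 P\<close> along \<open>\<tau>\<close>, extended by zero to \<open>P\<close>: with \<open>\<psi>\<^sub>a \<in> D(e1 R e1)\<close> given by
  \<open>\<psi>\<^sub>a(h) = \<Theta>(h a)\<close> for a functional \<open>\<Theta>\<close> vanishing on \<open>N\<close>, it is \<open>a \<mapsto> \<psi>\<^sub>a p\<close>.\<close>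

lemma shift_map:
  assumes P: "left_module R P" "has_dual_basis R e1 P"
    and N: "submodule N R P" "{x \<in> carrier P. e1 \<odot>\<^bsub>P\<^esub> x = \<zero>\<^bsub>P\<^esub>} \<subseteq> N" "N \<noteq> carrier P"
  shows "\<exists>\<mu>. (\<forall>a \<in> carrier P. \<mu> a \<in> carrier P \<and> e2 \<odot>\<^bsub>P\<^esub> \<mu> a = \<mu> a) \<and>
    (\<forall>a \<in> carrier P. \<forall>b \<in> carrier P. \<mu> (a \<oplus>\<^bsub>P\<^esub> b) = \<mu> a \<oplus>\<^bsub>P\<^esub> \<mu> b) \<and>
    (\<forall>r \<in> carrier R. \<forall>a \<in> carrier P. \<mu> (r \<odot>\<^bsub>P\<^esub> a) = \<tau> (e1 \<otimes> r) \<odot>\<^bsub>P\<^esub> \<mu> a) \<and>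
    (\<forall>a \<in> N. \<mu> a = \<zero>\<^bsub>P\<^esub>) \<and> (\<exists>a \<in> carrier P. \<mu> a \<noteq> \<zero>\<^bsub>P\<^esub>)"
proof -
  interpret P: left_module R P by fact
  note Nd = P.submoduleD[OF N(1)]
  obtain n x \<phi> where *: "\<And>j. j < n \<Longrightarrow> x j \<in> carrier P" "\<And>j. j < n \<Longrightarrow> e1 \<odot>\<^bsub>P\<^esub> x j = x j"
    "\<And>j. j < n \<Longrightarrow> \<phi> j \<in> lmod_hom R P (regular_module R)"
    "\<And>j p. j < n \<Longrightarrow> p \<in> carrier P \<Longrightarrow> \<phi> j p \<otimes> e1 = \<phi> j p"
    "\<And>p. p \<in> carrier P \<Longrightarrow> comb P n x (\<lambda>j. \<phi> j p) = p"
    by (rule has_dual_basisE[OF P(2)]) (rule that)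
  note \<phi>D = lmod_homD[OF *(3), simplified]
  have e2N: "e2 \<odot>\<^bsub>P\<^esub> a \<in> N" if "a \<in> carrier P" for a
    using N(2) that by (auto simp: P.smult_assoc1[symmetric])
  obtain p0 where p0: "p0 \<in> carrier P" "p0 \<notin> N" using N(3) Nd(1) by auto
  define p where "p = e1 \<odot>\<^bsub>P\<^esub> p0"
  have p: "p \<in> carrier P" "e1 \<odot>\<^bsub>P\<^esub> p = p" using p0 by (simp_all add: p_def P.smult_assoc1[symmetric])
  have pN: "p \<notin> N"
  proof
    assume "p \<in> N"
    then have "p \<oplus>\<^bsub>P\<^esub> e2 \<odot>\<^bsub>P\<^esub> p0 \<in> N" using Nd(3) e2N p0 by simp
    then show False using mod_decomp[OF P(1) p0(1)] p0(2) by (simp add: p_def)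
  qed
  \<comment> \<open>\<open>p\<close> is the sum of the \<open>\<phi> j p \<odot> x j\<close>, so one
    summand lies outside \<open>N\<close>; it will make the final map nonzero.\<close>
  have "\<exists>j<n. \<phi> j p \<odot>\<^bsub>P\<^esub> x j \<notin> N"
  proof (rule ccontr)
    assume "\<not> ?thesis"
    then have "comb P n x (\<lambda>j. \<phi> j p) \<in> N" unfolding comb_def by (intro P.submodule_msum N(1)) auto
    then show False using *(5) p pN by simp
  qed
  then obtain j where j: "j < n" "\<phi> j p \<odot>\<^bsub>P\<^esub> x j \<notin> N" by blast
  define h0 where "h0 = \<phi> j p"
  have h0: "h0 \<in> carrier R" "e1 \<otimes> h0 = h0"
    using \<phi>D(1)[OF j(1) p(1)] \<phi>D(3)[OF j(1) e_closed(1) p(1)] p by (simp_all add: h0_def)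
  interpret V: vector_space_mod K "restrict_scalars \<iota> P" by (rule restrict_vector_space[OF P(1)])
  \<comment> \<open>A functional that vanishes on \<open>N\<close> but not on the summand just
    found.\<close>
  obtain \<Theta> where \<Theta>: "\<Theta> \<in> lmod_hom K (restrict_scalars \<iota> P) (regular_module K)"
    "\<And>n. n \<in> N \<Longrightarrow> \<Theta> n = \<zero>\<^bsub>K\<^esub>" "\<Theta> (h0 \<odot>\<^bsub>P\<^esub> x j) \<noteq> \<zero>\<^bsub>K\<^esub>"
    by (rule V.separating_functional[OF restrict_submodule[OF P(1) N(1)], of "h0 \<odot>\<^bsub>P\<^esub> x j"])
      (use j h0 *(1) that in \<open>auto simp: h0_def\<close>)
  note \<Theta>D = lmod_homD[OF \<Theta>(1), simplified]
  interpret l: lmod_homomorphism K "restrict_scalars \<iota> (regular_module R)" "regular_module K" lam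
    by (rule lam_hom)
  \<comment> \<open>Under the duality of \<open>e2 R e1\<close> with \<open>e1 R e1\<close>, the
    element \<open>s\<close> is the functional \<open>h \<mapsto> \<Theta> (h a)\<close>.\<close>
  define rep where "rep a s \<longleftrightarrow> s \<in> carrier R \<and> e2 \<otimes> s = s \<and> s \<otimes> e1 = s \<and>
    (\<forall>h \<in> carrier R. e1 \<otimes> h = h \<longrightarrow> lam (s \<otimes> h) = \<Theta> (h \<odot>\<^bsub>P\<^esub> a))" for a s
  have ex: "\<exists>s. rep a s" if "a \<in> carrier P" for a
    using dual_surj[OF orbit_functional[OF P(1) that \<Theta>(1)]] unfolding rep_def by blast
  have uniq: "s = t" if "rep a s" "rep a t" for a s t
  proof -
    have st: "s \<in> carrier R" "t \<in> carrier R" "s \<otimes> e1 = s" "t \<otimes> e1 = t" "e2 \<otimes> s = s" "e2 \<otimes> t = t"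
      using that by (auto simp: rep_def)
    have "s \<ominus> t = \<zero>"
    proof (rule dual_inj)
      show "s \<ominus> t \<in> carrier R" using st by simp
      show "(s \<ominus> t) \<otimes> e1 = s \<ominus> t" using st by (simp add: a_minus_def l_distr l_minus)
      show "e2 \<otimes> (s \<ominus> t) = s \<ominus> t" using st by (simp add: a_minus_def r_distr r_minus)
      fix h assume h: "h \<in> carrier R" "e1 \<otimes> h = h"
      have "s \<otimes> h = (s \<ominus> t) \<otimes> h \<oplus> t \<otimes> h"
        using st h by (simp add: a_minus_def l_distr l_minus a_assoc l_neg)
      moreover have "lam (s \<otimes> h) = lam (t \<otimes> h)" using that h by (simp add: rep_def)
      ultimately have "lam (t \<otimes> h) = lam ((s \<ominus> t) \<otimes> h) \<oplus>\<^bsub>K\<^esub> lam (t \<otimes> h)"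
        using l.f_add[of "(s \<ominus> t) \<otimes> h" "t \<otimes> h"] st h by simp
      then show "lam ((s \<ominus> t) \<otimes> h) = \<zero>\<^bsub>K\<^esub>"
        using l.f_closed[of "t \<otimes> h"] l.f_closed[of "(s \<ominus> t) \<otimes> h"] st h
        by (metis V.R.add.r_cancel_one' m_closed minus_closed regular_module_simps(1) restrict_scalars_simps(1))
    qed
    then show ?thesis using st by simp
  qed
  define \<psi> where "\<psi> a = (SOME s. rep a s)" for a
  have \<psi>: "rep a (\<psi> a)" if "a \<in> carrier P" for a
    unfolding \<psi>_def using someI_ex[OF ex[OF that]] .
  have \<psi>c: "\<psi> a \<in> carrier R" "e2 \<otimes> \<psi> a = \<psi> a" "\<psi> a \<otimes> e1 = \<psi> a"
    "\<And>h. h \<in> carrier R \<Longrightarrow> e1 \<otimes> h = h \<Longrightarrow> lam (\<psi> a \<otimes> h) = \<Theta> (h \<odot>\<^bsub>P\<^esub> a)"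
    if "a \<in> carrier P" for a
    using \<psi>[OF that] by (auto simp: rep_def)
  have \<psi>_add: "\<psi> (a \<oplus>\<^bsub>P\<^esub> b) = \<psi> a \<oplus> \<psi> b" if ab: "a \<in> carrier P" "b \<in> carrier P" for a b
  proof (rule uniq[OF \<psi>])
    show "rep (a \<oplus>\<^bsub>P\<^esub> b) (\<psi> a \<oplus> \<psi> b)"
      using \<psi>c[OF ab(1)] \<psi>c[OF ab(2)] ab l.f_add
      by (simp add: rep_def l_distr r_distr P.smult_r_distr \<Theta>D)
  qed (use ab in simp)
  have \<psi>_N: "\<psi> a = \<zero>" if "a \<in> N" for a
  proof (rule uniq[OF \<psi>])
    have "lam \<zero> = \<zero>\<^bsub>K\<^esub>" using l.f_zero by simp
    then show "rep a \<zero>" using that Nd(4) \<Theta>(2) by (simp add: rep_def)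
  qed (use that Nd(7) in simp)
  have \<psi>_smult: "\<psi> (r \<odot>\<^bsub>P\<^esub> a) = \<tau> (e1 \<otimes> r) \<otimes> \<psi> a" if ra: "r \<in> carrier R" "a \<in> carrier P" for r a
  proof -
    define h where "h = e1 \<otimes> r"
    have h: "h \<in> carrier R" "e1 \<otimes> h = h" using ra by (simp_all add: h_def)
    have \<tau>h: "\<tau> h \<in> carrier R" "\<tau> h \<otimes> e2 = \<tau> h" using \<tau>_closed[OF h] by auto
    then have \<tau>h2: "e2 \<otimes> \<tau> h = \<tau> h" using e2_left[of "\<tau> h"] by simp
    have "\<psi> (h \<odot>\<^bsub>P\<^esub> a) = \<tau> h \<otimes> \<psi> a"
    proof (rule uniq[OF \<psi>])
      have "lam (\<tau> h \<otimes> \<psi> a \<otimes> k) = \<Theta> (k \<odot>\<^bsub>P\<^esub> (h \<odot>\<^bsub>P\<^esub> a))" if k: "k \<in> carrier R" "e1 \<otimes> k = k" for k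
      proof -
        have ke: "k \<otimes> e1 = k" using e1_right[of k] k by simp
        \<comment> \<open>Here \<open>lam_\<tau>\<close> moves \<open>h\<close> from the far left to
          the far right, where it acts on \<open>a\<close> before \<open>k\<close> does.\<close>
        have "lam (\<tau> h \<otimes> (\<psi> a \<otimes> k)) = lam (\<psi> a \<otimes> k \<otimes> h)"
          by (rule lam_\<tau>) (use h k ke \<psi>c[OF ra(2)] in \<open>simp_all add: m_assoc m_assoc[symmetric, of e2]\<close>)
        also have "\<dots> = \<Theta> ((k \<otimes> h) \<odot>\<^bsub>P\<^esub> a)"
          using \<psi>c(1)[OF ra(2)] \<psi>c(4)[OF ra(2), of "k \<otimes> h"] h k by (simp add: m_assoc m_assoc[symmetric, of e1])
        finally show ?thesis using \<psi>c[OF ra(2)] \<tau>h h k ra by (simp add: m_assoc P.smult_assoc1)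
      qed
      then show "rep (h \<odot>\<^bsub>P\<^esub> a) (\<tau> h \<otimes> \<psi> a)"
        using \<psi>c[OF ra(2)] \<tau>h \<tau>h2 by (simp add: rep_def m_assoc m_assoc[symmetric, of e2])
    qed (use h ra in simp)
    moreover have "r \<odot>\<^bsub>P\<^esub> a = h \<odot>\<^bsub>P\<^esub> a \<oplus>\<^bsub>P\<^esub> e2 \<odot>\<^bsub>P\<^esub> (r \<odot>\<^bsub>P\<^esub> a)"
      using mod_decomp[OF P(1), of "r \<odot>\<^bsub>P\<^esub> a"] ra by (simp add: h_def P.smult_assoc1)
    then have "\<psi> (r \<odot>\<^bsub>P\<^esub> a) = \<psi> (h \<odot>\<^bsub>P\<^esub> a) \<oplus> \<psi> (e2 \<odot>\<^bsub>P\<^esub> (r \<odot>\<^bsub>P\<^esub> a))"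
      using \<psi>_add ra h by (metis P.smult_closed e_closed(2))
    ultimately show ?thesis
      using \<psi>_N[OF e2N[of "r \<odot>\<^bsub>P\<^esub> a"]] \<psi>c(1)[OF ra(2)] \<tau>h ra by (simp add: h_def[symmetric])
  qed
  \<comment> \<open>Nonvanishing at \<open>a = x j\<close>: the coordinate \<open>\<phi> j\<close>
    of \<open>\<psi> (x j) p\<close> is \<open>\<psi> (x j) h0\<close>, on which \<open>lam\<close>
    has the value \<open>\<Theta> (h0 x j)\<close>.\<close>
  have "lam (\<psi> (x j) \<otimes> h0) \<noteq> \<zero>\<^bsub>K\<^esub>" using \<psi>c(4)[OF *(1)[OF j(1)] h0] \<Theta>(3) by simp
  then have "\<psi> (x j) \<otimes> h0 \<noteq> \<zero>" using l.f_zero by auto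
  moreover have "\<phi> j (\<psi> (x j) \<odot>\<^bsub>P\<^esub> p) = \<psi> (x j) \<otimes> h0"
    using \<phi>D(3)[OF j(1) _ p(1)] \<psi>c(1)[OF *(1)[OF j(1)]] by (simp add: h0_def)
  moreover have "\<phi> j \<zero>\<^bsub>P\<^esub> = \<zero>"
    using lmod_homomorphism.f_zero[OF lmod_homomorphismI[OF P(1) regular_left_module *(3)[OF j(1)]]] by simp
  ultimately have "\<psi> (x j) \<odot>\<^bsub>P\<^esub> p \<noteq> \<zero>\<^bsub>P\<^esub>" by auto
  then have "\<exists>a \<in> carrier P. \<psi> a \<odot>\<^bsub>P\<^esub> p \<noteq> \<zero>\<^bsub>P\<^esub>" using *(1)[OF j(1)] by blast
  moreover have "\<tau> (e1 \<otimes> r) \<in> carrier R" if "r \<in> carrier R" for r using \<tau>_closed[of "e1 \<otimes> r"] that by simp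
  ultimately show ?thesis
    using p \<psi>c \<psi>_add \<psi>_smult \<psi>_N
    by (intro exI[of _ "\<lambda>a. \<psi> a \<odot>\<^bsub>P\<^esub> p"]) (simp add: P.smult_assoc1[symmetric] P.smult_l_distr[symmetric] Nd(7))
qed

text \<open>The map \<open>\<mu>\<close> of \<open>shift_map\<close> identifies \<open>P\<close>
  modulo \<open>N\<close>, semilinearly along \<open>\<tau>\<close>, with a submodule
  \<open>B\<close> of \<open>e2 P\<close>. Essentiality and the maximality of \<open>N\<close> force
  \<open>B\<close> into \<open>L\<close>, so \<open>B\<close> is projective by heredity; a dual
  basis of \<open>B\<close>, translated back by \<open>\<tau>'\<close>, splits \<open>\<mu>\<close>.
  In effect the simple quotient of \<open>e1 P\<close> given by \<open>N\<close> is
  projective.\<close>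

lemma maximal_complement:
  assumes P: "left_module R P" "has_dual_basis R e1 P"
    and N: "submodule N R P" "{x \<in> carrier P. e1 \<odot>\<^bsub>P\<^esub> x = \<zero>\<^bsub>P\<^esub>} \<subseteq> N" "N \<noteq> carrier P"
    and Nmax: "\<And>N'. submodule N' R P \<Longrightarrow> N \<subseteq> N' \<Longrightarrow> N' = N \<or> N' = carrier P"
    and L: "submodule L R P" "L \<subseteq> {x \<in> carrier P. e1 \<odot>\<^bsub>P\<^esub> x = \<zero>\<^bsub>P\<^esub>}" "proj R (P\<lparr>carrier := L\<rparr>)"
    and ess: "\<And>x. x \<in> carrier P \<Longrightarrow> x \<noteq> \<zero>\<^bsub>P\<^esub> \<Longrightarrow> \<exists>a \<in> carrier R. a \<odot>\<^bsub>P\<^esub> x \<in> L \<and> a \<odot>\<^bsub>P\<^esub> x \<noteq> \<zero>\<^bsub>P\<^esub>"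
  shows "\<exists>A. submodule A R P \<and> N <+>\<^bsub>P\<^esub> A = carrier P \<and> N \<inter> A = {x \<in> carrier P. e1 \<odot>\<^bsub>P\<^esub> x = \<zero>\<^bsub>P\<^esub>}"
proof -
  interpret P: left_module R P by fact
  note Nd = P.submoduleD[OF N(1)] and Ld = P.submoduleD[OF L(1)]
  obtain \<mu> where \<mu>: "\<And>a. a \<in> carrier P \<Longrightarrow> \<mu> a \<in> carrier P" "\<And>a. a \<in> carrier P \<Longrightarrow> e2 \<odot>\<^bsub>P\<^esub> \<mu> a = \<mu> a"
    "\<And>a b. a \<in> carrier P \<Longrightarrow> b \<in> carrier P \<Longrightarrow> \<mu> (a \<oplus>\<^bsub>P\<^esub> b) = \<mu> a \<oplus>\<^bsub>P\<^esub> \<mu> b"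
    "\<And>r a. r \<in> carrier R \<Longrightarrow> a \<in> carrier P \<Longrightarrow> \<mu> (r \<odot>\<^bsub>P\<^esub> a) = \<tau> (e1 \<otimes> r) \<odot>\<^bsub>P\<^esub> \<mu> a"
    "\<And>a. a \<in> N \<Longrightarrow> \<mu> a = \<zero>\<^bsub>P\<^esub>" "\<exists>a \<in> carrier P. \<mu> a \<noteq> \<zero>\<^bsub>P\<^esub>"
  proof -
    from shift_map[OF P N] obtain \<mu> where
      m: "\<forall>a \<in> carrier P. \<mu> a \<in> carrier P \<and> e2 \<odot>\<^bsub>P\<^esub> \<mu> a = \<mu> a"
      "\<forall>a \<in> carrier P. \<forall>b \<in> carrier P. \<mu> (a \<oplus>\<^bsub>P\<^esub> b) = \<mu> a \<oplus>\<^bsub>P\<^esub> \<mu> b"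
      "\<forall>r \<in> carrier R. \<forall>a \<in> carrier P. \<mu> (r \<odot>\<^bsub>P\<^esub> a) = \<tau> (e1 \<otimes> r) \<odot>\<^bsub>P\<^esub> \<mu> a"
      "\<forall>a \<in> N. \<mu> a = \<zero>\<^bsub>P\<^esub>" "\<exists>a \<in> carrier P. \<mu> a \<noteq> \<zero>\<^bsub>P\<^esub>"
      by (elim exE conjE) (rule that)
    show thesis by (rule that[of \<mu>]) (use m in simp_all)
  qed
  have \<tau>c: "\<tau> (e1 \<otimes> r) \<in> carrier R" if "r \<in> carrier R" for r using \<tau>_closed[of "e1 \<otimes> r"] that by simp
  have pre: "submodule {a \<in> carrier P. \<mu> a \<in> U} R P" if U: "submodule U R P" for U
  proof (rule P.submoduleI)
    show "\<zero>\<^bsub>P\<^esub> \<in> {a \<in> carrier P. \<mu> a \<in> U}" using \<mu>(5) Nd(2) P.submoduleD(2)[OF U] by simp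
  qed (use \<mu> \<tau>c P.submoduleD[OF U] in auto)
  \<comment> \<open>The kernel of \<open>\<mu>\<close> is a proper submodule containing
    \<open>N\<close>, hence equal to \<open>N\<close>.\<close>
  have \<mu>ker: "a \<in> N" if "a \<in> carrier P" "\<mu> a = \<zero>\<^bsub>P\<^esub>" for a
  proof -
    have "N \<subseteq> {a \<in> carrier P. \<mu> a \<in> {\<zero>\<^bsub>P\<^esub>}}" using \<mu>(5) Nd(7) by auto
    then have "{a \<in> carrier P. \<mu> a \<in> {\<zero>\<^bsub>P\<^esub>}} = N" using Nmax[OF pre[OF P.zero_submodule]] \<mu>(6) by auto
    then show ?thesis using that by blast
  qed
  \<comment> \<open>The scalar \<open>r\<close> acts on \<open>e2 P\<close> through
    \<open>r e2\<close>, which \<open>\<tau>'\<close> lifts to a scalar in front of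
    \<open>a\<close>. This makes the image of \<open>\<mu>\<close> a submodule.\<close>
  have shift_back: "r \<odot>\<^bsub>P\<^esub> \<mu> a = \<mu> (\<tau>' (r \<otimes> e2) \<odot>\<^bsub>P\<^esub> a)" "\<tau>' (r \<otimes> e2) \<in> carrier R"
    if ra: "r \<in> carrier R" "a \<in> carrier P" for r a
  proof -
    have r: "\<tau>' (r \<otimes> e2) \<in> carrier R" "e1 \<otimes> \<tau>' (r \<otimes> e2) = \<tau>' (r \<otimes> e2)" "\<tau> (\<tau>' (r \<otimes> e2)) = r \<otimes> e2"
      using \<tau>'_closed[of "r \<otimes> e2"] \<tau>_\<tau>'[of "r \<otimes> e2"] ra by (simp_all add: m_assoc)
    then show "\<tau>' (r \<otimes> e2) \<in> carrier R" by simp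
    show "r \<odot>\<^bsub>P\<^esub> \<mu> a = \<mu> (\<tau>' (r \<otimes> e2) \<odot>\<^bsub>P\<^esub> a)"
      using \<mu>(1,2,4) r ra by (simp add: P.smult_assoc1)
  qed
  \<comment> \<open>A nonzero value of \<open>\<mu>\<close> has a nonzero multiple in
    \<open>L\<close>, again a value of \<open>\<mu>\<close> by \<open>shift_back\<close>. The
    preimage of \<open>L\<close> is thus larger than \<open>N\<close>, hence everything.\<close>
  have \<mu>L: "\<mu> a \<in> L" if "a \<in> carrier P" for a
  proof -
    obtain b where b: "b \<in> carrier P" "\<mu> b \<noteq> \<zero>\<^bsub>P\<^esub>" using \<mu>(6) by auto
    obtain r where r: "r \<in> carrier R" "r \<odot>\<^bsub>P\<^esub> \<mu> b \<in> L" "r \<odot>\<^bsub>P\<^esub> \<mu> b \<noteq> \<zero>\<^bsub>P\<^esub>"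
      using ess[OF \<mu>(1)[OF b(1)] b(2)] by auto
    let ?c = "\<tau>' (r \<otimes> e2) \<odot>\<^bsub>P\<^esub> b"
    have c: "?c \<in> carrier P" "\<mu> ?c \<in> L" "\<mu> ?c \<noteq> \<zero>\<^bsub>P\<^esub>" using r shift_back[OF r(1) b(1)] b by simp_all
    have "N \<subseteq> {a \<in> carrier P. \<mu> a \<in> L}" using \<mu>(5) Nd(7) Ld(2) by auto
    then have "{a \<in> carrier P. \<mu> a \<in> L} = carrier P" using Nmax[OF pre[OF L(1)]] c \<mu>(5) by auto
    then show ?thesis using that by blast
  qed
  define B where "B = \<mu> ` carrier P"
  have B: "submodule B R P"
  proof (rule P.submoduleI)
    show "B \<subseteq> carrier P" using \<mu>(1) by (auto simp: B_def)
    show "\<zero>\<^bsub>P\<^esub> \<in> B" unfolding B_def using \<mu>(5)[OF Nd(2)] by (intro image_eqI[of _ _ "\<zero>\<^bsub>P\<^esub>"]) auto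
    show "y \<oplus>\<^bsub>P\<^esub> z \<in> B" if "y \<in> B" "z \<in> B" for y z using that \<mu>(3) by (auto simp: B_def \<mu>(3)[symmetric])
    show "r \<odot>\<^bsub>P\<^esub> y \<in> B" if "r \<in> carrier R" "y \<in> B" for r y using that shift_back by (auto simp: B_def)
  qed
  have BL: "B \<subseteq> L" using \<mu>L by (auto simp: B_def)
  have LL: "left_module R (P\<lparr>carrier := L\<rparr>)" by (rule P.submodule_left_module[OF L(1)])
  have Bp: "proj R (P\<lparr>carrier := B\<rparr>)"
    using submodule_proj[OF LL L(3), of B] P.submodule_trans[OF L(1), of B] B BL L(2) by auto
  obtain n b \<beta> where *: "\<And>j. j < n \<Longrightarrow> b j \<in> carrier (P\<lparr>carrier := B\<rparr>)"
    "\<And>j. j < n \<Longrightarrow> \<one> \<odot>\<^bsub>P\<lparr>carrier := B\<rparr>\<^esub> b j = b j"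
    "\<And>j. j < n \<Longrightarrow> \<beta> j \<in> lmod_hom R (P\<lparr>carrier := B\<rparr>) (regular_module R)"
    "\<And>j p. j < n \<Longrightarrow> p \<in> carrier (P\<lparr>carrier := B\<rparr>) \<Longrightarrow> \<beta> j p \<otimes> \<one> = \<beta> j p"
    "\<And>p. p \<in> carrier (P\<lparr>carrier := B\<rparr>) \<Longrightarrow> comb (P\<lparr>carrier := B\<rparr>) n b (\<lambda>j. \<beta> j p) = p"
    by (rule has_dual_basisE[OF Bp]) (rule that)
  note \<beta>D = lmod_homD[OF *(3), simplified]
  have \<mu>B: "\<mu> a \<in> B" if "a \<in> carrier P" for a using that by (simp add: B_def)
  have "\<exists>a. a \<in> carrier P \<and> \<mu> a = b j" if "j < n" for j using *(1)[OF that] by (auto simp: B_def)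
  then obtain c where c: "\<And>j. j < n \<Longrightarrow> c j \<in> carrier P" "\<And>j. j < n \<Longrightarrow> \<mu> (c j) = b j" by metis
  \<comment> \<open>The factor \<open>e2\<close> puts the coefficient into \<open>R e2\<close>,
    where the assumptions on \<open>\<tau>'\<close> apply.\<close>
  define \<gamma> where "\<gamma> j a = \<beta> j (\<mu> a) \<otimes> e2" for j a
  have \<gamma>: "\<gamma> j a \<in> carrier R" "\<gamma> j a \<otimes> e2 = \<gamma> j a" if "j < n" "a \<in> carrier P" for j a
    using \<beta>D(1)[OF that(1) \<mu>B[OF that(2)]] by (simp_all add: \<gamma>_def m_assoc)
  have \<tau>'\<gamma>: "\<tau>' (\<gamma> j a) \<in> carrier R" "e1 \<otimes> \<tau>' (\<gamma> j a) = \<tau>' (\<gamma> j a)" "\<tau> (\<tau>' (\<gamma> j a)) = \<gamma> j a"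
    if "j < n" "a \<in> carrier P" for j a
    using \<tau>'_closed[OF \<gamma>[OF that]] \<tau>_\<tau>'[OF \<gamma>[OF that]] by auto
  \<comment> \<open>A splitting of \<open>\<mu>\<close> carried back to \<open>P\<close>: it becomes
    an idempotent with kernel \<open>N\<close>, linear over \<open>e1 R e1\<close> in the sense of
    \<open>\<sigma>_smult\<close>.\<close>
  define \<sigma> where "\<sigma> a = msum P n (\<lambda>j. \<tau>' (\<gamma> j a) \<odot>\<^bsub>P\<^esub> c j)" for a
  have \<sigma>c: "\<sigma> a \<in> carrier P" if "a \<in> carrier P" for a
    unfolding \<sigma>_def using \<tau>'\<gamma> c that by (intro P.M.msum_closed) auto
  have \<sigma>_add: "\<sigma> (a \<oplus>\<^bsub>P\<^esub> a') = \<sigma> a \<oplus>\<^bsub>P\<^esub> \<sigma> a'" if a: "a \<in> carrier P" "a' \<in> carrier P" for a a'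
  proof -
    have "\<sigma> (a \<oplus>\<^bsub>P\<^esub> a') = msum P n (\<lambda>j. \<tau>' (\<gamma> j a) \<odot>\<^bsub>P\<^esub> c j \<oplus>\<^bsub>P\<^esub> \<tau>' (\<gamma> j a') \<odot>\<^bsub>P\<^esub> c j)"
      unfolding \<sigma>_def
    proof (rule msum_cong)
      fix j assume j: "j < n"
      have "\<gamma> j (a \<oplus>\<^bsub>P\<^esub> a') = \<gamma> j a \<oplus> \<gamma> j a'"
        using \<beta>D(1,2)[OF j] \<mu>B \<mu>(3) a by (simp add: \<gamma>_def l_distr)
      then show "\<tau>' (\<gamma> j (a \<oplus>\<^bsub>P\<^esub> a')) \<odot>\<^bsub>P\<^esub> c j = \<tau>' (\<gamma> j a) \<odot>\<^bsub>P\<^esub> c j \<oplus>\<^bsub>P\<^esub> \<tau>' (\<gamma> j a') \<odot>\<^bsub>P\<^esub> c j"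
        using \<tau>'_add \<gamma> \<tau>'\<gamma> c j a by (simp add: P.smult_l_distr)
    qed
    also have "\<dots> = \<sigma> a \<oplus>\<^bsub>P\<^esub> \<sigma> a'"
      unfolding \<sigma>_def by (rule P.M.msum_add) (use \<tau>'\<gamma> c a in auto)
    finally show ?thesis .
  qed
  have \<sigma>_smult: "\<sigma> (r \<odot>\<^bsub>P\<^esub> a) = (e1 \<otimes> r) \<odot>\<^bsub>P\<^esub> \<sigma> a" if ra: "r \<in> carrier R" "a \<in> carrier P" for r a
  proof -
    have "(e1 \<otimes> r) \<odot>\<^bsub>P\<^esub> \<sigma> a = msum P n (\<lambda>j. (e1 \<otimes> r) \<odot>\<^bsub>P\<^esub> (\<tau>' (\<gamma> j a) \<odot>\<^bsub>P\<^esub> c j))"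
      unfolding \<sigma>_def by (rule P.msum_smult) (use \<tau>'\<gamma> c ra in auto)
    also have "\<dots> = \<sigma> (r \<odot>\<^bsub>P\<^esub> a)"
      unfolding \<sigma>_def
    proof (rule msum_cong)
      fix j assume j: "j < n"
      have "\<gamma> j (r \<odot>\<^bsub>P\<^esub> a) = \<tau> (e1 \<otimes> r) \<otimes> \<gamma> j a"
        using \<beta>D(1,3)[OF j] \<mu>B \<mu>(4) \<tau>c ra by (simp add: \<gamma>_def m_assoc)
      then have "\<tau>' (\<gamma> j (r \<odot>\<^bsub>P\<^esub> a)) = (e1 \<otimes> r) \<otimes> \<tau>' (\<gamma> j a)"
        using \<tau>'_mult[of "e1 \<otimes> r" "\<gamma> j a"] \<gamma>[OF j ra(2)] ra by simp
      then show "(e1 \<otimes> r) \<odot>\<^bsub>P\<^esub> (\<tau>' (\<gamma> j a) \<odot>\<^bsub>P\<^esub> c j) = \<tau>' (\<gamma> j (r \<odot>\<^bsub>P\<^esub> a)) \<odot>\<^bsub>P\<^esub> c j"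
        using \<tau>'\<gamma> c j ra by (simp add: P.smult_assoc1[symmetric])
    qed
    finally show ?thesis by simp
  qed
  have "\<tau>' \<zero> = \<zero>"
  proof -
    have "\<tau>' (\<zero> \<oplus> \<zero>) = \<tau>' \<zero> \<oplus> \<tau>' \<zero>" by (rule \<tau>'_add) simp_all
    then show ?thesis using \<tau>'_closed[of \<zero>] by (simp add: add.l_cancel_one')
  qed
  then have \<sigma>_ker: "\<sigma> a = \<zero>\<^bsub>P\<^esub>" if "a \<in> N" for a
  proof -
    have "\<beta> j \<zero>\<^bsub>P\<^esub> = \<zero>" if "j < n" for j
      using lmod_homomorphism.f_zero[OF lmod_homomorphismI[OF P.submodule_left_module[OF B] regular_left_module *(3)[OF that]]]
      by simp
    then show ?thesis unfolding \<sigma>_def using \<mu>(5)[OF \<open>a \<in> N\<close>] \<open>\<tau>' \<zero> = \<zero>\<close> c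
      by (intro P.M.msum_zero) (simp add: \<gamma>_def)
  qed
  have \<mu>_msum: "\<mu> (msum P k f) = msum P k (\<lambda>j. \<mu> (f j))" if "\<And>j. j < k \<Longrightarrow> f j \<in> carrier P" for k f
    using that by (induction k) (simp_all add: \<mu>(3) \<mu>(5)[OF Nd(2)] P.M.msum_closed)
  have \<mu>\<sigma>: "\<mu> (\<sigma> a) = \<mu> a" if a: "a \<in> carrier P" for a
  proof -
    have "\<mu> (\<sigma> a) = msum P n (\<lambda>j. \<mu> (\<tau>' (\<gamma> j a) \<odot>\<^bsub>P\<^esub> c j))"
      unfolding \<sigma>_def by (rule \<mu>_msum) (use \<tau>'\<gamma> c a in auto)
    also have "\<dots> = msum P n (\<lambda>j. \<beta> j (\<mu> a) \<odot>\<^bsub>P\<^esub> b j)"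
    proof (rule msum_cong)
      fix j assume j: "j < n"
      have "\<mu> (\<tau>' (\<gamma> j a) \<odot>\<^bsub>P\<^esub> c j) = \<gamma> j a \<odot>\<^bsub>P\<^esub> b j"
        using \<mu>(4) \<tau>'\<gamma>[OF j a] c[OF j] by simp
      also have "\<dots> = \<beta> j (\<mu> a) \<odot>\<^bsub>P\<^esub> (e2 \<odot>\<^bsub>P\<^esub> b j)"
        using \<beta>D(1)[OF j \<mu>B[OF a]] \<mu>(1)[OF c(1)[OF j]] c(2)[OF j] by (simp add: \<gamma>_def P.smult_assoc1)
      also have "e2 \<odot>\<^bsub>P\<^esub> b j = b j" using \<mu>(2)[OF c(1)[OF j]] c(2)[OF j] by simp
      finally show "\<mu> (\<tau>' (\<gamma> j a) \<odot>\<^bsub>P\<^esub> c j) = \<beta> j (\<mu> a) \<odot>\<^bsub>P\<^esub> b j" .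
    qed
    also have "\<dots> = \<mu> a" using *(5)[of "\<mu> a"] \<mu>B[OF a] by (simp add: comb_def)
    finally show ?thesis .
  qed
  have dN: "a \<ominus>\<^bsub>P\<^esub> \<sigma> a \<in> N" if a: "a \<in> carrier P" for a
  proof (rule \<mu>ker)
    have "\<mu> (a \<ominus>\<^bsub>P\<^esub> \<sigma> a) \<oplus>\<^bsub>P\<^esub> \<mu> (\<sigma> a) = \<mu> a"
      using \<mu>(3)[of "a \<ominus>\<^bsub>P\<^esub> \<sigma> a" "\<sigma> a"] \<sigma>c a by simp
    then show "\<mu> (a \<ominus>\<^bsub>P\<^esub> \<sigma> a) = \<zero>\<^bsub>P\<^esub>"
      using \<mu>\<sigma>[OF a] \<mu>(1)[OF a] \<mu>(1)[of "a \<ominus>\<^bsub>P\<^esub> \<sigma> a"] \<sigma>c[OF a] a by (simp add: P.M.add.r_cancel_one)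
  qed (use \<sigma>c a in simp)
  have \<sigma>\<sigma>: "\<sigma> (\<sigma> a) = \<sigma> a" if a: "a \<in> carrier P" for a
  proof -
    have "\<sigma> (a \<ominus>\<^bsub>P\<^esub> \<sigma> a) \<oplus>\<^bsub>P\<^esub> \<sigma> (\<sigma> a) = \<sigma> a"
      using \<sigma>_add[of "a \<ominus>\<^bsub>P\<^esub> \<sigma> a" "\<sigma> a"] \<sigma>c a by simp
    then show ?thesis using \<sigma>_ker[OF dN[OF a]] \<sigma>c a by simp
  qed
  let ?P2 = "{x \<in> carrier P. e1 \<odot>\<^bsub>P\<^esub> x = \<zero>\<^bsub>P\<^esub>}"
  \<comment> \<open>Since \<open>\<sigma>\<close> is linear only over \<open>e1 R e1\<close>, its
    image need not be a submodule; comparing \<open>e1\<close>-components only adds the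
    \<open>e2\<close>-part to it.\<close>
  define A where "A = {a \<in> carrier P. e1 \<odot>\<^bsub>P\<^esub> a = e1 \<odot>\<^bsub>P\<^esub> \<sigma> a}"
  have A: "submodule A R P"
  proof (rule P.submoduleI)
    show "A \<subseteq> carrier P" by (auto simp: A_def)
    show "\<zero>\<^bsub>P\<^esub> \<in> A" using \<sigma>_ker[OF Nd(2)] by (simp add: A_def)
    show "x \<oplus>\<^bsub>P\<^esub> y \<in> A" if "x \<in> A" "y \<in> A" for x y
      using that \<sigma>_add \<sigma>c by (simp add: A_def P.smult_r_distr)
    fix r x assume r: "r \<in> carrier R" and "x \<in> A"
    then have x: "x \<in> carrier P" "e1 \<odot>\<^bsub>P\<^esub> x = e1 \<odot>\<^bsub>P\<^esub> \<sigma> x" by (auto simp: A_def)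
    have "e1 \<odot>\<^bsub>P\<^esub> (r \<odot>\<^bsub>P\<^esub> x) = (e1 \<otimes> r) \<odot>\<^bsub>P\<^esub> (e1 \<odot>\<^bsub>P\<^esub> x)"
      using r x(1) by (simp add: P.smult_assoc1[symmetric] e1_right)
    also have "\<dots> = (e1 \<otimes> r) \<odot>\<^bsub>P\<^esub> \<sigma> x"
      unfolding x(2) using r \<sigma>c[OF x(1)] by (simp add: P.smult_assoc1[symmetric] e1_right)
    also have "\<dots> = e1 \<odot>\<^bsub>P\<^esub> \<sigma> (r \<odot>\<^bsub>P\<^esub> x)"
      using r x(1) \<sigma>c[OF x(1)] by (simp add: \<sigma>_smult P.smult_assoc1[symmetric])
    finally show "r \<odot>\<^bsub>P\<^esub> x \<in> A" using r x(1) by (simp add: A_def)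
  qed
  have "a \<in> N <+>\<^bsub>P\<^esub> A" if a: "a \<in> carrier P" for a
    unfolding P.set_add_iff
  proof (intro bexI)
    show "a = (a \<ominus>\<^bsub>P\<^esub> \<sigma> a) \<oplus>\<^bsub>P\<^esub> \<sigma> a" using a \<sigma>c by simp
    show "\<sigma> a \<in> A" using a \<sigma>c \<sigma>\<sigma> by (simp add: A_def)
    show "a \<ominus>\<^bsub>P\<^esub> \<sigma> a \<in> N" by (rule dN[OF a])
  qed
  then have "N <+>\<^bsub>P\<^esub> A = carrier P"
    using P.submoduleD(1)[OF P.submodule_set_add(1)[OF N(1) A]] by auto
  moreover have "N \<inter> A = ?P2"
    using \<sigma>_ker Nd(7) N(2) by (auto simp: A_def)
  ultimately show ?thesis using A by blast
qed

text \<open>The proof that a module is semisimple when its maximal submodules have complements,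
  carried out modulo the \<open>e2\<close>-part \<open>P2\<close>. The resulting decomposition
  \<open>P = V + P2 + W\<close> is turned into a retraction onto \<open>V\<close> by splitting the
  \<open>x j\<close> of a dual basis, which have no \<open>e2\<close>-component.\<close>

lemma top_semisimpleI:
  assumes P: "left_module R P" "has_dual_basis R e1 P"
    and L: "submodule L R P" "L \<subseteq> {x \<in> carrier P. e1 \<odot>\<^bsub>P\<^esub> x = \<zero>\<^bsub>P\<^esub>}" "proj R (P\<lparr>carrier := L\<rparr>)"
    and ess: "\<And>x. x \<in> carrier P \<Longrightarrow> x \<noteq> \<zero>\<^bsub>P\<^esub> \<Longrightarrow> \<exists>a \<in> carrier R. a \<odot>\<^bsub>P\<^esub> x \<in> L \<and> a \<odot>\<^bsub>P\<^esub> x \<noteq> \<zero>\<^bsub>P\<^esub>"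
  shows "top_semisimple P"
  unfolding top_semisimple_def
proof (intro allI impI)
  interpret P: left_module R P by fact
  fix V assume V: "submodule V R P" "gen1 (P\<lparr>carrier := V\<rparr>)"
  note Vd = P.submoduleD[OF V(1)]
  define P2 where "P2 = {x \<in> carrier P. e1 \<odot>\<^bsub>P\<^esub> x = \<zero>\<^bsub>P\<^esub>}"
  have P2: "submodule P2 R P" unfolding P2_def by (rule e2_part_submodule[OF P(1)])
  define N where "N = V <+>\<^bsub>P\<^esub> P2"
  have N: "submodule N R P" "V \<subseteq> N" "P2 \<subseteq> N" unfolding N_def using P.submodule_set_add[OF V(1) P2] by auto
  obtain W where W: "submodule W R P" "N \<inter> W = P2"
    "\<And>W'. submodule W' R P \<Longrightarrow> W \<subseteq> W' \<Longrightarrow> N \<inter> W' = P2 \<Longrightarrow> W' = W"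
    by (rule P.maximal_relative_complement[OF P2 N(3)]) (rule that)
  note Wd = P.submoduleD[OF W(1)]
  note NW = P.submodule_set_add[OF N(1) W(1)]
  have all: "N <+>\<^bsub>P\<^esub> W = carrier P"
  proof (rule ccontr)
    assume "N <+>\<^bsub>P\<^esub> W \<noteq> carrier P"
    \<comment> \<open>Finite generation puts \<open>N + W\<close> into a maximal submodule
      \<open>Z\<close>, whose complement \<open>A\<close> will be used to enlarge
      \<open>W\<close>.\<close>
    then obtain Z where Z: "submodule Z R P" "N <+>\<^bsub>P\<^esub> W \<subseteq> Z" "Z \<noteq> carrier P"
      "\<And>N'. submodule N' R P \<Longrightarrow> Z \<subseteq> N' \<Longrightarrow> N' = Z \<or> N' = carrier P"
      using P.maximal_submodule[OF P.proj_finitely_generated[OF P(2)] NW(1)] by metis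
    note Zd = P.submoduleD[OF Z(1)]
    have P2Z: "P2 \<subseteq> Z" using N(3) NW(2) Z(2) by auto
    obtain A where A: "submodule A R P" "Z <+>\<^bsub>P\<^esub> A = carrier P" "Z \<inter> A = P2"
      using maximal_complement[OF P Z(1) P2Z[unfolded P2_def] Z(3,4) L ess] unfolding P2_def by auto
    note Ad = P.submoduleD[OF A(1)] and WA = P.submodule_set_add[OF W(1) A(1)]
    \<comment> \<open>For \<open>z = w + a\<close> in \<open>N\<close> the element
      \<open>a = z - w\<close> lies in \<open>Z \<inter> A = P2\<close>. So \<open>W + A\<close> is
      also a relative complement, and \<open>A \<subseteq> W \<subseteq> Z\<close> by maximality of
      \<open>W\<close>, against \<open>Z + A = P\<close>.\<close>
    have "N \<inter> (W <+>\<^bsub>P\<^esub> A) \<subseteq> P2"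
    proof
      fix z assume z: "z \<in> N \<inter> (W <+>\<^bsub>P\<^esub> A)"
      then obtain w a where wa: "w \<in> W" "a \<in> A" "z = w \<oplus>\<^bsub>P\<^esub> a" by (auto simp: P.set_add_iff)
      have "a = z \<ominus>\<^bsub>P\<^esub> w" using wa Wd(7) Ad(7) by simp
      moreover have "z \<ominus>\<^bsub>P\<^esub> w \<in> Z" using z wa(1) NW Z(2) by (intro Zd(6)) auto
      ultimately have "a \<in> W" using A(3) W(2) wa(2) by auto
      then have "z \<in> W" using wa Wd(3) by simp
      then show "z \<in> P2" using W(2) z by auto
    qed
    moreover have "P2 \<subseteq> N \<inter> (W <+>\<^bsub>P\<^esub> A)" using N(3) WA(2) W(2) by auto
    ultimately have "W <+>\<^bsub>P\<^esub> A = W" using W(3)[OF WA(1,2)] by auto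
    then have "A \<subseteq> Z" using WA(3) NW(3) Z(2) by auto
    then have "Z <+>\<^bsub>P\<^esub> A \<subseteq> Z" using Zd(3) by (force simp: P.set_add_iff)
    then show False using A(2) Z(3) Zd(1) by auto
  qed
  obtain n x \<phi> where *: "\<And>j. j < n \<Longrightarrow> x j \<in> carrier P" "\<And>j. j < n \<Longrightarrow> e1 \<odot>\<^bsub>P\<^esub> x j = x j"
    "\<And>j. j < n \<Longrightarrow> \<phi> j \<in> lmod_hom R P (regular_module R)"
    "\<And>j p. j < n \<Longrightarrow> p \<in> carrier P \<Longrightarrow> \<phi> j p \<otimes> e1 = \<phi> j p"
    "\<And>p. p \<in> carrier P \<Longrightarrow> comb P n x (\<lambda>j. \<phi> j p) = p"
    by (rule has_dual_basisE[OF P(2)]) (rule that)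
  note c = lmod_homD(1)[OF *(3), simplified]
  have "\<exists>v w. v \<in> V \<and> w \<in> W \<and> x j = v \<oplus>\<^bsub>P\<^esub> w" if j: "j < n" for j
  proof -
    have "x j \<in> N <+>\<^bsub>P\<^esub> W" using all *(1)[OF j] by simp
    then obtain v q w where vw: "v \<in> V" "q \<in> P2" "w \<in> W" "x j = v \<oplus>\<^bsub>P\<^esub> q \<oplus>\<^bsub>P\<^esub> w"
      by (auto simp: N_def P.set_add_iff)
    have cc: "v \<in> carrier P" "q \<in> carrier P" "w \<in> carrier P"
      using vw Vd(7) Wd(7) by (auto simp: P2_def)
    \<comment> \<open>Applying \<open>e1\<close> removes the summand in \<open>P2\<close>.\<close>
    have "x j = e1 \<odot>\<^bsub>P\<^esub> v \<oplus>\<^bsub>P\<^esub> e1 \<odot>\<^bsub>P\<^esub> w"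
      using *(2)[OF j] vw(2) cc by (simp add: vw(4) P.smult_r_distr P2_def)
    then show ?thesis using Vd(4) Wd(4) vw e_closed(1) by blast
  qed
  then obtain v w where vw: "\<And>j. j < n \<Longrightarrow> v j \<in> V" "\<And>j. j < n \<Longrightarrow> w j \<in> W"
    "\<And>j. j < n \<Longrightarrow> x j = v j \<oplus>\<^bsub>P\<^esub> w j" by metis
  define f where "f p = comb P n v (\<lambda>j. \<phi> j p)" for p
  define g where "g p = comb P n w (\<lambda>j. \<phi> j p)" for p
  have f: "f \<in> lmod_hom R P P"
    unfolding f_def comb_def by (intro P.lmod_hom_msum P.lmod_hom_smult_fixed *(3)) (use vw Vd(7) in auto)
  have g: "g \<in> lmod_hom R P P"
    unfolding g_def comb_def by (intro P.lmod_hom_msum P.lmod_hom_smult_fixed *(3)) (use vw Wd(7) in auto)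
  have fV: "f p \<in> V" if "p \<in> carrier P" for p
    unfolding f_def comb_def using vw Vd(4) c that by (intro P.submodule_msum[OF V(1)]) auto
  have gW: "g p \<in> W" if "p \<in> carrier P" for p
    unfolding g_def comb_def using vw Wd(4) c that by (intro P.submodule_msum[OF W(1)]) auto
  have fg: "f p \<oplus>\<^bsub>P\<^esub> g p = p" if p: "p \<in> carrier P" for p
  proof -
    have "f p \<oplus>\<^bsub>P\<^esub> g p = msum P n (\<lambda>j. \<phi> j p \<odot>\<^bsub>P\<^esub> v j \<oplus>\<^bsub>P\<^esub> \<phi> j p \<odot>\<^bsub>P\<^esub> w j)"
      unfolding f_def g_def comb_def by (rule P.M.msum_add[symmetric]) (use c p vw Vd(7) Wd(7) in auto)
    also have "\<dots> = comb P n x (\<lambda>j. \<phi> j p)"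
      unfolding comb_def by (rule msum_cong) (use c p vw Vd(7) Wd(7) in \<open>simp add: P.smult_r_distr\<close>)
    finally show ?thesis using *(5) p by simp
  qed
  interpret g: lmod_homomorphism R P P g by (rule lmod_homomorphismI[OF P(1) P(1) g])
  have VL: "left_module R (P\<lparr>carrier := V\<rparr>)" by (rule P.submodule_left_module[OF V(1)])
  interpret gV: lmod_homomorphism R "P\<lparr>carrier := V\<rparr>" P g
    by (rule lmod_homomorphismI[OF VL P(1) lmod_hom_restrict[OF g Vd(1)]])
  \<comment> \<open>On \<open>V\<close> the map \<open>g = 1 - f\<close> takes values in
    \<open>N \<inter> W = P2\<close>, so it kills \<open>e1 V\<close> and with it
    \<open>V\<close>.\<close>
  have "{x \<in> carrier (P\<lparr>carrier := V\<rparr>). g x = \<zero>\<^bsub>P\<^esub>} = carrier (P\<lparr>carrier := V\<rparr>)"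
  proof (rule gen1D[OF V(2) gV.kernel_submodule])
    fix u assume "u \<in> carrier (P\<lparr>carrier := V\<rparr>)"
    then have u: "u \<in> V" "u \<in> carrier P" using Vd(7) by auto
    have "g u = u \<ominus>\<^bsub>P\<^esub> f u"
      using P.add_minus_cancel(2)[of "g u" "f u"] fg u Vd(7) fV by simp
    then have "g u \<in> N \<inter> W" using Vd(6)[OF u(1) fV[OF u(2)]] N(2) gW[OF u(2)] by auto
    then have "e1 \<odot>\<^bsub>P\<^esub> g u = \<zero>\<^bsub>P\<^esub>" using W(2) by (auto simp: P2_def)
    then show "e1 \<odot>\<^bsub>P\<lparr>carrier := V\<rparr>\<^esub> u \<in> {x \<in> carrier (P\<lparr>carrier := V\<rparr>). g x = \<zero>\<^bsub>P\<^esub>}"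
      using u Vd(4) by (simp add: g.f_smult)
  qed
  then have "g u = \<zero>\<^bsub>P\<^esub>" if "u \<in> V" for u using that by auto
  then have "f u = u" if "u \<in> V" for u
    using fg[of u] that Vd(7)[OF that] Vd(7)[OF fV[OF Vd(7)[OF that]]] by simp
  then show "\<exists>r\<in>lmod_hom R P P. (\<forall>p\<in>carrier P. r p \<in> V) \<and> (\<forall>v\<in>V. r v = v)"
    using f fV by blast
qed

text \<open>Projective dimension exactly one enters here: without a resolution of length zero
  \<open>X\<close> is not projective, as \<open>kernel_essential\<close> requires.\<close>

lemma presents_exists:
  fixes X :: "('r, 'm) module"
  assumes X: "left_module R X" "gen1 X" "indecomposable R X"
    and res: "has_projective_resolution R X 1" "\<not> has_projective_resolution R X 0"
  shows "\<exists>(P :: 'r small_module) p. presents P p X"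
proof -
  have np: "\<not> proj R X" using proj_has_resolution_0[OF X(1)] res(2) by auto
  obtain P :: "'r small_module" and p where P: "left_module R P" "has_dual_basis R e1 P"
    and p: "p \<in> lmod_hom R P X" "p ` carrier P = carrier X"
    and e: "\<And>x. x \<in> carrier P \<Longrightarrow> p x = \<zero>\<^bsub>X\<^esub> \<Longrightarrow> e1 \<odot>\<^bsub>P\<^esub> x = \<zero>\<^bsub>P\<^esub>"
    and L: "proj R (P\<lparr>carrier := {x \<in> carrier P. p x = \<zero>\<^bsub>X\<^esub>}\<rparr>)"
    using gen1_resolution[OF X(1,2) res(1)] by blast
  interpret P: left_module R P by fact
  interpret p: lmod_homomorphism R P X p by (rule lmod_homomorphismI[OF P(1) X(1) p(1)])
  have "top_semisimple P"
  proof (rule top_semisimpleI[OF P p.kernel_submodule _ L])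
    fix x assume x: "x \<in> carrier P" "x \<noteq> \<zero>\<^bsub>P\<^esub>"
    show "\<exists>a\<in>carrier R. a \<odot>\<^bsub>P\<^esub> x \<in> {x \<in> carrier P. p x = \<zero>\<^bsub>X\<^esub>} \<and> a \<odot>\<^bsub>P\<^esub> x \<noteq> \<zero>\<^bsub>P\<^esub>"
      using kernel_essential[OF X(1,3) np P p x] x(1) by auto
  qed (use e in auto)
  then show ?thesis using P p e L unfolding presents_def by blast
qed

section \<open>Projective dimension at most one and closure under predecessors\<close>

lemma presents_resolution:
  assumes "left_module R Y" "presents P p Y"
  shows "has_projective_resolution R Y 1"
proof -
  have P: "left_module R P" "has_dual_basis R e1 P" "p \<in> lmod_hom R P Y" "p ` carrier P = carrier Y"
    "proj R (P\<lparr>carrier := {x \<in> carrier P. p x = \<zero>\<^bsub>Y\<^esub>}\<rparr>)"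
    using assms(2) by (auto simp: presents_def)
  show ?thesis
    by (rule proj_has_resolution[OF P(1) left_module.has_dual_basis_proj[OF P(1,2)] assms(1) P(3-5)]) simp
qed

text \<open>A module killed by \<open>e1\<close> is covered by a power of \<open>R e2\<close>, and
  the kernel is projective by heredity of the lower copy of \<open>H\<close>.\<close>

lemma e2_module_resolution:
  assumes Y: "left_module R Y" "finitely_generated R Y" and e: "\<And>y. y \<in> carrier Y \<Longrightarrow> e1 \<odot>\<^bsub>Y\<^esub> y = \<zero>\<^bsub>Y\<^esub>"
  shows "has_projective_resolution R Y 1"
proof -
  interpret Y: left_module R Y by fact
  obtain n g where g: "\<And>i. i < n \<Longrightarrow> g i \<in> carrier Y"
    and s: "comb Y n g ` carrier (free_mod R \<one> n) = carrier Y"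
    using Y(2) unfolding Y.finitely_generated_iff by auto
  have eg: "e2 \<odot>\<^bsub>Y\<^esub> g i = g i" if "i < n" for i
    using mod_decomp[OF Y(1) g[OF that]] e[OF g[OF that]] g[OF that] by simp
  define Q where "Q = free_mod R e2 n"
  have Q: "left_module R Q" "has_dual_basis R e2 Q"
    unfolding Q_def by (simp_all add: free_mod_left_module free_mod_dual_basis)
  interpret Q: left_module R Q by fact
  have c: "comb Y n g \<in> lmod_hom R Q Y" unfolding Q_def by (rule Y.comb_hom[OF g])
  interpret c: lmod_homomorphism R Q Y "comb Y n g" by (rule lmod_homomorphismI[OF Q(1) Y(1) c])
  have onto: "comb Y n g ` carrier Q = carrier Y"
  proof (intro equalityI image_subsetI subsetI)
    fix y assume "y \<in> carrier Y"
    then obtain f where f: "f \<in> carrier (free_mod R \<one> n)" "y = comb Y n g f" using s by blast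
    have "comb Y n g (\<lambda>i. f i \<otimes> e2) = comb Y n g f"
      by (rule Y.comb_right_mult) (use g eg free_mod_closed[OF f(1)] in auto)
    moreover have "(\<lambda>i. f i \<otimes> e2) \<in> carrier Q"
      unfolding Q_def using lmod_homD(1)[OF free_mod_mult_right f(1)] by simp
    ultimately show "y \<in> comb Y n g ` carrier Q" using f(2) by (metis image_eqI)
  qed simp
  let ?L = "{x \<in> carrier Q. comb Y n g x = \<zero>\<^bsub>Y\<^esub>}"
  have L: "proj R (Q\<lparr>carrier := ?L\<rparr>)"
  proof (rule torsionless_proj[of _ n "\<lambda>i f. f i"])
    show "left_module R (Q\<lparr>carrier := ?L\<rparr>)" by (rule Q.submodule_left_module[OF c.kernel_submodule])
    show "(\<lambda>f. f i) \<in> lmod_hom R (Q\<lparr>carrier := ?L\<rparr>) (regular_module R)" for i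
      unfolding Q_def by (rule lmod_hom_restrict[OF free_mod_coord_hom]) auto
    show "f i \<otimes> e2 = f i" if "i < n" "f \<in> carrier (Q\<lparr>carrier := ?L\<rparr>)" for i f
      using that by (simp add: Q_def free_mod_carrier)
    show "f = \<zero>\<^bsub>Q\<lparr>carrier := ?L\<rparr>\<^esub>" if "f \<in> carrier (Q\<lparr>carrier := ?L\<rparr>)" "\<And>i. i < n \<Longrightarrow> f i = \<zero>" for f
    proof
      fix i show "f i = \<zero>\<^bsub>Q\<lparr>carrier := ?L\<rparr>\<^esub> i"
        using that by (cases "i < n") (auto simp: Q_def free_mod_carrier)
    qed
  qed
  show ?thesis
    by (rule proj_has_resolution[OF Q(1) Q.has_dual_basis_proj[OF Q(2)] Y(1) c onto L]) simp
qed

text \<open>The modules \<open>Y\<close> with \<open>e1 Y = 0\<close> or with a presentation as above form a class of modules of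
  projective dimension at most one that is closed under predecessors.\<close>

theorem pd_1_left_part:
  fixes X :: "('r, 'm) module" and I :: "'r small_module set"
  assumes I: "ind_representatives R I"
    and X: "fg_left_module R X" "indecomposable R X" "pd R X = 1"
    and X': "X' \<in> I" "lmod_iso R X X'"
  shows "X' \<in> left_part R I"
proof -
  have IL: "left_module R M" "finitely_generated R M" "indecomposable R M" if "M \<in> I" for M
    using I that by (auto simp: ind_representatives_def fg_left_module_def)
  have XL: "left_module R X" "finitely_generated R X" using X(1) by (auto simp: fg_left_module_def)
  \<comment> \<open>The class is stated for small modules, the type of the members of
    \<open>I\<close>; membership of \<open>X\<close> itself is transferred to \<open>X'\<close>
    along the isomorphism.\<close>
  define C where "C Y \<longleftrightarrow> (\<forall>y \<in> carrier Y. e1 \<odot>\<^bsub>Y\<^esub> y = \<zero>\<^bsub>Y\<^esub>) \<or> (\<exists>P p. presents P p Y)"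
    for Y :: "'r small_module"
  have pd: "pd R Y \<le> 1" if "Y \<in> I" "C Y" for Y
    using that(2) e2_module_resolution[OF IL(1,2)[OF that(1)]] presents_resolution[OF IL(1)[OF that(1)]]
    unfolding C_def by (auto intro: pd_le_1)
  have step: "C Y" if YZ: "(Y, Z) \<in> nonzero_morphism_rel R I" and Z: "C Z" for Y Z
  proof -
    obtain f y0 where *: "Y \<in> I" "Z \<in> I" "f \<in> lmod_hom R Y Z" "y0 \<in> carrier Y" "f y0 \<noteq> \<zero>\<^bsub>Z\<^esub>"
      using YZ by (auto simp: nonzero_morphism_rel_def)
    note Y = IL[OF *(1)] and ZL = IL[OF *(2)]
    interpret f: lmod_homomorphism R Y Z f by (rule lmod_homomorphismI[OF Y(1) ZL(1) *(3)])
    from indecomposable_cases[OF Y] show "C Y"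
    proof
      assume g: "gen1 Y"
      from Z show "C Y"
        unfolding C_def[of Z]
      proof
        assume Ze: "\<forall>y\<in>carrier Z. e1 \<odot>\<^bsub>Z\<^esub> y = \<zero>\<^bsub>Z\<^esub>"
        \<comment> \<open>The kernel of \<open>f\<close> contains \<open>e1 Y\<close>, hence all of
          \<open>Y\<close>, so this case admits no nonzero map from \<open>Y\<close> to
          \<open>Z\<close>.\<close>
        have "{x \<in> carrier Y. f x = \<zero>\<^bsub>Z\<^esub>} = carrier Y"
          by (rule gen1D[OF g f.kernel_submodule]) (use Ze in \<open>simp add: f.f_smult\<close>)
        then show ?thesis using *(4,5) by blast
      next
        assume "\<exists>P p. presents P p Z"
        then obtain P p where p: "presents P p Z" by blast
        have "\<exists>P p. presents P p Y"
          by (rule presents_pull[of Y Z P p f y0]) (use Y g ZL p * in simp_all)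
        then show ?thesis by (simp add: C_def)
      qed
    qed (simp add: C_def)
  qed
  obtain f where f: "f \<in> lmod_hom R X X'" "bij_betw f (carrier X) (carrier X')"
    using X'(2) by (auto simp: lmod_iso_def)
  interpret f: lmod_homomorphism R X X' f by (rule lmod_homomorphismI[OF XL(1) IL(1)[OF X'(1)] f(1)])
  have fonto: "f ` carrier X = carrier X'" and finj: "\<And>x. x \<in> carrier X \<Longrightarrow> f x = \<zero>\<^bsub>X'\<^esub> \<longleftrightarrow> x = \<zero>\<^bsub>X\<^esub>"
    using f(2) f.inj_iff by (auto simp: bij_betw_def)
  have CX: "C X'"
    using indecomposable_cases[OF XL X(2)]
  proof
    assume "gen1 X"
    then obtain P p where p: "presents P p X"
      using presents_exists[OF XL(1) _ X(2)] pd_eq_enat[of R X 1] X(3) by (auto simp: one_enat_def)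
    have pc: "p x \<in> carrier X" if "x \<in> carrier P" for x using p that by (auto simp: presents_def)
    have "presents P (\<lambda>x. f (p x)) X'"
      using p finj[OF pc] fonto lmod_hom_comp[of p R P X f X'] f(1)
      unfolding presents_def by (auto simp: image_image[symmetric] cong: conj_cong)
    then show ?thesis by (auto simp: C_def)
  next
    assume *: "\<forall>x\<in>carrier X. e1 \<odot>\<^bsub>X\<^esub> x = \<zero>\<^bsub>X\<^esub>"
    have "e1 \<odot>\<^bsub>X'\<^esub> f x = \<zero>\<^bsub>X'\<^esub>" if "x \<in> carrier X" for x using * that by (simp add: f.f_smult[symmetric])
    then show ?thesis unfolding C_def fonto[symmetric] by auto
  qed
  \<comment> \<open>Induction along the path, starting at its end \<open>X'\<close> and moving
    backwards.\<close>
  have "C Y" if "predecessor R I Y X'" for Y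
    using that unfolding predecessor_def
    by (induction rule: converse_trancl_induct) (auto intro: step CX)
  then show ?thesis using X'(1) pd by (auto simp: left_part_def)
qed

end

section \<open>The duplicated algebra of a hereditary algebra\<close>

locale hereditary_algebra =
  fixes K :: "('k, 'x) ring_scheme" and H :: "('k, 'h) module"
  assumes findim: "findim_algebra K H" and hered: "hereditary H"
begin

lemma field_K: "field K" and alg_H: "assoc_algebra K H" and fg_H: "finitely_generated K H"
  using findim by (auto simp: findim_algebra_def)

sublocale K: field K by (rule field_K)
sublocale H: assoc_algebra K H by (rule alg_H)

lemma H_ring: "ring H" by (rule H.A.ring_axioms)

lemma H_group: "abelian_group H" by (rule ring.is_abelian_group[OF H_ring])

lemmas H_ac = abelian_monoid.a_ac[OF abelian_group.axioms(1)[OF H_group]]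

lemma H_vector_space: "vector_space_mod K H"
  unfolding vector_space_mod_def left_module_def vector_space_mod_axioms_def left_module_axioms_def
  using field_K K.ring_axioms H.abelian_group_axioms
  by (simp add: H.smult_l_distr H.smult_r_distr H.smult_assoc1)

sublocale V: vector_space_mod K H by (rule H_vector_space)

section \<open>Functionals on \<open>H\<close> and the ring of triples\<close>

abbreviation D :: "('h \<Rightarrow> 'k) set" where "D \<equiv> dual_carrier K H"
abbreviation \<Lambda> :: "('k, 'h \<times> ('h \<Rightarrow> 'k) \<times> 'h) module" where "\<Lambda> \<equiv> duplicated_algebra K H"
definition D0 :: "'h \<Rightarrow> 'k" where "D0 = (\<lambda>x \<in> carrier H. \<zero>\<^bsub>K\<^esub>)"

lemma D0_apply [simp]: "x \<in> carrier H \<Longrightarrow> D0 x = \<zero>\<^bsub>K\<^esub>"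
  by (simp add: D0_def)

lemma D0_eqI: "(\<And>x. x \<in> carrier H \<Longrightarrow> f x = \<zero>\<^bsub>K\<^esub>) \<Longrightarrow> (\<lambda>x \<in> carrier H. f x) = D0"
  unfolding D0_def by (rule restrict_ext)

lemma D_I:
  assumes "\<And>x. x \<in> carrier H \<Longrightarrow> f x \<in> carrier K"
    "\<And>x y. x \<in> carrier H \<Longrightarrow> y \<in> carrier H \<Longrightarrow> f (x \<oplus>\<^bsub>H\<^esub> y) = f x \<oplus>\<^bsub>K\<^esub> f y"
    "\<And>c x. c \<in> carrier K \<Longrightarrow> x \<in> carrier H \<Longrightarrow> f (c \<odot>\<^bsub>H\<^esub> x) = c \<otimes>\<^bsub>K\<^esub> f x"
  shows "(\<lambda>x \<in> carrier H. f x) \<in> D"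
  using assms by (auto simp: dual_carrier_def lmod_hom_def)

lemma D_D:
  assumes "f \<in> D"
  shows "x \<in> carrier H \<Longrightarrow> f x \<in> carrier K"
    "x \<in> carrier H \<Longrightarrow> y \<in> carrier H \<Longrightarrow> f (x \<oplus>\<^bsub>H\<^esub> y) = f x \<oplus>\<^bsub>K\<^esub> f y"
    "c \<in> carrier K \<Longrightarrow> x \<in> carrier H \<Longrightarrow> f (c \<odot>\<^bsub>H\<^esub> x) = c \<otimes>\<^bsub>K\<^esub> f x"
    "(\<lambda>x \<in> carrier H. f x) = f" "f \<zero>\<^bsub>H\<^esub> = \<zero>\<^bsub>K\<^esub>"
proof -
  show *: "x \<in> carrier H \<Longrightarrow> f x \<in> carrier K"
    "x \<in> carrier H \<Longrightarrow> y \<in> carrier H \<Longrightarrow> f (x \<oplus>\<^bsub>H\<^esub> y) = f x \<oplus>\<^bsub>K\<^esub> f y"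
    "c \<in> carrier K \<Longrightarrow> x \<in> carrier H \<Longrightarrow> f (c \<odot>\<^bsub>H\<^esub> x) = c \<otimes>\<^bsub>K\<^esub> f x" for x y c
    using assms by (auto simp: dual_carrier_def lmod_hom_def)
  show "(\<lambda>x \<in> carrier H. f x) = f"
    using assms by (simp add: dual_carrier_def extensional_restrict)
  have "lmod_homomorphism K H (regular_module K) f"
    by (rule lmod_homomorphismI[OF V.left_module_axioms K.regular_left_module])
      (use assms in \<open>simp add: dual_carrier_def\<close>)
  from lmod_homomorphism.f_zero[OF this] show "f \<zero>\<^bsub>H\<^esub> = \<zero>\<^bsub>K\<^esub>" by simp
qed

lemma D_eqI:
  assumes "f \<in> D" "g \<in> D" "\<And>x. x \<in> carrier H \<Longrightarrow> f x = g x"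
  shows "f = g"
proof -
  have "(\<lambda>x \<in> carrier H. f x) = (\<lambda>x \<in> carrier H. g x)" using assms(3) by (rule restrict_ext)
  then show ?thesis using D_D(4)[OF assms(1)] D_D(4)[OF assms(2)] by simp
qed

lemma D_closed:
  "D0 \<in> D"
  "f \<in> D \<Longrightarrow> g \<in> D \<Longrightarrow> (\<lambda>x \<in> carrier H. f x \<oplus>\<^bsub>K\<^esub> g x) \<in> D"
  "f \<in> D \<Longrightarrow> (\<lambda>x \<in> carrier H. \<ominus>\<^bsub>K\<^esub> f x) \<in> D"
  "c \<in> carrier K \<Longrightarrow> f \<in> D \<Longrightarrow> (\<lambda>x \<in> carrier H. c \<otimes>\<^bsub>K\<^esub> f x) \<in> D"
  "a \<in> carrier H \<Longrightarrow> f \<in> D \<Longrightarrow> (\<lambda>x \<in> carrier H. f (a \<otimes>\<^bsub>H\<^esub> x)) \<in> D"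
  "a \<in> carrier H \<Longrightarrow> f \<in> D \<Longrightarrow> (\<lambda>x \<in> carrier H. f (x \<otimes>\<^bsub>H\<^esub> a)) \<in> D"
  "a \<in> carrier H \<Longrightarrow> b \<in> carrier H \<Longrightarrow> f \<in> D \<Longrightarrow> g \<in> D \<Longrightarrow>
    (\<lambda>x \<in> carrier H. f (a \<otimes>\<^bsub>H\<^esub> x) \<oplus>\<^bsub>K\<^esub> g (x \<otimes>\<^bsub>H\<^esub> b)) \<in> D"
  unfolding D0_def
  by (rule D_I; simp add: D_D K.r_distr K.a_ac K.m_ac K.minus_add K.r_minus H.A.r_distr H.A.l_distr
      H.smult_mult_left H.smult_mult_right)+

lemma \<Lambda>_simps [simp]:
  "carrier \<Lambda> = carrier H \<times> D \<times> carrier H"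
  "one \<Lambda> = (\<one>\<^bsub>H\<^esub>, D0, \<one>\<^bsub>H\<^esub>)" "zero \<Lambda> = (\<zero>\<^bsub>H\<^esub>, D0, \<zero>\<^bsub>H\<^esub>)"
  "(a, f, b) \<oplus>\<^bsub>\<Lambda>\<^esub> (a', f', b') = (a \<oplus>\<^bsub>H\<^esub> a', (\<lambda>x \<in> carrier H. f x \<oplus>\<^bsub>K\<^esub> f' x), b \<oplus>\<^bsub>H\<^esub> b')"
  "(a, f, b) \<otimes>\<^bsub>\<Lambda>\<^esub> (a', f', b') = (a \<otimes>\<^bsub>H\<^esub> a',
    (\<lambda>x \<in> carrier H. f (a' \<otimes>\<^bsub>H\<^esub> x) \<oplus>\<^bsub>K\<^esub> f' (x \<otimes>\<^bsub>H\<^esub> b)), b \<otimes>\<^bsub>H\<^esub> b')"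
  by (simp_all add: duplicated_algebra_def D0_def)

lemma \<Lambda>_ring: "ring \<Lambda>"
proof (rule ringI)
  show "abelian_group \<Lambda>"
  proof (rule abelian_groupI)
    fix r assume "r \<in> carrier \<Lambda>"
    then obtain a f b where r: "r = (a, f, b)" "a \<in> carrier H" "f \<in> D" "b \<in> carrier H" by auto
    have "(\<ominus>\<^bsub>H\<^esub> a, (\<lambda>x \<in> carrier H. \<ominus>\<^bsub>K\<^esub> f x), \<ominus>\<^bsub>H\<^esub> b) \<oplus>\<^bsub>\<Lambda>\<^esub> r = \<zero>\<^bsub>\<Lambda>\<^esub>"
      using r by (auto simp: abelian_group.l_neg[OF H_group] K.l_neg D_D intro!: restrict_ext D0_eqI)
    then show "\<exists>s\<in>carrier \<Lambda>. s \<oplus>\<^bsub>\<Lambda>\<^esub> r = \<zero>\<^bsub>\<Lambda>\<^esub>"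
      using r D_closed by (intro bexI[of _ "(\<ominus>\<^bsub>H\<^esub> a, (\<lambda>x \<in> carrier H. \<ominus>\<^bsub>K\<^esub> f x), \<ominus>\<^bsub>H\<^esub> b)"]) auto
    have "(\<lambda>x \<in> carrier H. D0 x \<oplus>\<^bsub>K\<^esub> f x) = f"
      by (rule D_eqI) (use r D_closed in \<open>simp_all add: D_D\<close>)
    then show "\<zero>\<^bsub>\<Lambda>\<^esub> \<oplus>\<^bsub>\<Lambda>\<^esub> r = r" using r by simp
  qed (auto simp: D_closed D_D H_ac K.a_ac intro!: restrict_ext D0_eqI)
  show "Group.monoid \<Lambda>"
  proof (rule monoidI)
    fix r assume "r \<in> carrier \<Lambda>"
    then obtain a f b where r: "r = (a, f, b)" "a \<in> carrier H" "f \<in> D" "b \<in> carrier H" by auto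
    have "(\<lambda>x \<in> carrier H. D0 (a \<otimes>\<^bsub>H\<^esub> x) \<oplus>\<^bsub>K\<^esub> f (x \<otimes>\<^bsub>H\<^esub> \<one>\<^bsub>H\<^esub>)) = f"
      by (rule D_eqI) (use r D_closed in \<open>simp_all add: D_D\<close>)
    then show "\<one>\<^bsub>\<Lambda>\<^esub> \<otimes>\<^bsub>\<Lambda>\<^esub> r = r" using r by simp
    have "(\<lambda>x \<in> carrier H. f (\<one>\<^bsub>H\<^esub> \<otimes>\<^bsub>H\<^esub> x) \<oplus>\<^bsub>K\<^esub> D0 (x \<otimes>\<^bsub>H\<^esub> b)) = f"
      by (rule D_eqI) (use r D_closed in \<open>simp_all add: D_D\<close>)
    then show "r \<otimes>\<^bsub>\<Lambda>\<^esub> \<one>\<^bsub>\<Lambda>\<^esub> = r" using r by simp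
  qed (auto simp: D_closed D_D H.A.m_assoc K.a_assoc intro!: restrict_ext D0_eqI)
qed (auto simp: D_D H.A.l_distr H.A.r_distr K.a_ac intro!: restrict_ext D0_eqI)

text \<open>Scalar matrices. Left and right multiplication by \<open>\<iota> c\<close> are both the
  scalar action, so restricting scalars along \<open>\<iota>\<close> recovers the vector space
  structure of the duplicated algebra.\<close>

definition \<iota> :: "'k \<Rightarrow> 'h \<times> ('h \<Rightarrow> 'k) \<times> 'h"
  where "\<iota> c = (c \<odot>\<^bsub>H\<^esub> \<one>\<^bsub>H\<^esub>, D0, c \<odot>\<^bsub>H\<^esub> \<one>\<^bsub>H\<^esub>)"

lemma \<iota>_smult:
  "c \<in> carrier K \<Longrightarrow> a \<in> carrier H \<Longrightarrow> f \<in> D \<Longrightarrow> b \<in> carrier H \<Longrightarrow>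
    \<iota> c \<otimes>\<^bsub>\<Lambda>\<^esub> (a, f, b) = (c \<odot>\<^bsub>H\<^esub> a, (\<lambda>x \<in> carrier H. c \<otimes>\<^bsub>K\<^esub> f x), c \<odot>\<^bsub>H\<^esub> b)"
  "c \<in> carrier K \<Longrightarrow> a \<in> carrier H \<Longrightarrow> f \<in> D \<Longrightarrow> b \<in> carrier H \<Longrightarrow>
    (a, f, b) \<otimes>\<^bsub>\<Lambda>\<^esub> \<iota> c = (c \<odot>\<^bsub>H\<^esub> a, (\<lambda>x \<in> carrier H. c \<otimes>\<^bsub>K\<^esub> f x), c \<odot>\<^bsub>H\<^esub> b)"
  by (auto simp: \<iota>_def H.smult_mult_left H.smult_mult_right D_D intro!: restrict_ext D0_eqI)

lemma e_mult:
  assumes "a \<in> carrier H" "f \<in> D" "b \<in> carrier H"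
  shows "(\<one>\<^bsub>H\<^esub>, D0, \<zero>\<^bsub>H\<^esub>) \<otimes>\<^bsub>\<Lambda>\<^esub> (a, f, b) = (a, D0, \<zero>\<^bsub>H\<^esub>)"
    "(\<zero>\<^bsub>H\<^esub>, D0, \<one>\<^bsub>H\<^esub>) \<otimes>\<^bsub>\<Lambda>\<^esub> (a, f, b) = (\<zero>\<^bsub>H\<^esub>, f, b)"
    "(a, f, b) \<otimes>\<^bsub>\<Lambda>\<^esub> (\<one>\<^bsub>H\<^esub>, D0, \<zero>\<^bsub>H\<^esub>) = (a, f, \<zero>\<^bsub>H\<^esub>)"
    "(a, f, b) \<otimes>\<^bsub>\<Lambda>\<^esub> (\<zero>\<^bsub>H\<^esub>, D0, \<one>\<^bsub>H\<^esub>) = (\<zero>\<^bsub>H\<^esub>, D0, b)"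
proof -
  have "(\<lambda>x \<in> carrier H. f x) = f" by (rule D_D) fact
  then show "(\<one>\<^bsub>H\<^esub>, D0, \<zero>\<^bsub>H\<^esub>) \<otimes>\<^bsub>\<Lambda>\<^esub> (a, f, b) = (a, D0, \<zero>\<^bsub>H\<^esub>)"
    "(\<zero>\<^bsub>H\<^esub>, D0, \<one>\<^bsub>H\<^esub>) \<otimes>\<^bsub>\<Lambda>\<^esub> (a, f, b) = (\<zero>\<^bsub>H\<^esub>, f, b)"
    "(a, f, b) \<otimes>\<^bsub>\<Lambda>\<^esub> (\<one>\<^bsub>H\<^esub>, D0, \<zero>\<^bsub>H\<^esub>) = (a, f, \<zero>\<^bsub>H\<^esub>)"
    "(a, f, b) \<otimes>\<^bsub>\<Lambda>\<^esub> (\<zero>\<^bsub>H\<^esub>, D0, \<one>\<^bsub>H\<^esub>) = (\<zero>\<^bsub>H\<^esub>, D0, b)"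
    using assms by (auto simp: D_D D0_def[symmetric] cong: restrict_cong)
qed

text \<open>Finite dimensional reflexivity. With vectors \<open>b i\<close> and functionals
  \<open>\<beta> i\<close> forming a dual basis of \<open>H\<close>, every \<open>f\<close> is the
  sum of the \<open>f (b i) \<beta> i\<close>, so the functional on \<open>D\<close> is evaluation
  at the sum of the \<open>\<xi> (0, \<beta> i, 0) b i\<close>.\<close>

lemma D_reflexive:
  assumes \<xi>: "\<xi> \<in> lmod_hom K (restrict_scalars \<iota> (regular_module \<Lambda>)) (regular_module K)"
  shows "\<exists>h \<in> carrier H. \<forall>f \<in> D. f h = \<xi> (\<zero>\<^bsub>H\<^esub>, f, \<zero>\<^bsub>H\<^esub>)"
proof -
  note \<xi>D = lmod_homD[OF \<xi>]
  obtain n b \<beta>' where *: "\<And>j. j < n \<Longrightarrow> b j \<in> carrier H"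
    "\<And>j. j < n \<Longrightarrow> \<one>\<^bsub>K\<^esub> \<odot>\<^bsub>H\<^esub> b j = b j"
    "\<And>j. j < n \<Longrightarrow> \<beta>' j \<in> lmod_hom K H (regular_module K)"
    "\<And>j p. j < n \<Longrightarrow> p \<in> carrier H \<Longrightarrow> \<beta>' j p \<otimes>\<^bsub>K\<^esub> \<one>\<^bsub>K\<^esub> = \<beta>' j p"
    "\<And>p. p \<in> carrier H \<Longrightarrow> comb H n b (\<lambda>j. \<beta>' j p) = p"
    by (rule has_dual_basisE[OF V.finitely_generated_proj[OF fg_H]]) (rule that)
  \<comment> \<open>Members of \<open>D\<close> are \<open>undefined\<close> outside the carrier,
    which the functionals of a dual basis need not be.\<close>
  define \<beta> where "\<beta> j = (\<lambda>x \<in> carrier H. \<beta>' j x)" for j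
  have \<beta>: "\<beta> j \<in> D" if "j < n" for j
    unfolding \<beta>_def using lmod_homD[OF *(3)[OF that]] by (intro D_I) auto
  define z where "z f = \<xi> (\<zero>\<^bsub>H\<^esub>, f, \<zero>\<^bsub>H\<^esub>)" for f
  have z_closed: "z f \<in> carrier K" if "f \<in> D" for f
    unfolding z_def using \<xi>D(1)[of "(\<zero>\<^bsub>H\<^esub>, f, \<zero>\<^bsub>H\<^esub>)"] that by simp
  have z_add: "z (\<lambda>x \<in> carrier H. f x \<oplus>\<^bsub>K\<^esub> g x) = z f \<oplus>\<^bsub>K\<^esub> z g" if "f \<in> D" "g \<in> D" for f g
    unfolding z_def using \<xi>D(2)[of "(\<zero>\<^bsub>H\<^esub>, f, \<zero>\<^bsub>H\<^esub>)" "(\<zero>\<^bsub>H\<^esub>, g, \<zero>\<^bsub>H\<^esub>)"] that by simp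
  have z_smult: "z (\<lambda>x \<in> carrier H. c \<otimes>\<^bsub>K\<^esub> f x) = c \<otimes>\<^bsub>K\<^esub> z f" if "c \<in> carrier K" "f \<in> D" for c f
    unfolding z_def using \<xi>D(3)[of c "(\<zero>\<^bsub>H\<^esub>, f, \<zero>\<^bsub>H\<^esub>)"] that \<iota>_smult(1)[of c "\<zero>\<^bsub>H\<^esub>" f "\<zero>\<^bsub>H\<^esub>"]
    by simp
  have z_zero: "z D0 = \<zero>\<^bsub>K\<^esub>"
  proof -
    have "(\<lambda>x \<in> carrier H. \<zero>\<^bsub>K\<^esub> \<otimes>\<^bsub>K\<^esub> D0 x) = D0" by (rule D0_eqI) simp
    then show ?thesis using z_smult[of "\<zero>\<^bsub>K\<^esub>" D0] z_closed[of D0] D_closed(1) by simp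
  qed
  define h where "h = msum H n (\<lambda>i. z (\<beta> i) \<odot>\<^bsub>H\<^esub> b i)"
  have hc: "h \<in> carrier H"
    unfolding h_def by (rule abelian_group.msum_closed[OF H_group]) (use * \<beta> z_closed in auto)
  have "f h = z f" if f: "f \<in> D" for f
  proof -
    \<comment> \<open>Partial sums of the expansion of \<open>f\<close> in the
      \<open>\<beta> i\<close>; the induction evaluates \<open>z\<close> on them, adding one summand
      at a time.\<close>
    define F where "F k = (\<lambda>x \<in> carrier H. msum K k (\<lambda>i. f (b i) \<otimes>\<^bsub>K\<^esub> \<beta> i x))" for k
    have F: "F k \<in> D \<and> z (F k) = msum K k (\<lambda>i. f (b i) \<otimes>\<^bsub>K\<^esub> z (\<beta> i))" if "k \<le> n" for k
      using that
    proof (induction k)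
      case 0
      have "F 0 = D0" unfolding F_def by (rule D0_eqI) simp
      then show ?case by (simp add: D_closed z_zero)
    next
      case (Suc k)
      then have k: "k < n" by simp
      define g where "g = (\<lambda>x \<in> carrier H. f (b k) \<otimes>\<^bsub>K\<^esub> \<beta> k x)"
      have g: "g \<in> D" unfolding g_def by (rule D_closed) (use k * \<beta> D_D(1)[OF f] in auto)
      have zg: "z g = f (b k) \<otimes>\<^bsub>K\<^esub> z (\<beta> k)"
        unfolding g_def by (rule z_smult) (use k * \<beta> D_D(1)[OF f] in auto)
      have "F (Suc k) = (\<lambda>x \<in> carrier H. F k x \<oplus>\<^bsub>K\<^esub> g x)"
        unfolding F_def by (rule restrict_ext) (simp add: g_def)
      then show ?case using Suc g zg D_closed(2) z_add by (simp del: restrict_apply)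
    qed
    have fm: "f (msum H k g) = msum K k (\<lambda>i. f (g i))" if "\<And>i. i < k \<Longrightarrow> g i \<in> carrier H" for k g
      using that by (induction k) (simp_all add: D_D[OF f] abelian_group.msum_closed[OF H_group])
    have "F n = f"
    proof (rule D_eqI)
      fix x assume x: "x \<in> carrier H"
      note \<beta>c = D_D(1)[OF \<beta> x]
      have "f x = f (msum H n (\<lambda>i. \<beta> i x \<odot>\<^bsub>H\<^esub> b i))" using *(5)[OF x] x by (simp add: comb_def \<beta>_def)
      also have "\<dots> = msum K n (\<lambda>i. f (\<beta> i x \<odot>\<^bsub>H\<^esub> b i))" by (rule fm) (use * \<beta>c in auto)
      also have "\<dots> = msum K n (\<lambda>i. f (b i) \<otimes>\<^bsub>K\<^esub> \<beta> i x)"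
        by (rule msum_cong) (use * \<beta>c in \<open>simp add: D_D[OF f] K.m_comm\<close>)
      finally show "F n x = f x" using x by (simp add: F_def)
    qed (use F f in auto)
    then have "z f = msum K n (\<lambda>i. f (b i) \<otimes>\<^bsub>K\<^esub> z (\<beta> i))" using F[of n] by simp
    also have "\<dots> = msum K n (\<lambda>i. f (z (\<beta> i) \<odot>\<^bsub>H\<^esub> b i))"
      by (rule msum_cong) (use * \<beta> z_closed in \<open>simp add: D_D[OF f] K.m_comm\<close>)
    also have "\<dots> = f h" unfolding h_def by (rule fm[symmetric]) (use * \<beta> z_closed in auto)
    finally show ?thesis by simp
  qed
  then show ?thesis using hc by (auto simp: z_def)
qed

lemma D_separates:
  assumes "h \<in> carrier H" "\<And>f. f \<in> D \<Longrightarrow> f h = \<zero>\<^bsub>K\<^esub>"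
  shows "h = \<zero>\<^bsub>H\<^esub>"
proof (rule ccontr)
  assume "h \<noteq> \<zero>\<^bsub>H\<^esub>"
  then obtain g where g: "g \<in> lmod_hom K H (regular_module K)" "g h \<noteq> \<zero>\<^bsub>K\<^esub>"
    using V.separating_functional[OF V.zero_submodule assms(1)] by auto
  have "(\<lambda>x \<in> carrier H. g x) \<in> D" using lmod_homD[OF g(1)] by (intro D_I) auto
  then show False using assms g(2) by fastforce
qed

text \<open>The condition confines \<open>J\<close> to triples \<open>(0, 0, h)\<close>, on which
  the ring acts through its lower right entry. So \<open>J\<close> is a left ideal \<open>I\<close>
  of \<open>H\<close>, and a dual basis of \<open>I\<close> becomes one of \<open>J\<close>.\<close>

lemma hereditary_corner:
  assumes J: "submodule J \<Lambda> (regular_module \<Lambda>)" "\<And>x. x \<in> J \<Longrightarrow> x \<otimes>\<^bsub>\<Lambda>\<^esub> (\<zero>\<^bsub>H\<^esub>, D0, \<one>\<^bsub>H\<^esub>) = x"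
  shows "proj \<Lambda> ((regular_module \<Lambda>)\<lparr>carrier := J\<rparr>)"
proof -
  interpret L: left_module \<Lambda> "regular_module \<Lambda>" by (rule ring.regular_left_module[OF \<Lambda>_ring])
  interpret RH: left_module H "regular_module H" by (rule ring.regular_left_module[OF H_ring])
  note Jd = L.submoduleD[OF J(1)]
  have J_form: "\<exists>h \<in> carrier H. x = (\<zero>\<^bsub>H\<^esub>, D0, h)" if x: "x \<in> J" for x
  proof -
    obtain a f b where "x = (a, f, b)" "a \<in> carrier H" "f \<in> D" "b \<in> carrier H" using Jd(7)[OF x] by auto
    then show ?thesis using J(2)[OF x] e_mult(4) by auto
  qed
  define I where "I = {h \<in> carrier H. (\<zero>\<^bsub>H\<^esub>, D0, h) \<in> J}"
  have J_I: thesis if "x \<in> J" "\<And>h. x = (\<zero>\<^bsub>H\<^esub>, D0, h) \<Longrightarrow> h \<in> I \<Longrightarrow> thesis" for x thesis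
    using J_form[OF that(1)] that by (auto simp: I_def)
  have D00: "(\<lambda>x \<in> carrier H. D0 x \<oplus>\<^bsub>K\<^esub> D0 x) = D0" by (rule D0_eqI) simp
  have act: "(a, f, b) \<otimes>\<^bsub>\<Lambda>\<^esub> (\<zero>\<^bsub>H\<^esub>, D0, h) = (\<zero>\<^bsub>H\<^esub>, D0, b \<otimes>\<^bsub>H\<^esub> h)"
    if "a \<in> carrier H" "f \<in> D" "b \<in> carrier H" "h \<in> carrier H" for a f b h
    using that by (auto simp: D_D intro!: restrict_ext D0_eqI)
  have I: "submodule I H (regular_module H)"
  proof (rule RH.submoduleI)
    show "\<zero>\<^bsub>regular_module H\<^esub> \<in> I" using Jd(2) by (simp add: I_def)
    show "x \<oplus>\<^bsub>regular_module H\<^esub> y \<in> I" if "x \<in> I" "y \<in> I" for x y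
      using that Jd(3)[of "(\<zero>\<^bsub>H\<^esub>, D0, x)" "(\<zero>\<^bsub>H\<^esub>, D0, y)"] D00 by (simp add: I_def)
    show "a \<odot>\<^bsub>regular_module H\<^esub> x \<in> I" if "a \<in> carrier H" "x \<in> I" for a x
      using that Jd(4)[of "(\<zero>\<^bsub>H\<^esub>, D0, a)" "(\<zero>\<^bsub>H\<^esub>, D0, x)"] act[of "\<zero>\<^bsub>H\<^esub>" D0 a x] D_closed(1)
      by (simp add: I_def)
  qed (auto simp: I_def)
  have "proj H ((regular_module H)\<lparr>carrier := I\<rparr>)"
    using hered I unfolding hereditary_def by (blast intro: projective_proj(2))
  then obtain n x \<phi> where *: "\<And>j. j < n \<Longrightarrow> x j \<in> I" "\<And>j. j < n \<Longrightarrow> \<one>\<^bsub>H\<^esub> \<otimes>\<^bsub>H\<^esub> x j = x j"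
    "\<And>j. j < n \<Longrightarrow> \<phi> j \<in> lmod_hom H ((regular_module H)\<lparr>carrier := I\<rparr>) (regular_module H)"
    "\<And>j p. j < n \<Longrightarrow> p \<in> I \<Longrightarrow> \<phi> j p \<otimes>\<^bsub>H\<^esub> \<one>\<^bsub>H\<^esub> = \<phi> j p"
    "\<And>p. p \<in> I \<Longrightarrow> comb (regular_module H) n x (\<lambda>j. \<phi> j p) = p"
    by (rule has_dual_basisE) (use that in auto)
  note \<phi>D = lmod_homD[OF *(3), simplified]
  have xc: "x j \<in> carrier H" if "j < n" for j using *(1)[OF that] by (simp add: I_def)
  show ?thesis
  proof (rule has_dual_basisI[of n "\<lambda>j. (\<zero>\<^bsub>H\<^esub>, D0, x j)" _ _ "\<lambda>j p. (\<zero>\<^bsub>H\<^esub>, D0, \<phi> j (snd (snd p)))"])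
    fix j assume j: "j < n"
    show xJ: "(\<zero>\<^bsub>H\<^esub>, D0, x j) \<in> carrier ((regular_module \<Lambda>)\<lparr>carrier := J\<rparr>)" using *(1)[OF j] by (simp add: I_def)
    then show "\<one>\<^bsub>\<Lambda>\<^esub> \<odot>\<^bsub>(regular_module \<Lambda>)\<lparr>carrier := J\<rparr>\<^esub> (\<zero>\<^bsub>H\<^esub>, D0, x j) = (\<zero>\<^bsub>H\<^esub>, D0, x j)"
      using L.smult_one[of "(\<zero>\<^bsub>H\<^esub>, D0, x j)"] Jd(7) by (simp del: \<Lambda>_simps)
    show "(\<lambda>p. (\<zero>\<^bsub>H\<^esub>, D0, \<phi> j (snd (snd p)))) \<in> lmod_hom \<Lambda> ((regular_module \<Lambda>)\<lparr>carrier := J\<rparr>) (regular_module \<Lambda>)"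
    proof (rule lmod_homI)
      fix p assume "p \<in> carrier ((regular_module \<Lambda>)\<lparr>carrier := J\<rparr>)"
      then have "p \<in> J" by simp
      then obtain h where p: "p = (\<zero>\<^bsub>H\<^esub>, D0, h)" "h \<in> I" by (rule J_I)
      show "(\<zero>\<^bsub>H\<^esub>, D0, \<phi> j (snd (snd p))) \<in> carrier (regular_module \<Lambda>)"
        using p \<phi>D(1)[OF j] D_closed(1) by simp
      fix r assume "r \<in> carrier \<Lambda>"
      then obtain a f b where r: "r = (a, f, b)" "a \<in> carrier H" "f \<in> D" "b \<in> carrier H" by auto
      have hc: "h \<in> carrier H" using p by (simp add: I_def)
      show "(\<zero>\<^bsub>H\<^esub>, D0, \<phi> j (snd (snd (r \<odot>\<^bsub>(regular_module \<Lambda>)\<lparr>carrier := J\<rparr>\<^esub> p))))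
          = r \<odot>\<^bsub>regular_module \<Lambda>\<^esub> (\<zero>\<^bsub>H\<^esub>, D0, \<phi> j (snd (snd p)))"
        using r p hc act[OF r(2,3,4) hc] act[OF r(2,3,4) \<phi>D(1)[OF j p(2)]] \<phi>D(3)[OF j r(4) p(2)] by simp
    next
      fix p q assume "p \<in> carrier ((regular_module \<Lambda>)\<lparr>carrier := J\<rparr>)" "q \<in> carrier ((regular_module \<Lambda>)\<lparr>carrier := J\<rparr>)"
      then have pq: "p \<in> J" "q \<in> J" by simp_all
      obtain h where "p = (\<zero>\<^bsub>H\<^esub>, D0, h)" "h \<in> I" by (rule J_I[OF pq(1)])
      moreover obtain k where "q = (\<zero>\<^bsub>H\<^esub>, D0, k)" "k \<in> I" by (rule J_I[OF pq(2)])
      ultimately show "(\<zero>\<^bsub>H\<^esub>, D0, \<phi> j (snd (snd (p \<oplus>\<^bsub>(regular_module \<Lambda>)\<lparr>carrier := J\<rparr>\<^esub> q))))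
          = (\<zero>\<^bsub>H\<^esub>, D0, \<phi> j (snd (snd p))) \<oplus>\<^bsub>regular_module \<Lambda>\<^esub> (\<zero>\<^bsub>H\<^esub>, D0, \<phi> j (snd (snd q)))"
        using \<phi>D(2)[OF j] D00 by simp
    qed
    show "(\<zero>\<^bsub>H\<^esub>, D0, \<phi> j (snd (snd p))) \<otimes>\<^bsub>\<Lambda>\<^esub> \<one>\<^bsub>\<Lambda>\<^esub> = (\<zero>\<^bsub>H\<^esub>, D0, \<phi> j (snd (snd p)))"
      if "p \<in> carrier ((regular_module \<Lambda>)\<lparr>carrier := J\<rparr>)" for p
    proof -
      from that have "p \<in> J" by simp
      then obtain h where "p = (\<zero>\<^bsub>H\<^esub>, D0, h)" "h \<in> I" by (rule J_I)
      then have "(\<zero>\<^bsub>H\<^esub>, D0, \<phi> j (snd (snd p))) \<in> carrier \<Lambda>" using \<phi>D(1)[OF j] D_closed(1) by simp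
      then show ?thesis by (rule monoid.r_one[OF ring.is_monoid[OF \<Lambda>_ring]])
    qed
  next
    fix p assume "p \<in> carrier ((regular_module \<Lambda>)\<lparr>carrier := J\<rparr>)"
    then have "p \<in> J" by simp
    then obtain h where p: "p = (\<zero>\<^bsub>H\<^esub>, D0, h)" "h \<in> I" by (rule J_I)
    have "msum (regular_module \<Lambda>) k (\<lambda>j. (\<zero>\<^bsub>H\<^esub>, D0, \<phi> j h) \<otimes>\<^bsub>\<Lambda>\<^esub> (\<zero>\<^bsub>H\<^esub>, D0, x j))
        = (\<zero>\<^bsub>H\<^esub>, D0, msum (regular_module H) k (\<lambda>j. \<phi> j h \<otimes>\<^bsub>H\<^esub> x j))" if "k \<le> n" for k
      using that
    proof (induction k)
      case (Suc k)
      then have "k < n" by simp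
      then show ?case
        using Suc act[of "\<zero>\<^bsub>H\<^esub>" D0 "\<phi> k h" "x k"] D_closed(1) \<phi>D(1)[of k h] p(2) xc[of k] D00 by simp
    qed simp
    from this[of n] show "comb ((regular_module \<Lambda>)\<lparr>carrier := J\<rparr>) n (\<lambda>j. (\<zero>\<^bsub>H\<^esub>, D0, x j))
        (\<lambda>j. (\<zero>\<^bsub>H\<^esub>, D0, \<phi> j (snd (snd p)))) = p"
      using *(5)[OF p(2)] p by (simp add: comb_def)
  qed
qed

text \<open>Evaluating the lower left entry of a product at \<open>1\<close> amounts to evaluating
  functionals on \<open>H\<close>, so perfectness of the pairings reduces to the duality between
  \<open>H\<close> and \<open>D\<close>; \<open>\<tau>\<close> and \<open>\<tau>'\<close> move an
  entry between the two diagonal places.\<close>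

lemma duplicated_ring:
  "duplicated_ring \<Lambda> K \<iota> (\<one>\<^bsub>H\<^esub>, D0, \<zero>\<^bsub>H\<^esub>) (\<zero>\<^bsub>H\<^esub>, D0, \<one>\<^bsub>H\<^esub>) (\<lambda>(a, f, b). f \<one>\<^bsub>H\<^esub>)
    (\<lambda>(a, f, b). (\<zero>\<^bsub>H\<^esub>, D0, a)) (\<lambda>(a, f, b). (b, D0, \<zero>\<^bsub>H\<^esub>))"
  (is "duplicated_ring \<Lambda> K \<iota> ?e1 ?e2 ?lam ?\<tau> ?\<tau>'")
proof (intro duplicated_ring.intro duplicated_ring_axioms.intro \<Lambda>_ring field_K)
  have D00: "(\<lambda>x \<in> carrier H. D0 x \<oplus>\<^bsub>K\<^esub> D0 x) = D0" by (rule D0_eqI) simp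
  have corner1: "\<exists>a \<in> carrier H. h = (a, D0, \<zero>\<^bsub>H\<^esub>)" if h: "h \<in> carrier \<Lambda>" "?e1 \<otimes>\<^bsub>\<Lambda>\<^esub> h = h" for h
  proof -
    obtain a f b where "h = (a, f, b)" "a \<in> carrier H" "f \<in> D" "b \<in> carrier H" using h(1) by auto
    then show ?thesis using h(2) e_mult(1)[of a f b] by (simp del: \<Lambda>_simps(5))
  qed
  have corner2: "\<exists>b \<in> carrier H. h = (\<zero>\<^bsub>H\<^esub>, D0, b)" if h: "h \<in> carrier \<Lambda>" "h \<otimes>\<^bsub>\<Lambda>\<^esub> ?e2 = h" for h
  proof -
    obtain a f b where "h = (a, f, b)" "a \<in> carrier H" "f \<in> D" "b \<in> carrier H" using h(1) by auto
    then show ?thesis using h(2) e_mult(4)[of a f b] by (simp del: \<Lambda>_simps(5))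
  qed
  have corner21: "\<exists>f \<in> D. p = (\<zero>\<^bsub>H\<^esub>, f, \<zero>\<^bsub>H\<^esub>)"
    if p: "p \<in> carrier \<Lambda>" "?e2 \<otimes>\<^bsub>\<Lambda>\<^esub> p = p" "p \<otimes>\<^bsub>\<Lambda>\<^esub> ?e1 = p" for p
  proof -
    obtain a f b where "p = (a, f, b)" "a \<in> carrier H" "f \<in> D" "b \<in> carrier H" using p(1) by auto
    then show ?thesis using p(2,3) e_mult(2,3)[of a f b] by (simp del: \<Lambda>_simps(5))
  qed
  show "\<iota> c \<in> carrier \<Lambda>" if "c \<in> carrier K" for c using that D_closed(1) by (simp add: \<iota>_def)
  show "\<iota> (c \<oplus>\<^bsub>K\<^esub> d) = \<iota> c \<oplus>\<^bsub>\<Lambda>\<^esub> \<iota> d" if "c \<in> carrier K" "d \<in> carrier K" for c d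
    using that D00 by (simp add: \<iota>_def H.smult_l_distr)
  show "\<iota> (c \<otimes>\<^bsub>K\<^esub> d) = \<iota> c \<otimes>\<^bsub>\<Lambda>\<^esub> \<iota> d" if "c \<in> carrier K" "d \<in> carrier K" for c d
  proof -
    have "(\<lambda>x \<in> carrier H. c \<otimes>\<^bsub>K\<^esub> D0 x) = D0" by (rule D0_eqI) (use that in simp)
    then show ?thesis
      using that D_closed(1) \<iota>_smult(1)[of c "d \<odot>\<^bsub>H\<^esub> \<one>\<^bsub>H\<^esub>" D0 "d \<odot>\<^bsub>H\<^esub> \<one>\<^bsub>H\<^esub>"]
      by (simp add: \<iota>_def H.smult_assoc1 del: \<Lambda>_simps(5))
  qed
  show "\<iota> \<one>\<^bsub>K\<^esub> = \<one>\<^bsub>\<Lambda>\<^esub>" by (simp add: \<iota>_def)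
  show "\<iota> c \<otimes>\<^bsub>\<Lambda>\<^esub> r = r \<otimes>\<^bsub>\<Lambda>\<^esub> \<iota> c" if "c \<in> carrier K" "r \<in> carrier \<Lambda>" for c r
    using that \<iota>_smult[of c] by (cases r) (simp del: \<Lambda>_simps(5))
  show "?e1 \<in> carrier \<Lambda>" "?e2 \<in> carrier \<Lambda>" using D_closed(1) by simp_all
  show "?e1 \<oplus>\<^bsub>\<Lambda>\<^esub> ?e2 = \<one>\<^bsub>\<Lambda>\<^esub>" using D00 by simp
  show "?e1 \<otimes>\<^bsub>\<Lambda>\<^esub> r \<otimes>\<^bsub>\<Lambda>\<^esub> ?e2 = \<zero>\<^bsub>\<Lambda>\<^esub>" if "r \<in> carrier \<Lambda>" for r
    using that D_closed(1) by (cases r) (simp add: e_mult del: \<Lambda>_simps(5))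
  show "?lam \<in> lmod_hom K (restrict_scalars \<iota> (regular_module \<Lambda>)) (regular_module K)"
    by (rule lmod_homI) (auto simp: D_D \<iota>_smult simp del: \<Lambda>_simps(5))
  show "proj \<Lambda> ((regular_module \<Lambda>)\<lparr>carrier := J\<rparr>)"
    if "submodule J \<Lambda> (regular_module \<Lambda>)" "\<And>x. x \<in> J \<Longrightarrow> x \<otimes>\<^bsub>\<Lambda>\<^esub> ?e2 = x" for J
    by (rule hereditary_corner) fact+
  have mult_dual: "(\<zero>\<^bsub>H\<^esub>, f, b) \<otimes>\<^bsub>\<Lambda>\<^esub> (h, g, \<zero>\<^bsub>H\<^esub>) =
      (\<zero>\<^bsub>H\<^esub>, (\<lambda>x \<in> carrier H. f (h \<otimes>\<^bsub>H\<^esub> x) \<oplus>\<^bsub>K\<^esub> g (x \<otimes>\<^bsub>H\<^esub> b)), \<zero>\<^bsub>H\<^esub>)"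
    if "f \<in> D" "g \<in> D" "b \<in> carrier H" "h \<in> carrier H" for f g b h
    using that by simp
  show "\<exists>s\<in>carrier \<Lambda>. s \<otimes>\<^bsub>\<Lambda>\<^esub> ?e1 = s \<and>
      (\<forall>r\<in>carrier \<Lambda>. ?lam (?e2 \<otimes>\<^bsub>\<Lambda>\<^esub> r \<otimes>\<^bsub>\<Lambda>\<^esub> s) = \<xi> (?e2 \<otimes>\<^bsub>\<Lambda>\<^esub> r))"
    if \<xi>: "\<xi> \<in> lmod_hom K (restrict_scalars \<iota> (regular_module \<Lambda>)) (regular_module K)" for \<xi>
  proof -
    note \<xi>D = lmod_homD[OF \<xi>]
    \<comment> \<open>The representing element is \<open>(h, g, 0)\<close>: the lower left entry of
      \<open>(0, f, b) (h, g, 0)\<close> has the value \<open>f h + g b\<close> at \<open>1\<close>,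
      so \<open>h\<close> must represent \<open>\<xi>\<close> on the dual and \<open>g\<close> must
      be \<open>\<xi>\<close> on the lower right corner.\<close>
    obtain h where h: "h \<in> carrier H" "\<And>f. f \<in> D \<Longrightarrow> f h = \<xi> (\<zero>\<^bsub>H\<^esub>, f, \<zero>\<^bsub>H\<^esub>)"
      using D_reflexive[OF \<xi>] by auto
    define g where "g = (\<lambda>x \<in> carrier H. \<xi> (\<zero>\<^bsub>H\<^esub>, D0, x))"
    have g: "g \<in> D"
      unfolding g_def
    proof (rule D_I)
      fix x assume x: "x \<in> carrier H"
      show "\<xi> (\<zero>\<^bsub>H\<^esub>, D0, x) \<in> carrier K" using \<xi>D(1)[of "(\<zero>\<^bsub>H\<^esub>, D0, x)"] x D_closed(1) by simp
      show "\<xi> (\<zero>\<^bsub>H\<^esub>, D0, x \<oplus>\<^bsub>H\<^esub> y) = \<xi> (\<zero>\<^bsub>H\<^esub>, D0, x) \<oplus>\<^bsub>K\<^esub> \<xi> (\<zero>\<^bsub>H\<^esub>, D0, y)" if "y \<in> carrier H" for y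
        using \<xi>D(2)[of "(\<zero>\<^bsub>H\<^esub>, D0, x)" "(\<zero>\<^bsub>H\<^esub>, D0, y)"] x that D_closed(1) D00 by simp
      have "(\<lambda>x \<in> carrier H. c \<otimes>\<^bsub>K\<^esub> D0 x) = D0" if "c \<in> carrier K" for c
        by (rule D0_eqI) (use that in simp)
      then show "\<xi> (\<zero>\<^bsub>H\<^esub>, D0, c \<odot>\<^bsub>H\<^esub> x) = c \<otimes>\<^bsub>K\<^esub> \<xi> (\<zero>\<^bsub>H\<^esub>, D0, x)" if "c \<in> carrier K" for c
        using \<xi>D(3)[of c "(\<zero>\<^bsub>H\<^esub>, D0, x)"] x that D_closed(1) \<iota>_smult(1)[of c "\<zero>\<^bsub>H\<^esub>" D0 x]
        by (simp del: \<Lambda>_simps(5))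
    qed
    have main: "?lam (?e2 \<otimes>\<^bsub>\<Lambda>\<^esub> r \<otimes>\<^bsub>\<Lambda>\<^esub> (h, g, \<zero>\<^bsub>H\<^esub>)) = \<xi> (?e2 \<otimes>\<^bsub>\<Lambda>\<^esub> r)" if r0: "r \<in> carrier \<Lambda>" for r
    proof -
      obtain a f b where r: "r = (a, f, b)" "a \<in> carrier H" "f \<in> D" "b \<in> carrier H" using r0 by auto
      have e: "?e2 \<otimes>\<^bsub>\<Lambda>\<^esub> r = (\<zero>\<^bsub>H\<^esub>, f, b)" using e_mult(2) r by simp
      have "(\<zero>\<^bsub>H\<^esub>, f, b) = (\<zero>\<^bsub>H\<^esub>, f, \<zero>\<^bsub>H\<^esub>) \<oplus>\<^bsub>\<Lambda>\<^esub> (\<zero>\<^bsub>H\<^esub>, D0, b)"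
        using r D_D[OF r(3)] by (simp cong: restrict_cong)
      then have "\<xi> (\<zero>\<^bsub>H\<^esub>, f, b) = f h \<oplus>\<^bsub>K\<^esub> \<xi> (\<zero>\<^bsub>H\<^esub>, D0, b)"
        using \<xi>D(2)[of "(\<zero>\<^bsub>H\<^esub>, f, \<zero>\<^bsub>H\<^esub>)" "(\<zero>\<^bsub>H\<^esub>, D0, b)"] h(2)[OF r(3)] r D_closed(1) by simp
      then show ?thesis unfolding e mult_dual[OF r(3) g r(4) h(1)] using h r by (simp add: g_def)
    qed
    show ?thesis
      by (intro bexI[of _ "(h, g, \<zero>\<^bsub>H\<^esub>)"] conjI ballI main) (use h g e_mult(3) in simp_all)
  qed
  show "s = \<zero>\<^bsub>\<Lambda>\<^esub>" if s: "s \<in> carrier \<Lambda>" "s \<otimes>\<^bsub>\<Lambda>\<^esub> ?e1 = s"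
    "\<And>r. r \<in> carrier \<Lambda> \<Longrightarrow> ?lam (?e2 \<otimes>\<^bsub>\<Lambda>\<^esub> r \<otimes>\<^bsub>\<Lambda>\<^esub> s) = \<zero>\<^bsub>K\<^esub>" for s
  proof -
    obtain h g b where "s = (h, g, b)" "h \<in> carrier H" "g \<in> D" "b \<in> carrier H" using s(1) by auto
    then have s': "s = (h, g, \<zero>\<^bsub>H\<^esub>)" "h \<in> carrier H" "g \<in> D" using s(2) e_mult(3) by simp_all
    \<comment> \<open>With \<open>b = 0\<close> all functionals vanish at \<open>h\<close>; with
      \<open>f = 0\<close> the functional \<open>g\<close> vanishes.\<close>
    have *: "f h \<oplus>\<^bsub>K\<^esub> g b = \<zero>\<^bsub>K\<^esub>" if "f \<in> D" "b \<in> carrier H" for f b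
    proof -
      have "?e2 \<otimes>\<^bsub>\<Lambda>\<^esub> (\<zero>\<^bsub>H\<^esub>, f, b) = (\<zero>\<^bsub>H\<^esub>, f, b)" by (rule e_mult) (use that in simp_all)
      then show ?thesis using s(3)[of "(\<zero>\<^bsub>H\<^esub>, f, b)"] mult_dual[OF that(1) s'(3) that(2) s'(2)] that s' by simp
    qed
    have "h = \<zero>\<^bsub>H\<^esub>"
      by (rule D_separates[OF s'(2)]) (use *[of _ "\<zero>\<^bsub>H\<^esub>"] D_D(1,5) s' in force)
    moreover have "g = D0"
      by (rule D_eqI[OF s'(3) D_closed(1)]) (use *[OF D_closed(1)] D_D(1)[OF s'(3)] s'(2) in simp)
    ultimately show ?thesis using s' by simp
  qed
  show "?\<tau> h \<in> carrier \<Lambda> \<and> ?\<tau> h \<otimes>\<^bsub>\<Lambda>\<^esub> ?e2 = ?\<tau> h" if "h \<in> carrier \<Lambda>" "?e1 \<otimes>\<^bsub>\<Lambda>\<^esub> h = h" for h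
    using corner1[OF that] D_closed(1) e_mult(4) by auto
  show "?\<tau>' h \<in> carrier \<Lambda> \<and> ?e1 \<otimes>\<^bsub>\<Lambda>\<^esub> ?\<tau>' h = ?\<tau>' h" if "h \<in> carrier \<Lambda>" "h \<otimes>\<^bsub>\<Lambda>\<^esub> ?e2 = h" for h
    using corner2[OF that] D_closed(1) e_mult(1) by auto
  show "?\<tau> (?\<tau>' h) = h" if "h \<in> carrier \<Lambda>" "h \<otimes>\<^bsub>\<Lambda>\<^esub> ?e2 = h" for h
    using corner2[OF that] by auto
  show "?\<tau>' (g \<oplus>\<^bsub>\<Lambda>\<^esub> h) = ?\<tau>' g \<oplus>\<^bsub>\<Lambda>\<^esub> ?\<tau>' h"
    if "g \<in> carrier \<Lambda>" "g \<otimes>\<^bsub>\<Lambda>\<^esub> ?e2 = g" "h \<in> carrier \<Lambda>" "h \<otimes>\<^bsub>\<Lambda>\<^esub> ?e2 = h" for g h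
    using corner2[OF that(1,2)] corner2[OF that(3,4)] D00 by auto
  have DH: "(\<lambda>x \<in> carrier H. D0 (a \<otimes>\<^bsub>H\<^esub> x) \<oplus>\<^bsub>K\<^esub> D0 (x \<otimes>\<^bsub>H\<^esub> b)) = D0"
    if "a \<in> carrier H" "b \<in> carrier H" for a b
    by (rule D0_eqI) (use that in simp)
  show "?\<tau>' (?\<tau> g \<otimes>\<^bsub>\<Lambda>\<^esub> h) = g \<otimes>\<^bsub>\<Lambda>\<^esub> ?\<tau>' h"
    if "g \<in> carrier \<Lambda>" "?e1 \<otimes>\<^bsub>\<Lambda>\<^esub> g = g" "h \<in> carrier \<Lambda>" "h \<otimes>\<^bsub>\<Lambda>\<^esub> ?e2 = h" for g h
    using corner1[OF that(1,2)] corner2[OF that(3,4)] DH by auto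
  show "\<exists>p\<in>carrier \<Lambda>. ?e2 \<otimes>\<^bsub>\<Lambda>\<^esub> p = p \<and> p \<otimes>\<^bsub>\<Lambda>\<^esub> ?e1 = p \<and>
      (\<forall>h\<in>carrier \<Lambda>. ?e1 \<otimes>\<^bsub>\<Lambda>\<^esub> h = h \<longrightarrow> ?lam (p \<otimes>\<^bsub>\<Lambda>\<^esub> h) = \<xi> h)"
    if \<xi>: "\<xi> \<in> lmod_hom K (restrict_scalars \<iota> (regular_module \<Lambda>)) (regular_module K)" for \<xi>
  proof -
    note \<xi>D = lmod_homD[OF \<xi>]
    \<comment> \<open>The value of \<open>lam\<close> at \<open>(0, g, 0) (a, 0, 0)\<close> is
      \<open>g a\<close>, so \<open>g\<close> has to be \<open>\<xi>\<close> on the upper left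
      corner.\<close>
    define g where "g = (\<lambda>x \<in> carrier H. \<xi> (x, D0, \<zero>\<^bsub>H\<^esub>))"
    have g: "g \<in> D"
      unfolding g_def
    proof (rule D_I)
      fix x assume x: "x \<in> carrier H"
      show "\<xi> (x, D0, \<zero>\<^bsub>H\<^esub>) \<in> carrier K" using \<xi>D(1)[of "(x, D0, \<zero>\<^bsub>H\<^esub>)"] x D_closed(1) by simp
      show "\<xi> (x \<oplus>\<^bsub>H\<^esub> y, D0, \<zero>\<^bsub>H\<^esub>) = \<xi> (x, D0, \<zero>\<^bsub>H\<^esub>) \<oplus>\<^bsub>K\<^esub> \<xi> (y, D0, \<zero>\<^bsub>H\<^esub>)" if "y \<in> carrier H" for y
        using \<xi>D(2)[of "(x, D0, \<zero>\<^bsub>H\<^esub>)" "(y, D0, \<zero>\<^bsub>H\<^esub>)"] x that D_closed(1) D00 by simp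
      have "(\<lambda>x \<in> carrier H. c \<otimes>\<^bsub>K\<^esub> D0 x) = D0" if "c \<in> carrier K" for c
        by (rule D0_eqI) (use that in simp)
      then show "\<xi> (c \<odot>\<^bsub>H\<^esub> x, D0, \<zero>\<^bsub>H\<^esub>) = c \<otimes>\<^bsub>K\<^esub> \<xi> (x, D0, \<zero>\<^bsub>H\<^esub>)" if "c \<in> carrier K" for c
        using \<xi>D(3)[of c "(x, D0, \<zero>\<^bsub>H\<^esub>)"] x that D_closed(1) \<iota>_smult(1)[of c x D0 "\<zero>\<^bsub>H\<^esub>"]
        by (simp del: \<Lambda>_simps(5))
    qed
    have main: "?lam ((\<zero>\<^bsub>H\<^esub>, g, \<zero>\<^bsub>H\<^esub>) \<otimes>\<^bsub>\<Lambda>\<^esub> h) = \<xi> h" if "h \<in> carrier \<Lambda>" "?e1 \<otimes>\<^bsub>\<Lambda>\<^esub> h = h" for h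
      using corner1[OF that] g D_D(1)[OF g] by (auto simp: g_def)
    show ?thesis
      by (intro bexI[of _ "(\<zero>\<^bsub>H\<^esub>, g, \<zero>\<^bsub>H\<^esub>)"] conjI ballI impI main)
        (use g e_mult(2,3)[of "\<zero>\<^bsub>H\<^esub>" g "\<zero>\<^bsub>H\<^esub>"] in simp_all)
  qed
  have lam_mult: "?lam ((\<zero>\<^bsub>H\<^esub>, f, \<zero>\<^bsub>H\<^esub>) \<otimes>\<^bsub>\<Lambda>\<^esub> (a, D0, \<zero>\<^bsub>H\<^esub>)) = f a" if "f \<in> D" "a \<in> carrier H" for f a
    using that D_D(1)[OF that] by simp
  show "p = \<zero>\<^bsub>\<Lambda>\<^esub>" if p: "p \<in> carrier \<Lambda>" "?e2 \<otimes>\<^bsub>\<Lambda>\<^esub> p = p" "p \<otimes>\<^bsub>\<Lambda>\<^esub> ?e1 = p"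
    "\<And>h. h \<in> carrier \<Lambda> \<Longrightarrow> ?e1 \<otimes>\<^bsub>\<Lambda>\<^esub> h = h \<Longrightarrow> ?lam (p \<otimes>\<^bsub>\<Lambda>\<^esub> h) = \<zero>\<^bsub>K\<^esub>" for p
  proof -
    obtain f where f: "f \<in> D" "p = (\<zero>\<^bsub>H\<^esub>, f, \<zero>\<^bsub>H\<^esub>)" using corner21[OF p(1-3)] by auto
    have "f a = \<zero>\<^bsub>K\<^esub>" if a: "a \<in> carrier H" for a
      using p(4)[of "(a, D0, \<zero>\<^bsub>H\<^esub>)"] lam_mult[OF f(1) a] e_mult(1)[OF a D_closed(1)] f a D_closed(1)
      by (simp del: \<Lambda>_simps(5))
    then have "f = D0" by (intro D_eqI f D_closed) simp
    then show ?thesis using f by simp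
  qed
  show "?lam (?\<tau> h \<otimes>\<^bsub>\<Lambda>\<^esub> p) = ?lam (p \<otimes>\<^bsub>\<Lambda>\<^esub> h)"
    if "h \<in> carrier \<Lambda>" "?e1 \<otimes>\<^bsub>\<Lambda>\<^esub> h = h" "p \<in> carrier \<Lambda>" "?e2 \<otimes>\<^bsub>\<Lambda>\<^esub> p = p" "p \<otimes>\<^bsub>\<Lambda>\<^esub> ?e1 = p" for h p
    using corner1[OF that(1,2)] corner21[OF that(3-5)] D_D(1) by auto
qed

end

theorem proposition2p4:
  fixes K :: "('k, 'x) ring_scheme"
    and H :: "('k, 'h) module"
    and \<Lambda> :: "('k, 'h \<times> ('h \<Rightarrow> 'k) \<times> 'h) module"
    and ind\<Lambda> :: "('h \<times> ('h \<Rightarrow> 'k) \<times> 'h) small_module set"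
    and X :: "('h \<times> ('h \<Rightarrow> 'k) \<times> 'h, 'm) module"
    and X' :: "('h \<times> ('h \<Rightarrow> 'k) \<times> 'h) small_module"
  assumes "algebraically_closed K"
    and "findim_algebra K H" and "basic H" and "hereditary H"
    and "\<Lambda> = duplicated_algebra K H"
    and "ind_representatives \<Lambda> ind\<Lambda>"
    and "fg_left_module \<Lambda> X" and "indecomposable \<Lambda> X" and "pd \<Lambda> X = 1"
    and "X' \<in> ind\<Lambda>" and "lmod_iso \<Lambda> X X'"
  shows "X' \<in> left_part \<Lambda> ind\<Lambda>"
proof -
  have "hereditary_algebra K H" using assms(2,4) by (rule hereditary_algebra.intro)
  from duplicated_ring.pd_1_left_part[OF hereditary_algebra.duplicated_ring[OF this]]
  show ?thesis using assms(6-11) unfolding assms(5) .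
qed

end
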